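(* When $g\ge 2$, it is possible for two $2$-superelliptic subsets $S,S'\subset\mathbb{P}^1_K$ of cardinality $2g+2$ to induce the same groups $\Gamma\lhd\Gamma_0$ but not to have the same position. An example (with $p=2$, $g=2$) is as follows. Let $K=\mathbb{Q}_3(\zeta_3)$ and $$S=\{a_0=-9,\ b_0=9,\ a_1=3,\ b_1=12,\ a_2=1,\ b_2=\infty\}\subset\mathbb{P}^1_K.$$ For $i=0,1,2$ let $s_i\in\mathrm{PGL}_2(K)$ be the unique fractional linear transformation of order $2$ fixing $a_i$ and $b_i$ (so $s_0$ is $z\mapsto 81/z$). Then $\Gamma:=\langle s_0s_1,s_0s_2\rangle$ is a Schottky group. Let $$S'=\{a_0'=a_0=-9,\ b_0'=b_0=9,\ a_1'=s_0(a_1)=27,\ b_1'=s_0(b_1)=27/4,\ a_2'=a_2=1,\ b_2'=b_2=\infty\},$$ and let $\phi:S\to S'$ be the bijection $a_i\mapsto a_i'$, $b_i\mapsto b_i'$ for $0\le i\le 2$. Writing $\pi$ for reduction modulo the action of $\Gamma_0=\langle s_0,s_1,s_2\rangle$, we have $\pi\circ\phi=\pi$ on $S$. Put $s_i'=s_i$ for $i=0,2$ and $s_1'=s_0s_1s_0$. Then each $s_i'$ is the unique fractional linear transformation of order $2$ fixing $a_i'$ and $b_i'$, and $$\Gamma':=\langle s_0's_1',s_0's_2'\rangle=\langle (s_0s_1)^{-1},s_0s_2\rangle=\Gamma.$$ However, the conjecture of Gerritzen and van der Put (that a set of fixed points and its image under $\pi$ have the same position) cannot hold for $S$, because there is no $\sigma\in\mathrm{PGL}_2(K)$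 such that $\sigma(S')$ has the same combinatorial cluster data as $S$; more precisely, there is no $\sigma\in\mathrm{PGL}_2(K)$ such that $\sigma\circ\phi:S\to\sigma(S')$ acts as a bijection between the clusters of $S$ and the clusters of $\sigma(S')$. Indeed, the even-cardinality clusters of $S$ are $\{-9,9,3,12\}$, $\{-9,9\}$ and $\{3,12\}$, while the even-cardinality clusters of $S'$ are only $\{-9,9,27,27/4\}$ and $\{27,27/4\}$. Equivalently, in terms of position, the positions of $S$ and $S'$ are of different types (they are cases (a) and (b), respectively, in Gerritzen and van der Put's treatment of $g=2$).
   Context: Let $K$ be a field with discrete valuation $v$, ring of integers $R$ and residue field $k$; write $\mathbb{P}^1_K=K\cup\{\infty\}$. *Clusters.* For a finite subset $A\subset\mathbb{P}^1_K$, a subset $\mathfrak{s}\subseteq A$ is a cluster of $A$ if $\mathfrak{s}=A\cap D$ for some disc $D\subset K$ in the metric induced by $v$. The combinatorial cluster data of $A$ is the data of which subsets of $A$ are clusters. *Position.* Let $A\subset\mathbb{P}^1_K$ be finite with at least $3$ elements. For an ordered triple $\underline z=(z_0,z_1,z_\infty)$ of distinct elements of $A$, let $\gamma_{\underline z}\in\mathrm{PGL}_2(K)$ send $z_0,z_1,z_\infty$ to $0,1,\infty$, and let $\bar\gamma_{\underline z}:\mathbb{P}^1_K\to\mathbb{P}^1_k$ be its composition with reduction. Two triples $\underline z,\underline w$ are equivalent if $\gamma_{\underline w}\gamma_{\underline z}^{-1}$ has invertible reduction over $k$. The product $R_A$ of the maps $\bar\gamma_{\underline z}$ over representatives of the equivalence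 classes has as its image a curve over $k$ whose components are copies of $\mathbb{P}^1_k$, one for each class, meeting only in ordinary double points, none of which is the image of a point of $A$. The tree $T(A)$ has these classes (equivalently, components) as vertices, with edges corresponding to the intersections of components. The position of $A$ is the tree $T(A)$ together with the map $r_A$ from $A$ to its vertices sending $z$ to the component containing $R_A(z)$. Given a bijection $\varphi:A\to A'$, the sets $A$ and $A'$ have the same position if there is a graph isomorphism $T(A)\to T(A')$ carrying $r_A$ to $r_{A'}\circ\varphi$. *Groups.* A Schottky group is a finitely generated free subgroup of $\mathrm{PGL}_2(K)$ acting discontinuously on the projective line. Given $S=\{a_0,b_0,\dots,a_g,b_g\}\subset\mathbb{P}^1_K$ of cardinality $2g+2$ and elements $s_i\in\mathrm{PGL}_2(K)$ of order $2$ fixing $a_i,b_i$, put $\Gamma_0=\langle s_0,\dots,s_g\rangle$ and $\Gamma=\langle s_0s_1,\dots,s_0s_g\rangle$. The set $S$ is called $2$-superelliptic if, for some such partition into pairs, $\Gamma$ is a Schottky group and $\Gamma_0$ cannot be generated by fewer than $g+1$ elements. In that case, with $\Omega$ the set of non-limit points of $\Gamma$, one has $\Omega/\Gamma_0\cong\mathbb{P}^1$ and $S\subset\Omega$, and the quotient map $\pi:\Omega\to\Omega/\Gamma_0\cong\mathbb{P}^1$ maps $S$ bijectively to the set $\mathcal{B}$ of branch points of the hyperelliptic curve $\Omega/\Gamma\to\Omega/\Gamma_0$. *Conjecture of Gerritzen and van der Put* (for residue characteristic $\ne 2$): with respect to the bijection $\pi:S\to\mathcal{B}$, the sets $S$ and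 $\mathcal{B}$ have the same position; equivalently, after possibly applying suitable fractional linear transformations to $S$ and to $\mathcal{B}$, they have the same combinatorial cluster data.
   Formalization: The conjecture is refuted as "it cannot hold for both S and S'": read for S alone the claim is false, since π(S) has the same position as S. The labels "cases (a) and (b)" are replaced by the statement that the positions differ under every bijection. *)

theory Defs
  imports
    "HOL-Algebra.Multiplicative_Group"
    "HOL-Analysis.Abstract_Limits"
    "HOL-Computational_Algebra.Fraction_Field"
    "HOL-Computational_Algebra.Primes"
begin

section \<open>The field \<open>\<rat>\<^sub>3(\<zeta>\<^sub>3)\<close> and its valuation\<close>

text \<open>A 3-adic integer is a compatible system of residues modulo the powers of 3;
  the compatibility condition forces \<open>0 \<le> x n < 3 ^ n\<close>.\<close>

typedef z3 = "{x :: nat \<Rightarrow> int. \<forall>n. x n = x (Suc n) mod 3 ^ n}"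
  by (rule exI[of _ "\<lambda>_. 0"]) simp

setup_lifting type_definition_z3

lemma z3_mod_Suc: "(k :: int) mod 3 ^ n = k mod 3 ^ Suc n mod 3 ^ n"
  by (simp add: mod_mod_cancel)

lemma z3_self:
  assumes "\<forall>n. x n = x (Suc n) mod (3 :: int) ^ n"
  shows "(\<lambda>n. x n mod 3 ^ n) = x"
proof
  fix n
  have "x n mod 3 ^ n = x (Suc n) mod 3 ^ n mod 3 ^ n"
    using spec[OF assms, of n] by (rule arg_cong)
  also have "\<dots> = x n"
    unfolding mod_mod_trivial using spec[OF assms, of n] by (rule sym)
  finally show "x n mod 3 ^ n = x n" .
qed

instantiation z3 :: comm_ring_1
begin

lift_definition zero_z3 :: z3 is "\<lambda>_. 0"
  by simp

lift_definition one_z3 :: z3 is "\<lambda>n. 1 mod 3 ^ n"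
  by (rule z3_mod_Suc)

lift_definition plus_z3 :: "z3 \<Rightarrow> z3 \<Rightarrow> z3" is "\<lambda>x y n. (x n + y n) mod 3 ^ n"
proof -
  fix x y :: "nat \<Rightarrow> int" and n :: nat
  assume x: "\<And>n. x n = x (Suc n) mod 3 ^ n" and y: "\<And>n. y n = y (Suc n) mod 3 ^ n"
  have "(x n + y n) mod 3 ^ n = (x (Suc n) mod 3 ^ n + y (Suc n) mod 3 ^ n) mod 3 ^ n"
    by (subst x, subst y) (rule refl)
  also have "\<dots> = (x (Suc n) + y (Suc n)) mod 3 ^ n"
    by (rule mod_add_eq)
  finally show "(x n + y n) mod 3 ^ n = (x (Suc n) + y (Suc n)) mod 3 ^ Suc n mod 3 ^ n"
    by (subst z3_mod_Suc[symmetric])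
qed

lift_definition times_z3 :: "z3 \<Rightarrow> z3 \<Rightarrow> z3" is "\<lambda>x y n. (x n * y n) mod 3 ^ n"
proof -
  fix x y :: "nat \<Rightarrow> int" and n :: nat
  assume x: "\<And>n. x n = x (Suc n) mod 3 ^ n" and y: "\<And>n. y n = y (Suc n) mod 3 ^ n"
  have "(x n * y n) mod 3 ^ n = ((x (Suc n) mod 3 ^ n) * (y (Suc n) mod 3 ^ n)) mod 3 ^ n"
    by (subst x, subst y) (rule refl)
  also have "\<dots> = (x (Suc n) * y (Suc n)) mod 3 ^ n"
    by (rule mod_mult_eq)
  finally show "(x n * y n) mod 3 ^ n = (x (Suc n) * y (Suc n)) mod 3 ^ Suc n mod 3 ^ n"
    by (subst z3_mod_Suc[symmetric])
qed

lift_definition uminus_z3 :: "z3 \<Rightarrow> z3" is "\<lambda>x n. (- x n) mod 3 ^ n"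
proof -
  fix x :: "nat \<Rightarrow> int" and n :: nat
  assume x: "\<And>n. x n = x (Suc n) mod 3 ^ n"
  have "(- x n) mod 3 ^ n = (- (x (Suc n) mod 3 ^ n)) mod 3 ^ n"
    by (subst x) (rule refl)
  also have "\<dots> = (- x (Suc n)) mod 3 ^ n"
    by (rule mod_minus_eq)
  finally show "(- x n) mod 3 ^ n = (- x (Suc n)) mod 3 ^ Suc n mod 3 ^ n"
    by (subst z3_mod_Suc[symmetric])
qed

definition minus_z3 :: "z3 \<Rightarrow> z3 \<Rightarrow> z3"
  where "minus_z3 x y = x + (- y)"

instance
proof
  fix a b c :: z3
  show "a + b + c = a + (b + c)"
    by transfer (simp (no_asm) only: mod_add_left_eq mod_add_right_eq add.assoc)
  show "a + b = b + a"
    by transfer (simp (no_asm) only: add.commute)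
  show "0 + a = a"
    by transfer (simp (no_asm) only: add_0, rule z3_self)
  show "- a + a = 0"
    by transfer (simp (no_asm) only: mod_add_left_eq add.left_inverse mod_0)
  show "a - b = a + - b"
    by (rule minus_z3_def)
  show "a * b * c = a * (b * c)"
    by transfer (simp (no_asm) only: mod_mult_left_eq mod_mult_right_eq mult.assoc)
  show "a * b = b * a"
    by transfer (simp (no_asm) only: mult.commute)
  show "1 * a = a"
    by transfer (simp (no_asm) only: mod_mult_left_eq mult_1, rule z3_self)
  show "(a + b) * c = a * c + b * c"
    by transfer (simp (no_asm) only: mod_mult_left_eq mod_add_eq distrib_right)
  show "(0 :: z3) \<noteq> 1"
  proof (transfer, rule notI)
    assume "(\<lambda>_ :: nat. 0 :: int) = (\<lambda>n. 1 mod 3 ^ n)"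
    from fun_cong[OF this, of 1] show False by simp
  qed
qed

end

lemma z3_mod_le:
  assumes "\<forall>n. x n = x (Suc n) mod (3 :: int) ^ n"
  shows "x n = x (n + k) mod 3 ^ n"
proof (induction k)
  case 0
  show ?case
    using fun_cong[OF z3_self[OF assms], of n] by (simp only: add_0_right)
next
  case (Suc k)
  have "x (n + k) = x (n + Suc k) mod 3 ^ (n + k)"
    using spec[OF assms, of "n + k"] by (simp only: add_Suc_right)
  then have "x (n + k) mod 3 ^ n = x (n + Suc k) mod 3 ^ n"
    by (simp only: mod_mod_cancel[OF le_imp_power_dvd[OF le_add1]])
  with Suc show ?case by (rule trans)
qed

lemma prime_elem_3_int: "prime_elem (3 :: int)"
  by simp

lemma three_power_dvd_mult:
  fixes x y :: int
  assumes "\<not> 3 ^ m dvd x" "\<not> 3 ^ n dvd y"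
  shows "\<not> 3 ^ (m + n) dvd x * y"
proof
  assume d: "3 ^ (m + n) dvd x * y"
  have "3 ^ m dvd x \<or> 3 ^ Suc n dvd y"
    using d prime_elem_3_int by (intro prime_elem_power_dvd_cases[of _ "m + n"]) auto
  then show False
    using assms by (auto dest: dvd_mult_right)
qed

instance z3 :: idom
proof
  fix a b :: z3
  assume "a \<noteq> 0" "b \<noteq> 0"
  then show "a * b \<noteq> 0"
  proof (transfer)
    fix x y :: "nat \<Rightarrow> int"
    assume x: "\<forall>n. x n = x (Suc n) mod 3 ^ n" and y: "\<forall>n. y n = y (Suc n) mod 3 ^ n"
    assume "x \<noteq> (\<lambda>_. 0)" "y \<noteq> (\<lambda>_. 0)"
    then obtain m n where m: "x m \<noteq> 0" and n: "y n \<noteq> 0" by blast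
    let ?k = "m + n"
    have "\<not> 3 ^ m dvd x ?k"
      using m z3_mod_le[OF x, of m n] by (metis dvd_imp_mod_0)
    moreover have "\<not> 3 ^ n dvd y ?k"
      using n z3_mod_le[OF y, of n m] by (metis add.commute dvd_imp_mod_0)
    ultimately have "\<not> 3 ^ ?k dvd x ?k * y ?k"
      by (rule three_power_dvd_mult)
    then show "(\<lambda>n. x n * y n mod 3 ^ n) \<noteq> (\<lambda>_. 0)"
      by (metis mod_0_imp_dvd)
  qed
qed

type_synonym q3 = "z3 fract"

text \<open>Only the value at nonzero arguments matters, here and for every valuation below.\<close>

definition v3 :: "q3 \<Rightarrow> int" where
  "v3 q = (THE n. \<exists>a b. \<not> 3 dvd a \<and> \<not> 3 dvd b \<and> q = Fract a b * 3 powi n)"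

text \<open>\<open>Q3z a b\<close> is \<open>a + b * \<zeta>\<^sub>3\<close>, where \<open>\<zeta>\<^sub>3\<^sup>2 = - 1 - \<zeta>\<^sub>3\<close>.\<close>

datatype q3z = Q3z (q3z_re: q3) (q3z_ze: q3)

definition q3z_norm :: "q3z \<Rightarrow> q3" where
  "q3z_norm x = q3z_re x ^ 2 - q3z_re x * q3z_ze x + q3z_ze x ^ 2"

text \<open>The norm form is anisotropic, i.e. \<open>X\<^sup>2 + X + 1\<close> is irreducible over \<open>\<rat>\<^sub>3\<close>.\<close>

lemma nine_dvd_norm:
  fixes x y :: int
  assumes "9 dvd x ^ 2 - x * y + y ^ 2"
  shows "3 dvd x \<and> 3 dvd y"
proof -
  have "(3 :: int) dvd 9" by simp
  then have "3 dvd x ^ 2 - x * y + y ^ 2"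
    using assms by (rule dvd_trans)
  then have "3 dvd (x ^ 2 - x * y + y ^ 2) + 3 * (x * y)"
    by (rule dvd_add) (rule dvd_triv_left)
  also have "(x ^ 2 - x * y + y ^ 2) + 3 * (x * y) = (x + y) * (x + y)"
    by (simp add: power2_eq_square algebra_simps)
  finally have "3 dvd x + y"
    using prime_elem_dvd_mult_iff[OF prime_elem_3_int] by blast
  then obtain k where "x + y = 3 * k" by (rule dvdE)
  then have y: "y = 3 * k - x" by simp
  have "9 dvd (x ^ 2 - x * y + y ^ 2) - 9 * (k * k - k * x)"
    using assms by (rule dvd_diff) (rule dvd_triv_left)
  also have "(x ^ 2 - x * y + y ^ 2) - 9 * (k * k - k * x) = 3 * (x * x)"
    unfolding y by (simp add: power2_eq_square algebra_simps)
  finally have "3 * 3 dvd 3 * (x * x)" by simp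
  then have "3 dvd x * x"
    by (simp only: dvd_mult_cancel_left) simp
  then have "3 dvd x"
    using prime_elem_dvd_mult_iff[OF prime_elem_3_int] by blast
  moreover from this have "3 dvd y"
    unfolding y by (intro dvd_diff dvd_triv_left)
  ultimately show ?thesis ..
qed

lemma three_power_dvd_norm:
  fixes x y :: int
  assumes "3 ^ (2 * n) dvd x ^ 2 - x * y + y ^ 2"
  shows "3 ^ n dvd x \<and> 3 ^ n dvd y"
  using assms
proof (induction n arbitrary: x y)
  case (Suc n)
  have e: "(3 :: int) ^ (2 * Suc n) = 9 * 3 ^ (2 * n)" by simp
  have "9 dvd x ^ 2 - x * y + y ^ 2"
    using Suc.prems unfolding e by (rule dvd_mult_left)
  then obtain x' y' where xy: "x = 3 * x'" "y = 3 * y'"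
    using nine_dvd_norm by (meson dvdE)
  have "9 * 3 ^ (2 * n) dvd 9 * (x' ^ 2 - x' * y' + y' ^ 2)"
    using Suc.prems unfolding e xy by (simp add: power2_eq_square algebra_simps)
  then have "3 ^ (2 * n) dvd x' ^ 2 - x' * y' + y' ^ 2"
    by (simp only: dvd_mult_cancel_left) simp
  from Suc.IH[OF this] show ?case
    unfolding xy by simp
qed simp

lemma z3_norm_eq_0:
  fixes a b :: z3
  assumes "a * a - a * b + b * b = 0"
  shows "a = 0 \<and> b = 0"
proof -
  have eq: "a * a + b * b = a * b"
    using assms by (simp add: algebra_simps)
  have "Rep_z3 a n = 0 \<and> Rep_z3 b n = 0" for n
    using eq
  proof transfer
    fix x y :: "nat \<Rightarrow> int" and n :: nat
    assume x: "\<forall>n. x n = x (Suc n) mod 3 ^ n" and y: "\<forall>n. y n = y (Suc n) mod 3 ^ n"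
    assume e: "(\<lambda>n. (x n * x n mod 3 ^ n + y n * y n mod 3 ^ n) mod 3 ^ n) =
        (\<lambda>n. x n * y n mod 3 ^ n)"
    let ?k = "n + n"
    have "(x ?k * x ?k + y ?k * y ?k) mod 3 ^ ?k = x ?k * y ?k mod 3 ^ ?k"
      using fun_cong[OF e, of ?k] by (simp add: mod_simps)
    then have "3 ^ ?k dvd x ?k * x ?k + y ?k * y ?k - x ?k * y ?k"
      by (simp only: mod_eq_dvd_iff)
    also have "x ?k * x ?k + y ?k * y ?k - x ?k * y ?k = (x ?k) ^ 2 - x ?k * y ?k + (y ?k) ^ 2"
      by (simp add: power2_eq_square)
    finally have "3 ^ (2 * n) dvd (x ?k) ^ 2 - x ?k * y ?k + (y ?k) ^ 2"
      by (simp only: mult_2)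
    then have "3 ^ n dvd x ?k \<and> 3 ^ n dvd y ?k"
      by (rule three_power_dvd_norm)
    then show "x n = 0 \<and> y n = 0"
      using z3_mod_le[OF x, of n n] z3_mod_le[OF y, of n n] by (simp add: dvd_imp_mod_0)
  qed
  then have "Rep_z3 a = Rep_z3 0" "Rep_z3 b = Rep_z3 0"
    by (auto simp: fun_eq_iff zero_z3.rep_eq)
  then show ?thesis by (simp add: Rep_z3_inject)
qed

lemma fract_add_same: "m \<noteq> 0 \<Longrightarrow> Fract a m + Fract b m = Fract (a + b) (m :: 'b :: idom)"
  by (simp add: eq_fract distrib_right)

lemma fract_diff_same: "m \<noteq> 0 \<Longrightarrow> Fract a m - Fract b m = Fract (a - b) (m :: 'b :: idom)"
  by (simp add: eq_fract left_diff_distrib)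

lemma q3z_norm_eq_0:
  assumes "q3z_norm x = 0"
  shows "q3z_re x = 0 \<and> q3z_ze x = 0"
proof -
  obtain a c where ac: "q3z_re x = Fract a c" "c \<noteq> 0" by (cases "q3z_re x")
  obtain b d where bd: "q3z_ze x = Fract b d" "d \<noteq> 0" by (cases "q3z_ze x")
  define p q where "p = d * a" and "q = c * b"
  have re: "q3z_re x = Fract p (c * d)" and ze: "q3z_ze x = Fract q (c * d)"
    using mult_fract_cancel[OF bd(2), of a c] mult_fract_cancel[OF ac(2), of b d]
    by (simp_all only: ac(1) bd(1) p_def q_def mult.commute[of d c])
  have cd: "c * d \<noteq> 0" using ac bd by simp
  have "Fract (p * p - p * q + q * q) ((c * d) * (c * d)) = 0"
  proof -
    have "q3z_norm x = Fract p (c * d) * Fract p (c * d) - Fract p (c * d) * Fract q (c * d)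
        + Fract q (c * d) * Fract q (c * d)"
      by (simp add: q3z_norm_def re ze power2_eq_square)
    also have "\<dots> = Fract (p * p - p * q + q * q) ((c * d) * (c * d))"
    proof -
      have "(c * d) * (c * d) \<noteq> 0" using cd by simp
      from fract_diff_same[OF this] fract_add_same[OF this] show ?thesis
        by (simp only: mult_fract)
    qed
    finally show ?thesis using assms by simp
  qed
  then have "Fract (p * p - p * q + q * q) ((c * d) * (c * d)) = Fract 0 1"
    unfolding Zero_fract_def .
  moreover have "(c * d) * (c * d) \<noteq> 0" using cd by simp
  ultimately have "(p * p - p * q + q * q) * 1 = 0 * ((c * d) * (c * d))"
    by (metis eq_fract(1) one_neq_zero)
  then have "p * p - p * q + q * q = 0" by (simp only: mult_1_right mult_zero_left)
  then have "p = 0 \<and> q = 0" by (rule z3_norm_eq_0)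
  then show ?thesis
    by (simp add: re ze fract_collapse)
qed

instantiation q3z :: field
begin

definition "0 = Q3z 0 0"
definition "1 = Q3z 1 0"
definition "x + y = Q3z (q3z_re x + q3z_re y) (q3z_ze x + q3z_ze y)"
definition "- x = Q3z (- q3z_re x) (- q3z_ze x)"
definition "x - y = Q3z (q3z_re x - q3z_re y) (q3z_ze x - q3z_ze y)"
definition "x * y = Q3z (q3z_re x * q3z_re y - q3z_ze x * q3z_ze y)
  (q3z_re x * q3z_ze y + q3z_ze x * q3z_re y - q3z_ze x * q3z_ze y)"
definition "inverse x =
  Q3z ((q3z_re x - q3z_ze x) / q3z_norm x) (- q3z_ze x / q3z_norm x)"
definition "x div y = x * inverse (y :: q3z)"

instance
proof
  fix a b c :: q3z
  note defs = zero_q3z_def one_q3z_def plus_q3z_def uminus_q3z_def minus_q3z_def times_q3z_def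
  show "a + b + c = a + (b + c)" "a + b = b + a" "0 + a = a" "- a + a = 0" "a - b = a + - b"
    "a * b * c = a * (b * c)" "a * b = b * a" "1 * a = a" "(a + b) * c = a * c + b * c"
    "(0 :: q3z) \<noteq> 1"
    by (simp_all add: defs algebra_simps)
  show "inverse a * a = 1" if "a \<noteq> 0"
  proof -
    have n: "q3z_norm a \<noteq> 0"
      using that q3z_norm_eq_0[of a] by (metis q3z.collapse zero_q3z_def)
    obtain x y where a: "a = Q3z x y" by (cases a)
    let ?N = "q3z_norm a"
    have "(x - y) / ?N * x - (- y / ?N) * y = ((x - y) * x + y * y) / ?N"
      by (simp add: add_divide_distrib)
    also have "(x - y) * x + y * y = ?N"
      by (simp add: q3z_norm_def a power2_eq_square algebra_simps)
    finally have 1: "(x - y) / ?N * x - (- y / ?N) * y = 1"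
      using n by simp
    have "(x - y) / ?N * y + (- y / ?N) * x - (- y / ?N) * y
        = ((x - y) * y - y * x + y * y) / ?N"
      by (simp add: add_divide_distrib diff_divide_distrib left_diff_distrib)
    also have "(x - y) * y - y * x + y * y = 0"
      by (simp add: algebra_simps)
    finally have 2: "(x - y) / ?N * y + (- y / ?N) * x - (- y / ?N) * y = 0"
      by simp
    have "inverse a * a = Q3z ((x - y) / ?N * x - (- y / ?N) * y)
        ((x - y) / ?N * y + (- y / ?N) * x - (- y / ?N) * y)"
      by (simp only: times_q3z_def inverse_q3z_def a q3z.sel)
    then show ?thesis
      by (simp only: 1 2 one_q3z_def)
  qed
  show "a div b = a * inverse b" by (rule divide_q3z_def)
  show "inverse (0 :: q3z) = 0" by (simp add: inverse_q3z_def zero_q3z_def)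
qed

end

text \<open>The extension is totally ramified of degree 2, so composing with the norm gives the
  valuation of \<open>\<rat>\<^sub>3(\<zeta>\<^sub>3)\<close> with value group \<open>\<int>\<close>; the value of 3 is 2.\<close>

definition val :: "q3z \<Rightarrow> int" where
  "val x = v3 (q3z_norm x)"


section \<open>The projective line and its fractional linear transformations\<close>

text \<open>From here on, \<open>v\<close> is a discrete valuation on a field \<open>'a\<close>; its value at 0 is ignored.\<close>

datatype 'a P1 = Fin 'a | Infty

fun mobius :: "'a :: field \<Rightarrow> 'a \<Rightarrow> 'a \<Rightarrow> 'a \<Rightarrow> 'a P1 \<Rightarrow> 'a P1" where
  "mobius a b c d (Fin x) = (if c * x + d = 0 then Infty else Fin ((a * x + b) / (c * x + d)))"
| "mobius a b c d Infty = (if c = 0 then Infty else Fin (a / c))"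

definition PGL2 :: "('a :: field P1 \<Rightarrow> 'a P1) monoid" where
  "PGL2 = \<lparr>carrier = {mobius a b c d | a b c d. a * d - b * c \<noteq> 0}, monoid.mult = (\<circ>), one = id\<rparr>"

definition fixing_involutions :: "'a :: field P1 \<Rightarrow> 'a P1 \<Rightarrow> ('a P1 \<Rightarrow> 'a P1) set" where
  "fixing_involutions p q = {s \<in> carrier PGL2. group.ord PGL2 s = 2 \<and> s p = p \<and> s q = q}"

definition basic_nbhd :: "('a :: field \<Rightarrow> int) \<Rightarrow> 'a P1 \<Rightarrow> int \<Rightarrow> 'a P1 set" where
  "basic_nbhd v p n = (case p of
      Fin x \<Rightarrow> Fin ` {y. y = x \<or> v (y - x) \<ge> n}
    | Infty \<Rightarrow> insert Infty (Fin ` {y. y \<noteq> 0 \<and> v y \<le> - n}))"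

definition P1_topology :: "('a :: field \<Rightarrow> int) \<Rightarrow> 'a P1 topology" where
  "P1_topology v = topology (\<lambda>U. \<forall>p\<in>U. \<exists>n. basic_nbhd v p n \<subseteq> U)"

lemma basic_nbhd_antimono: "m \<le> n \<Longrightarrow> basic_nbhd v p n \<subseteq> basic_nbhd v p m"
  by (cases p) (auto simp: basic_nbhd_def)

lemma openin_P1_topology:
  "openin (P1_topology v) U \<longleftrightarrow> (\<forall>p\<in>U. \<exists>n. basic_nbhd v p n \<subseteq> U)"
proof -
  have "istopology (\<lambda>U. \<forall>p\<in>U. \<exists>n. basic_nbhd v p n \<subseteq> U)"
    unfolding istopology_def
  proof (intro conjI allI impI ballI)
    fix S T p
    assume S: "\<forall>p\<in>S. \<exists>n. basic_nbhd v p n \<subseteq> S" and T: "\<forall>p\<in>T. \<exists>n. basic_nbhd v p n \<subseteq> T"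
      and p: "p \<in> S \<inter> T"
    obtain m n where "basic_nbhd v p m \<subseteq> S" "basic_nbhd v p n \<subseteq> T"
      using S T p by blast
    then have "basic_nbhd v p (max m n) \<subseteq> S \<inter> T"
      using basic_nbhd_antimono[of m "max m n" v p] basic_nbhd_antimono[of n "max m n" v p]
      by auto
    then show "\<exists>n. basic_nbhd v p n \<subseteq> S \<inter> T" ..
  next
    fix \<K> p
    assume "\<forall>K\<in>\<K>. \<forall>p\<in>K. \<exists>n. basic_nbhd v p n \<subseteq> K" "p \<in> \<Union> \<K>"
    then show "\<exists>n. basic_nbhd v p n \<subseteq> \<Union> \<K>" by (meson Union_iff Sup_upper order_trans)
  qed
  then show ?thesis by (simp add: P1_topology_def topology_inverse')
qed


section \<open>Schottky groups and 2-superelliptic sets\<close>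

text \<open>A letter \<open>(x, True)\<close> stands for \<open>x\<close> and \<open>(x, False)\<close> for its inverse.\<close>

definition word_value :: "('g, 'm) monoid_scheme \<Rightarrow> ('g \<times> bool) list \<Rightarrow> 'g" where
  "word_value G w =
    foldr (\<lambda>(x, e) y. (if e then x else inv\<^bsub>G\<^esub> x) \<otimes>\<^bsub>G\<^esub> y) w \<one>\<^bsub>G\<^esub>"

definition reduced_word :: "('g \<times> bool) list \<Rightarrow> bool" where
  "reduced_word w \<longleftrightarrow> successively (\<lambda>l m. fst l = fst m \<longrightarrow> snd l = snd m) w"

definition free_basis :: "('g, 'm) monoid_scheme \<Rightarrow> 'g set \<Rightarrow> 'g set \<Rightarrow> bool" where
  "free_basis G X H \<longleftrightarrow> X \<subseteq> carrier G \<and> generate G X = H \<and>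
    (\<forall>w. w \<noteq> [] \<and> fst ` set w \<subseteq> X \<and> reduced_word w \<longrightarrow> word_value G w \<noteq> \<one>\<^bsub>G\<^esub>)"

definition orb :: "('a P1 \<Rightarrow> 'a P1) set \<Rightarrow> 'a P1 \<Rightarrow> 'a P1 set" where
  "orb H p = (\<lambda>h. h p) ` H"

definition limit_points ::
  "('a :: field \<Rightarrow> int) \<Rightarrow> ('a P1 \<Rightarrow> 'a P1) set \<Rightarrow> 'a P1 set" where
  "limit_points v H = {p. \<exists>q h. inj h \<and> range h \<subseteq> H \<and>
    limitin (P1_topology v) (\<lambda>n :: nat. h n q) p sequentially}"

text \<open>Discontinuity in the sense of Gerritzen and van der Put.\<close>

definition acts_discontinuously ::
  "('a :: field \<Rightarrow> int) \<Rightarrow> ('a P1 \<Rightarrow> 'a P1) set \<Rightarrow> bool" where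
  "acts_discontinuously v H \<longleftrightarrow> limit_points v H \<noteq> UNIV \<and>
    (\<forall>p. compactin (P1_topology v) (P1_topology v closure_of orb H p))"

definition schottky :: "('a :: field \<Rightarrow> int) \<Rightarrow> ('a P1 \<Rightarrow> 'a P1) set \<Rightarrow> bool" where
  "schottky v H \<longleftrightarrow> subgroup H PGL2 \<and> (\<exists>X. finite X \<and> free_basis PGL2 X H) \<and>
    acts_discontinuously v H"

definition pair_set :: "nat \<Rightarrow> (nat \<Rightarrow> 'a) \<Rightarrow> (nat \<Rightarrow> 'a) \<Rightarrow> 'a set" where
  "pair_set g a b = a ` {..g} \<union> b ` {..g}"

definition Gamma0 :: "nat \<Rightarrow> (nat \<Rightarrow> 'a :: field P1 \<Rightarrow> 'a P1) \<Rightarrow> ('a P1 \<Rightarrow> 'a P1) set" where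
  "Gamma0 g s = generate PGL2 (s ` {..g})"

definition Gamma :: "nat \<Rightarrow> (nat \<Rightarrow> 'a :: field P1 \<Rightarrow> 'a P1) \<Rightarrow> ('a P1 \<Rightarrow> 'a P1) set" where
  "Gamma g s = generate PGL2 ((\<lambda>i. s 0 \<circ> s i) ` {1..g})"

definition superelliptic_pairing :: "('a :: field \<Rightarrow> int) \<Rightarrow> nat \<Rightarrow>
    (nat \<Rightarrow> 'a P1) \<Rightarrow> (nat \<Rightarrow> 'a P1) \<Rightarrow> (nat \<Rightarrow> 'a P1 \<Rightarrow> 'a P1) \<Rightarrow> bool" where
  "superelliptic_pairing v g a b s \<longleftrightarrow>
    card (pair_set g a b) = 2 * g + 2 \<and>
    (\<forall>i\<le>g. s i \<in> fixing_involutions (a i) (b i)) \<and>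
    schottky v (Gamma g s) \<and>
    (\<forall>X. finite X \<and> X \<subseteq> Gamma0 g s \<and> generate PGL2 X = Gamma0 g s \<longrightarrow> g + 1 \<le> card X)"

text \<open>\<open>S\<close> is 2-superelliptic and induces \<open>H \<lhd> H0\<close> via a suitable partition into pairs.\<close>

definition superelliptic_inducing :: "('a :: field \<Rightarrow> int) \<Rightarrow> nat \<Rightarrow>
    'a P1 set \<Rightarrow> ('a P1 \<Rightarrow> 'a P1) set \<Rightarrow> ('a P1 \<Rightarrow> 'a P1) set \<Rightarrow> bool" where
  "superelliptic_inducing v g S H H0 \<longleftrightarrow> (\<exists>a b s. S = pair_set g a b \<and>
    superelliptic_pairing v g a b s \<and> H = Gamma g s \<and> H0 = Gamma0 g s)"

text \<open>On \<open>K\<close>-rational points a quotient map by \<open>H0\<close> need not be surjective; being constant on,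
  and separating, the orbits outside the limit set is all that is required of it here.\<close>

definition separates_orbits :: "('a :: field \<Rightarrow> int) \<Rightarrow>
    ('a P1 \<Rightarrow> 'a P1) set \<Rightarrow> ('a P1 \<Rightarrow> 'a P1) set \<Rightarrow> ('a P1 \<Rightarrow> 'a P1) \<Rightarrow> bool" where
  "separates_orbits v H H0 \<pi> \<longleftrightarrow>
    (\<forall>x\<in>- limit_points v H. \<forall>y\<in>- limit_points v H. \<pi> x = \<pi> y \<longleftrightarrow> orb H0 x = orb H0 y)"


section \<open>Clusters\<close>

definition disc :: "('a :: field \<Rightarrow> int) \<Rightarrow> 'a \<Rightarrow> int \<Rightarrow> 'a set" where
  "disc v c n = {x. x = c \<or> v (x - c) \<ge> n}"

text \<open>The empty set does not count as a cluster.\<close>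

definition clusters :: "('a :: field \<Rightarrow> int) \<Rightarrow> 'a P1 set \<Rightarrow> 'a P1 set set" where
  "clusters v A = {A \<inter> Fin ` disc v c n | c n. A \<inter> Fin ` disc v c n \<noteq> {}}"

definition same_cluster_data ::
  "('a :: field \<Rightarrow> int) \<Rightarrow> 'a P1 set \<Rightarrow> 'a P1 set \<Rightarrow> bool" where
  "same_cluster_data v A A' \<longleftrightarrow>
    (\<exists>\<psi>. bij_betw \<psi> A A' \<and> bij_betw ((`) \<psi>) (clusters v A) (clusters v A'))"


section \<open>Position\<close>

definition integral :: "('a :: field \<Rightarrow> int) \<Rightarrow> 'a \<Rightarrow> bool" where
  "integral v x \<longleftrightarrow> x = 0 \<or> v x \<ge> 0"

text \<open>Elements of the residue field are represented as cosets of the maximal ideal.\<close>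

definition residue_class :: "('a :: field \<Rightarrow> int) \<Rightarrow> 'a \<Rightarrow> 'a set" where
  "residue_class v x = {y. y = x \<or> v (y - x) > 0}"

definition residue_P1 :: "('a :: field \<Rightarrow> int) \<Rightarrow> 'a set P1 set" where
  "residue_P1 v = insert Infty (Fin ` residue_class v ` {x. integral v x})"

fun reduction :: "('a :: field \<Rightarrow> int) \<Rightarrow> 'a P1 \<Rightarrow> 'a set P1" where
  "reduction v (Fin x) = (if integral v x then Fin (residue_class v x) else Infty)"
| "reduction v Infty = Infty"

definition invertible_reduction :: "('a :: field \<Rightarrow> int) \<Rightarrow> ('a P1 \<Rightarrow> 'a P1) \<Rightarrow> bool" where
  "invertible_reduction v h \<longleftrightarrow> (\<exists>a b c d. h = mobius a b c d \<and>
    integral v a \<and> integral v b \<and> integral v c \<and> integral v d \<and>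
    a * d - b * c \<noteq> 0 \<and> v (a * d - b * c) = 0)"

definition triples :: "'p set \<Rightarrow> ('p \<times> 'p \<times> 'p) set" where
  "triples A = {(x, y, z). x \<in> A \<and> y \<in> A \<and> z \<in> A \<and> x \<noteq> y \<and> y \<noteq> z \<and> x \<noteq> z}"

definition normalizer :: "'a :: field P1 \<times> 'a P1 \<times> 'a P1 \<Rightarrow> 'a P1 \<Rightarrow> 'a P1" where
  "normalizer = (\<lambda>(z0, z1, zinf).
    THE h. h \<in> carrier PGL2 \<and> h z0 = Fin 0 \<and> h z1 = Fin 1 \<and> h zinf = Infty)"

definition triple_equiv :: "('a :: field \<Rightarrow> int) \<Rightarrow> 'a P1 set \<Rightarrow>
    (('a P1 \<times> 'a P1 \<times> 'a P1) \<times> ('a P1 \<times> 'a P1 \<times> 'a P1)) set" where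
  "triple_equiv v A = {(z, w). z \<in> triples A \<and> w \<in> triples A \<and>
    invertible_reduction v (normalizer w \<otimes>\<^bsub>PGL2\<^esub> inv\<^bsub>PGL2\<^esub> (normalizer z))}"

definition tree_verts ::
  "('a :: field \<Rightarrow> int) \<Rightarrow> 'a P1 set \<Rightarrow> ('a P1 \<times> 'a P1 \<times> 'a P1) set set" where
  "tree_verts v A = triples A // triple_equiv v A"

definition class_map :: "('a :: field \<Rightarrow> int) \<Rightarrow>
    ('a P1 \<times> 'a P1 \<times> 'a P1) set \<Rightarrow> 'a P1 \<Rightarrow> 'a set P1" where
  "class_map v V x = reduction v (normalizer (SOME z. z \<in> V) x)"

definition R_map :: "('a :: field \<Rightarrow> int) \<Rightarrow> 'a P1 set \<Rightarrow> 'a P1 \<Rightarrow>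
    ('a P1 \<times> 'a P1 \<times> 'a P1) set \<Rightarrow> 'a set P1" where
  "R_map v A x = (\<lambda>V\<in>tree_verts v A. class_map v V x)"

text \<open>The component of the curve that belongs to the class \<open>V\<close>: the coordinate at \<open>V\<close> runs
  through the projective line over the residue field, while the coordinate at any other class
  \<open>W\<close> is the constant value that \<open>class_map v W\<close> takes off one residue class \<open>P\<close> of
  \<open>class_map v V\<close>. Taking the literal image of the \<open>K\<close>-rational points instead would lose
  intersection points of components, as \<open>K\<close> is discretely valued.\<close>

definition component :: "('a :: field \<Rightarrow> int) \<Rightarrow> 'a P1 set \<Rightarrow> ('a P1 \<times> 'a P1 \<times> 'a P1) set \<Rightarrow>
    (('a P1 \<times> 'a P1 \<times> 'a P1) set \<Rightarrow> 'a set P1) set" where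
  "component v A V = {y \<in> tree_verts v A \<rightarrow>\<^sub>E residue_P1 v. \<forall>W\<in>tree_verts v A - {V}.
    \<exists>P\<in>residue_P1 v. \<forall>x. class_map v V x \<noteq> P \<longrightarrow> class_map v W x = y W}"

definition tree_adj :: "('a :: field \<Rightarrow> int) \<Rightarrow> 'a P1 set \<Rightarrow>
    ('a P1 \<times> 'a P1 \<times> 'a P1) set \<Rightarrow> ('a P1 \<times> 'a P1 \<times> 'a P1) set \<Rightarrow> bool" where
  "tree_adj v A V W \<longleftrightarrow> V \<noteq> W \<and> component v A V \<inter> component v A W \<noteq> {}"

definition tree_point ::
  "('a :: field \<Rightarrow> int) \<Rightarrow> 'a P1 set \<Rightarrow> 'a P1 \<Rightarrow> ('a P1 \<times> 'a P1 \<times> 'a P1) set" where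
  "tree_point v A z = (THE V. V \<in> tree_verts v A \<and> R_map v A z \<in> component v A V)"

definition same_position :: "('a :: field \<Rightarrow> int) \<Rightarrow> 'a P1 set \<Rightarrow> 'a P1 set \<Rightarrow>
    ('a P1 \<Rightarrow> 'a P1) \<Rightarrow> bool" where
  "same_position v A A' \<phi> \<longleftrightarrow> (\<exists>f. bij_betw f (tree_verts v A) (tree_verts v A') \<and>
    (\<forall>V\<in>tree_verts v A. \<forall>W\<in>tree_verts v A.
      tree_adj v A V W \<longleftrightarrow> tree_adj v A' (f V) (f W)) \<and>
    (\<forall>z\<in>A. f (tree_point v A z) = tree_point v A' (\<phi> z)))"

end

(*
  The involutions s_i play ping-pong with pairwise disjoint discs D_i: s_i maps the complement of D_i
  into D_i. Hence Gamma_0 is the free product of the groups <s_i>, Gamma is free on the s_0 s_i, and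
  mod 2 the number of occurrences of each s_i in a word is well defined, which bounds the number of
  generators from below. The fixed points have neighbourhoods that only id and s_i move to
  intersecting sets, and the projective line over Q_3(zeta_3) is compact, so Gamma is Schottky.

  If the set contains infinity, the vertices of its tree correspond to the smallest discs containing
  two of its finite points. Replacing the pair {a_1, b_1} by its image under s_0 leaves the groups
  unchanged but moves the pair into the smallest disc around a_0, b_0. The disc joining a_1 to a_0
  then disappears, and the trees have different numbers of vertices.
  For clusters, "xy is separated from zw" is a PGL_2-invariant condition on the valuation of a
  cross-ratio; it splits S into three mutually separated pairs, which is impossible for S'.
*)
theory Submission
  imports Defs "HOL-Number_Theory.Cong"
begin

section \<open>Fractional linear transformations in homogeneous coordinates\<close>

text \<open>The discs come from one formula: an involution with fixed points m - f and m + f sends m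
  + w to m + f^2/w. As 2 is a unit, f has the valuation of the difference of the fixed points, so
  every point farther from m than that is thrown into a strictly smaller disc around m, away from
  neighbourhoods of both fixed points. For the same reason s_0 puts a_1 and b_1 exactly as far from
  a_0 and from b_0 as these are from each other.

  The obstacle in the tree is that its vertices are classes of triples under matrices that reduce
  invertibly. Each normalizing map is therefore factored into such a matrix and the affine
  coordinate of a disc; equivalence of triples then becomes equality of discs, and vertices can be
  counted.

  The quotient map enters only through its equal values at a point and at the twisted point: S and
  S' have the same image, whose tree cannot have two different numbers of vertices. Higher genus is
  reached by adding pairs far from pairs 0 and 1, which leaves the comparison of the counts
  intact.\<close>

definition hom_pt :: "'a :: field \<times> 'a \<Rightarrow> 'a P1" where
  "hom_pt u = (if snd u = 0 then Infty else Fin (fst u / snd u))"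

fun coords :: "'a :: field P1 \<Rightarrow> 'a \<times> 'a" where
  "coords (Fin x) = (x, 1)"
| "coords Infty = (1, 0)"

text \<open>The bracket of two coordinate vectors. Cross-ratios are quotients of products of
  brackets, so it serves both the normalizing maps and the separation of pairs of points.\<close>

definition det2 :: "'a :: field \<times> 'a \<Rightarrow> 'a \<times> 'a \<Rightarrow> 'a" where
  "det2 u w = fst u * snd w - snd u * fst w"

lemma hom_pt_coords [simp]: "hom_pt (coords p) = p"
  by (cases p) (auto simp: hom_pt_def)

lemma coords_nonzero [simp]: "coords p \<noteq> (0, 0)"
  by (cases p) auto

lemma det2_swap: "det2 u w = - det2 w u"
  by (simp add: det2_def)

lemma hom_pt_eq_iff:
  assumes "u \<noteq> (0, 0)" "w \<noteq> (0, 0)"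
  shows "hom_pt u = hom_pt w \<longleftrightarrow> det2 u w = 0"
  using assms by (cases u; cases w) (auto simp: hom_pt_def det2_def divide_simps mult.commute)

lemma det2_coords_eq_0_iff: "det2 (coords p) (coords q) = 0 \<longleftrightarrow> p = q"
  using hom_pt_eq_iff[of "coords p" "coords q"] by simp

text \<open>Cramer's rule: the adjugate matrix recovers the determinant times \<open>(x, y)\<close>
  from the image vector.\<close>

lemma linear_image_nonzero:
  fixes a b c d x y :: "'a :: field"
  assumes "a * d - b * c \<noteq> 0" "(x, y) \<noteq> (0, 0)"
  shows "(a * x + b * y, c * x + d * y) \<noteq> (0, 0)"
proof
  assume e: "(a * x + b * y, c * x + d * y) = (0, 0)"
  have "(a * d - b * c) * x = d * (a * x + b * y) - b * (c * x + d * y)"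
    "(a * d - b * c) * y = a * (c * x + d * y) - c * (a * x + b * y)"
    by (simp_all add: algebra_simps)
  then have "(a * d - b * c) * x = 0" "(a * d - b * c) * y = 0"
    using e by auto
  then show False using assms by auto
qed

text \<open>Homogeneous coordinates remove the case distinctions at infinity, so that composition
  becomes the product of matrices.\<close>

lemma mobius_hom_pt:
  assumes "a * d - b * c \<noteq> 0" "(x, y) \<noteq> (0, 0)"
  shows "mobius a b c d (hom_pt (x, y)) = hom_pt (a * x + b * y, c * x + d * y)"
proof (cases "y = 0")
  case True
  then show ?thesis using assms by (auto simp: hom_pt_def)
next
  case False
  then have "c * (x / y) + d = (c * x + d * y) / y" "a * (x / y) + b = (a * x + b * y) / y"
    by (simp_all add: field_simps)
  then show ?thesis using False by (auto simp: hom_pt_def)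
qed

lemma mobius_coords:
  assumes "a * d - b * c \<noteq> 0"
  shows "mobius a b c d p = hom_pt (a * fst (coords p) + b * snd (coords p),
    c * fst (coords p) + d * snd (coords p))"
  using mobius_hom_pt[OF assms, of "fst (coords p)" "snd (coords p)"]
  by (simp del: coords.simps)

lemma mobius_comp:
  fixes a b c d a' b' c' d' :: "'a :: field"
  assumes "a * d - b * c \<noteq> 0" "a' * d' - b' * c' \<noteq> 0"
  shows "mobius a b c d \<circ> mobius a' b' c' d' =
    mobius (a * a' + b * c') (a * b' + b * d') (c * a' + d * c') (c * b' + d * d')"
proof
  fix p :: "'a P1"
  obtain x y where p: "coords p = (x, y)" by (cases "coords p")
  then have xy: "(x, y) \<noteq> (0, 0)" using coords_nonzero[of p] by simp
  have "(a * a' + b * c') * (c * b' + d * d') - (a * b' + b * d') * (c * a' + d * c') =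
      (a * d - b * c) * (a' * d' - b' * c')"
    by (simp add: algebra_simps)
  then have nz: "(a * a' + b * c') * (c * b' + d * d') - (a * b' + b * d') * (c * a' + d * c') \<noteq> 0"
    using assms by simp
  show "(mobius a b c d \<circ> mobius a' b' c' d') p =
    mobius (a * a' + b * c') (a * b' + b * d') (c * a' + d * c') (c * b' + d * d') p"
    unfolding o_apply mobius_coords[OF nz] mobius_coords[OF assms(2), of p] p fst_conv snd_conv
      mobius_hom_pt[OF assms(1) linear_image_nonzero[OF assms(2) xy]]
    by (simp add: algebra_simps)
qed

lemma mobius_scale:
  assumes "k \<noteq> 0"
  shows "mobius (k * a) (k * b) (k * c) (k * d) = mobius a b c d"
proof
  fix p
  show "mobius (k * a) (k * b) (k * c) (k * d) p = mobius a b c d p"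
  proof (cases p)
    case (Fin x)
    have "k * c * x + k * d = k * (c * x + d)" "k * a * x + k * b = k * (a * x + b)"
      by (simp_all add: algebra_simps)
    then show ?thesis using assms Fin by simp
  qed (use assms in simp)
qed

lemma mobius_diagonal: "a \<noteq> 0 \<Longrightarrow> mobius a 0 0 a = id"
proof
  fix p assume "a \<noteq> 0"
  then show "mobius a 0 0 a p = id p" by (cases p) auto
qed

lemma PGL2_simps [simp]: "monoid.mult PGL2 f h = f \<circ> h" "one PGL2 = id"
  by (simp_all add: PGL2_def)

lemma in_PGL2_iff: "h \<in> carrier PGL2 \<longleftrightarrow> (\<exists>a b c d. h = mobius a b c d \<and> a * d - b * c \<noteq> 0)"
  by (simp add: PGL2_def)

lemma PGL2_E:
  assumes "h \<in> carrier PGL2"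
  obtains a b c d where "h = mobius a b c d" "a * d - b * c \<noteq> 0"
  using assms by (auto simp: in_PGL2_iff)

lemma mobius_in_PGL2 [intro]: "a * d - b * c \<noteq> 0 \<Longrightarrow> mobius a b c d \<in> carrier PGL2"
  by (auto simp: in_PGL2_iff)

lemma mobius_adjugate:
  assumes "a * d - b * c \<noteq> 0"
  shows "mobius d (- b) (- c) a \<circ> mobius a b c d = id"
proof -
  have "d * a - (- b) * (- c) \<noteq> 0" using assms by (simp add: mult.commute)
  from mobius_comp[OF this assms]
  have "mobius d (- b) (- c) a \<circ> mobius a b c d = mobius (a * d - b * c) 0 0 (a * d - b * c)"
    by (simp add: algebra_simps)
  then show ?thesis using mobius_diagonal[OF assms] by simp
qed

lemma id_in_PGL2 [simp]: "(id :: 'a :: field P1 \<Rightarrow> 'a P1) \<in> carrier PGL2"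
  using mobius_diagonal[of "1 :: 'a"] mobius_in_PGL2[of "1 :: 'a" 1 0 0] by simp

lemma comp_in_PGL2:
  assumes "f \<in> carrier PGL2" "h \<in> carrier PGL2"
  shows "f \<circ> h \<in> carrier PGL2"
proof -
  obtain a b c d where f: "f = mobius a b c d" "a * d - b * c \<noteq> 0"
    using assms(1) by (rule PGL2_E)
  obtain a' b' c' d' where h: "h = mobius a' b' c' d'" "a' * d' - b' * c' \<noteq> 0"
    using assms(2) by (rule PGL2_E)
  have "(a * a' + b * c') * (c * b' + d * d') - (a * b' + b * d') * (c * a' + d * c') =
      (a * d - b * c) * (a' * d' - b' * c')"
    by (simp add: algebra_simps)
  then show ?thesis using f h mobius_comp[OF f(2) h(2)] by auto
qed

lemma group_PGL2: "group (PGL2 :: ('a :: field P1 \<Rightarrow> 'a P1) monoid)"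
proof (rule groupI)
  fix h :: "'a P1 \<Rightarrow> 'a P1" assume "h \<in> carrier PGL2"
  then obtain a b c d where h: "h = mobius a b c d" "a * d - b * c \<noteq> 0" by (rule PGL2_E)
  have "mobius d (- b) (- c) a \<in> carrier PGL2"
    using h(2) by (intro mobius_in_PGL2) (simp add: mult.commute)
  then show "\<exists>f\<in>carrier PGL2. f \<otimes>\<^bsub>PGL2\<^esub> h = \<one>\<^bsub>PGL2\<^esub>"
    using mobius_adjugate[OF h(2)] h(1) by auto
qed (auto simp: comp_in_PGL2 o_assoc)

interpretation PGL2: group "PGL2 :: ('a :: field P1 \<Rightarrow> 'a P1) monoid"
  rewrites "monoid.mult PGL2 = (\<circ>)" and "one PGL2 = id"
  by (rule group_PGL2) (simp_all add: PGL2_def)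

lemma PGL2_inv_mobius:
  assumes "a * d - b * c \<noteq> 0"
  shows "inv\<^bsub>PGL2\<^esub> (mobius a b c d) = mobius d (- b) (- c) a"
proof (rule PGL2.inv_equality)
  show "mobius d (- b) (- c) a \<circ> mobius a b c d = id" by (rule mobius_adjugate[OF assms])
  show "mobius d (- b) (- c) a \<in> carrier PGL2"
    using assms by (intro mobius_in_PGL2) (simp add: mult.commute)
qed (use assms in auto)

lemma PGL2_inv_apply:
  assumes "h \<in> carrier PGL2"
  shows "(inv\<^bsub>PGL2\<^esub> h) (h x) = x" "h ((inv\<^bsub>PGL2\<^esub> h) x) = x"
  using fun_cong[OF PGL2.l_inv[OF assms], of x] fun_cong[OF PGL2.r_inv[OF assms], of x] by simp_all

lemma PGL2_inj: "h \<in> carrier PGL2 \<Longrightarrow> inj h"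
  using PGL2_inv_apply(1) by (metis injI)

lemma fixes_0_1_Infty:
  assumes "h \<in> carrier PGL2" "h (Fin 0) = Fin 0" "h (Fin 1) = Fin 1" "h Infty = Infty"
  shows "h = id"
proof -
  obtain a b c d where h: "h = mobius a b c d" "a * d - b * c \<noteq> 0"
    using assms(1) by (rule PGL2_E)
  have "c = 0" using assms(4) h by (simp split: if_splits)
  moreover have "d \<noteq> 0" "b = 0" using assms(2) h by (auto split: if_splits)
  moreover have "a = d" using assms(3) h calculation by simp
  ultimately show ?thesis using h mobius_diagonal[of d] by simp
qed

text \<open>The map is the cross-ratio: u goes to [u, u 0] [u 1, u 2] over [u, u 2] [u 1, u 0], with
  brackets \<open>det2\<close>. The coordinates are left free because existence uses
  \<open>coords\<close>, whereas the reduction argument uses integral vectors with unit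
  brackets.\<close>

lemma normalizer_mobius:
  fixes u :: "nat \<Rightarrow> 'a :: field \<times> 'a"
  assumes nz: "\<And>i. i < 3 \<Longrightarrow> u i \<noteq> (0, 0)"
    and d: "det2 (u 0) (u 1) \<noteq> 0" "det2 (u 1) (u 2) \<noteq> 0" "det2 (u 0) (u 2) \<noteq> 0"
  defines "A \<equiv> det2 (u 1) (u 2)" and "B \<equiv> det2 (u 1) (u 0)"
  defines "h \<equiv> mobius (A * snd (u 0)) (- (A * fst (u 0))) (B * snd (u 2)) (- (B * fst (u 2)))"
  shows "A * snd (u 0) * (- (B * fst (u 2))) - (- (A * fst (u 0))) * (B * snd (u 2))
      = A * B * det2 (u 0) (u 2)"
    and "h (hom_pt (u 0)) = Fin 0" "h (hom_pt (u 1)) = Fin 1" "h (hom_pt (u 2)) = Infty"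
proof -
  show *: "A * snd (u 0) * (- (B * fst (u 2))) - (- (A * fst (u 0))) * (B * snd (u 2))
      = A * B * det2 (u 0) (u 2)"
    by (simp add: det2_def algebra_simps)
  have AB: "A \<noteq> 0" "B \<noteq> 0" using d det2_swap[of "u 0" "u 1"] by (auto simp: A_def B_def)
  then have D: "A * snd (u 0) * (- (B * fst (u 2))) - (- (A * fst (u 0))) * (B * snd (u 2)) \<noteq> 0"
    using * d(3) by simp
  have app: "h (hom_pt (u i)) = hom_pt (A * det2 (u i) (u 0), B * det2 (u i) (u 2))" if "i < 3" for i
    using mobius_hom_pt[OF D, of "fst (u i)" "snd (u i)"] nz[OF that]
    by (simp add: h_def det2_def algebra_simps)
  have self: "det2 w w = 0" for w :: "'a \<times> 'a" by (simp add: det2_def)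
  show "h (hom_pt (u 0)) = Fin 0" "h (hom_pt (u 2)) = Infty"
    using AB d app[of 0] app[of 2] by (auto simp: hom_pt_def self)
  have "h (hom_pt (u 1)) = hom_pt (A * B, B * A)"
    using app[of 1] by (simp add: A_def B_def)
  then show "h (hom_pt (u 1)) = Fin 1" using AB by (simp add: hom_pt_def)
qed

lemma normalizer_ex1:
  fixes z0 z1 zinf :: "'a :: field P1"
  assumes "z0 \<noteq> z1" "z1 \<noteq> zinf" "z0 \<noteq> zinf"
  shows "\<exists>!h. h \<in> carrier PGL2 \<and> h z0 = Fin 0 \<and> h z1 = Fin 1 \<and> h zinf = Infty"
proof (rule ex_ex1I)
  define u where "u = (\<lambda>i :: nat. coords (if i = 0 then z0 else if i = 1 then z1 else zinf))"
  have u: "u 0 = coords z0" "u 1 = coords z1" "u 2 = coords zinf" by (simp_all add: u_def)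
  have nz: "u i \<noteq> (0, 0)" for i by (simp add: u_def)
  have d: "det2 (u 0) (u 1) \<noteq> 0" "det2 (u 1) (u 2) \<noteq> 0" "det2 (u 0) (u 2) \<noteq> 0"
    unfolding u det2_coords_eq_0_iff by (fact assms)+
  have "det2 (u 1) (u 0) \<noteq> 0" using d(1) det2_swap[of "u 0" "u 1"] by simp
  then have nz2: "det2 (u 1) (u 2) * det2 (u 1) (u 0) * det2 (u 0) (u 2) \<noteq> 0"
    using d by simp
  note h = normalizer_mobius[of u, OF nz d]
  show "\<exists>h. h \<in> carrier PGL2 \<and> h z0 = Fin 0 \<and> h z1 = Fin 1 \<and> h zinf = Infty"
    using h(2-4) nz2 h(1) unfolding u hom_pt_coords
    by (metis mobius_in_PGL2)
next
  fix h h' :: "'a P1 \<Rightarrow> 'a P1"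
  assume h: "h \<in> carrier PGL2 \<and> h z0 = Fin 0 \<and> h z1 = Fin 1 \<and> h zinf = Infty"
    and h': "h' \<in> carrier PGL2 \<and> h' z0 = Fin 0 \<and> h' z1 = Fin 1 \<and> h' zinf = Infty"
  let ?f = "h \<circ> inv\<^bsub>PGL2\<^esub> h'"
  have inv': "(inv\<^bsub>PGL2\<^esub> h') (Fin 0) = z0" "(inv\<^bsub>PGL2\<^esub> h') (Fin 1) = z1"
    "(inv\<^bsub>PGL2\<^esub> h') Infty = zinf"
    using PGL2_inv_apply(1)[of h'] h' by metis+
  have "?f = id"
    using h h' inv' by (intro fixes_0_1_Infty) (auto intro: comp_in_PGL2)
  then have "?f (h' x) = h' x" for x by simp
  then show "h = h'" using h' by (auto simp: PGL2_inv_apply)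
qed

lemma normalizer_props:
  assumes "z0 \<noteq> z1" "z1 \<noteq> zinf" "z0 \<noteq> zinf"
  shows "normalizer (z0, z1, zinf) \<in> carrier PGL2" "normalizer (z0, z1, zinf) z0 = Fin 0"
    "normalizer (z0, z1, zinf) z1 = Fin 1" "normalizer (z0, z1, zinf) zinf = Infty"
  using theI'[OF normalizer_ex1[OF assms]] by (simp_all add: normalizer_def)

lemma normalizer_unique:
  assumes "z0 \<noteq> z1" "z1 \<noteq> zinf" "z0 \<noteq> zinf"
    and "h \<in> carrier PGL2" "h z0 = Fin 0" "h z1 = Fin 1" "h zinf = Infty"
  shows "normalizer (z0, z1, zinf) = h"
  using normalizer_ex1[OF assms(1-3)] assms(4-7) normalizer_props[OF assms(1-3)] by blast

subsection \<open>Involutions with two given fixed points\<close>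

lemma PGL2_ord_eq_2_iff:
  assumes "h \<in> carrier PGL2"
  shows "PGL2.ord h = 2 \<longleftrightarrow> h \<circ> h = id \<and> h \<noteq> id"
proof -
  have sq: "h [^]\<^bsub>PGL2\<^esub> (2 :: nat) = h \<circ> h"
    using assms by (simp add: numeral_2_eq_2)
  have "PGL2.ord h dvd 2 \<longleftrightarrow> h \<circ> h = id"
    using PGL2.pow_eq_id[OF assms, of 2] by (simp add: sq)
  moreover have "PGL2.ord h = 1 \<longleftrightarrow> h = id"
    using PGL2.ord_eq_1[OF assms] by simp
  moreover have "PGL2.ord h dvd 2 \<longleftrightarrow> PGL2.ord h = 1 \<or> PGL2.ord h = 2"
    using two_is_prime_nat by (metis prime_nat_iff dvd_refl one_dvd)
  ultimately show ?thesis by auto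
qed

lemma fixing_involutions_iff:
  "h \<in> fixing_involutions p q \<longleftrightarrow>
    h \<in> carrier PGL2 \<and> h \<circ> h = id \<and> h \<noteq> id \<and> h p = p \<and> h q = q"
  using PGL2_ord_eq_2_iff by (auto simp: fixing_involutions_def)

text \<open>Fixing 0 and infinity leaves multiplication by some r; an involution has r^2 = 1, and r
  = 1 is the identity.\<close>

lemma involution_fixing_0_Infty:
  fixes h :: "'a :: field P1 \<Rightarrow> 'a P1"
  assumes "h \<in> fixing_involutions (Fin 0) Infty"
  shows "h = mobius (- 1) 0 0 1"
proof -
  have h: "h \<in> carrier PGL2" "h \<circ> h = id" "h \<noteq> id" "h (Fin 0) = Fin 0" "h Infty = Infty"
    using assms by (auto simp: fixing_involutions_iff)
  obtain a b c d where m: "h = mobius a b c d" "a * d - b * c \<noteq> 0"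
    using h(1) by (rule PGL2_E)
  have "c = 0" using h(5) m by (simp split: if_splits)
  moreover have "d \<noteq> 0" "b = 0" using h(4) m by (auto split: if_splits)
  ultimately have "h (Fin x) = Fin (a / d * x)" for x using m by simp
  then obtain r where hx: "h (Fin x) = Fin (r * x)" for x by blast
  have "r * r = 1" using fun_cong[OF h(2), of "Fin 1"] by (simp add: hx)
  then have "r = 1 \<or> r = - 1" by (metis square_eq_1_iff)
  moreover have "r \<noteq> 1"
  proof
    assume "r = 1"
    then have "h p = id p" for p using hx h(5) by (cases p) auto
    then show False using h(3) by blast
  qed
  ultimately have "h p = mobius (- 1) 0 0 1 p" for p using hx h(5) by (cases p) auto
  then show ?thesis by blast
qed

lemma fixing_involutions_conj:
  assumes "f \<in> carrier PGL2" "h \<in> fixing_involutions p q"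
  shows "f \<circ> h \<circ> inv\<^bsub>PGL2\<^esub> f \<in> fixing_involutions (f p) (f q)"
proof -
  note h = assms(2)[unfolded fixing_involutions_iff]
  let ?g = "inv\<^bsub>PGL2\<^esub> f"
  have hh: "h (h x) = x" for x using h by (metis comp_apply id_apply)
  have "f \<circ> h \<circ> ?g \<in> carrier PGL2" using assms(1) h by (simp add: comp_in_PGL2)
  moreover have "(f \<circ> h \<circ> ?g) \<circ> (f \<circ> h \<circ> ?g) = id"
    by (rule ext) (simp add: PGL2_inv_apply[OF assms(1)] hh)
  moreover have "f \<circ> h \<circ> ?g \<noteq> id"
  proof
    assume e: "f \<circ> h \<circ> ?g = id"
    have "h x = x" for x
      using fun_cong[OF e, of "f x"] PGL2_inj[OF assms(1)]
      by (simp add: PGL2_inv_apply[OF assms(1)] inj_eq)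
    then show False using h by auto
  qed
  ultimately show ?thesis using h by (simp add: fixing_involutions_iff PGL2_inv_apply[OF assms(1)])
qed

lemma fixing_involutions_unique:
  assumes "p \<noteq> q" "h \<in> fixing_involutions p q" "h' \<in> fixing_involutions p q"
  shows "h = h'"
proof -
  \<comment> \<open>Normalizing needs a third point; any point moved by \<open>h\<close> differs
    from both fixed points.\<close>
  obtain x where x: "x \<noteq> p" "x \<noteq> q"
  proof -
    have "h \<noteq> id" "h \<circ> h = id" "h p = p" "h q = q" using assms(2) by (auto simp: fixing_involutions_iff)
    then obtain x where "h x \<noteq> x" by (metis ext id_apply)
    then show ?thesis using that[of x] \<open>h p = p\<close> \<open>h q = q\<close> by auto
  qed
  define f where "f = normalizer (p, x, q)"
  have f: "f \<in> carrier PGL2" "f p = Fin 0" "f q = Infty"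
    using normalizer_props[of p x q] x assms(1) by (auto simp: f_def)
  let ?g = "inv\<^bsub>PGL2\<^esub> f"
  have "f \<circ> h \<circ> ?g = f \<circ> h' \<circ> ?g"
    using fixing_involutions_conj[OF f(1) assms(2)] fixing_involutions_conj[OF f(1) assms(3)]
    unfolding f by (metis involution_fixing_0_Infty)
  then have "f (h (?g (f y))) = f (h' (?g (f y)))" for y by (metis comp_apply)
  then show ?thesis using PGL2_inj[OF f(1)] by (auto simp: PGL2_inv_apply[OF f(1)] inj_eq)
qed

text \<open>Trace zero makes the square of the matrix scalar, and the fixed-point equation is 2 (z -
  a) (z - b) = 0.\<close>

definition pair_involution :: "'a :: field \<Rightarrow> 'a \<Rightarrow> 'a P1 \<Rightarrow> 'a P1" where
  "pair_involution a b = mobius (a + b) (- (2 * a * b)) 2 (- (a + b))"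

lemma traceless_involution:
  assumes "- (a * a) - b * c \<noteq> 0"
  shows "mobius a b c (- a) \<circ> mobius a b c (- a) = id"
proof -
  have nz: "a * (- a) - b * c \<noteq> 0" using assms by simp
  then have "a * a + b * c \<noteq> 0"
    by (metis add.inverse_inverse minus_add_distrib mult_minus_right neg_0_equal_iff_equal uminus_add_conv_diff add.commute)
  then show ?thesis
    using mobius_comp[OF nz nz] mobius_diagonal[of "a * a + b * c"] by (simp add: algebra_simps)
qed

lemma pair_involution_in:
  fixes a b :: "'a :: field"
  assumes "a \<noteq> b" "(2 :: 'a) \<noteq> 0"
  shows "pair_involution a b \<in> fixing_involutions (Fin a) (Fin b)"
proof -
  have det: "- ((a + b) * (a + b)) - (- (2 * a * b)) * 2 = - ((a - b) * (a - b))"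
    by (simp add: algebra_simps)
  then have nz: "- ((a + b) * (a + b)) - (- (2 * a * b)) * 2 \<noteq> 0" using assms by simp
  have fa: "pair_involution a b (Fin a) = Fin a"
  proof -
    have "2 * a + - (a + b) = a - b" "(a + b) * a + - (2 * a * b) = a * (a - b)"
      by (simp_all add: algebra_simps)
    then show ?thesis using assms by (simp only: pair_involution_def mobius.simps) simp
  qed
  have fb: "pair_involution a b (Fin b) = Fin b"
  proof -
    have "2 * b + - (a + b) = b - a" "(a + b) * b + - (2 * a * b) = b * (b - a)"
      by (simp_all add: algebra_simps)
    then show ?thesis using assms by (simp only: pair_involution_def mobius.simps) simp
  qed
  have "pair_involution a b Infty \<noteq> Infty" using assms by (simp add: pair_involution_def)
  then have "pair_involution a b \<noteq> id" by auto
  moreover have "pair_involution a b \<circ> pair_involution a b = id"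
    unfolding pair_involution_def by (rule traceless_involution[OF nz])
  moreover have "pair_involution a b \<in> carrier PGL2"
    unfolding pair_involution_def using nz by (intro mobius_in_PGL2) (simp only: mult_minus_right not_False_eq_True)
  ultimately show ?thesis using fa fb by (simp add: fixing_involutions_iff)
qed

lemma reflection_in_fixing_involutions:
  fixes c :: "'a :: field"
  assumes "(2 :: 'a) \<noteq> 0"
  shows "mobius (- 1) (2 * c) 0 1 \<in> fixing_involutions (Fin c) Infty"
proof -
  let ?h = "mobius (- 1) (2 * c) 0 (1 :: 'a)"
  have "?h (?h p) = p" for p by (cases p) auto
  then have "?h \<circ> ?h = id" by auto
  moreover have "?h (Fin (c + 1)) \<noteq> Fin (c + 1)"
  proof
    assume "?h (Fin (c + 1)) = Fin (c + 1)"
    then have "2 * c - c - 1 = c + 1" by (simp add: algebra_simps)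
    then have "(2 :: 'a) = 0" by (simp add: algebra_simps)
    then show False using assms by simp
  qed
  then have "?h \<noteq> id" by (metis id_apply)
  moreover have "?h \<in> carrier PGL2" by (rule mobius_in_PGL2) simp
  ultimately show ?thesis by (simp add: fixing_involutions_iff)
qed

section \<open>Groups generated by involutions playing ping-pong\<close>

text \<open>Left multiplication of a normal form by a letter in a free product of groups of order
  two: equal neighbours cancel.\<close>

fun push :: "nat \<Rightarrow> nat list \<Rightarrow> nat list" where
  "push i [] = [i]"
| "push i (j # r) = (if i = j then r else i # j # r)"

definition reduce :: "nat list \<Rightarrow> nat list" where
  "reduce u = foldr push u []"

lemma reduce_simps [simp]: "reduce [] = []" "reduce (i # u) = push i (reduce u)"
  by (simp_all add: reduce_def)

lemma successively_push: "successively (\<noteq>) r \<Longrightarrow> successively (\<noteq>) (push i r)"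
  by (cases r; cases "tl r") auto

lemma successively_reduce: "successively (\<noteq>) (reduce u)"
  by (induction u) (auto simp: successively_push)

lemma set_push: "set (push i r) \<subseteq> insert i (set r)"
  by (cases r) auto

lemma set_reduce: "set (reduce u) \<subseteq> set u"
  using set_push by (induction u) fastforce+

text \<open>A cancellation removes two equal letters, so the number of letters from any set changes
  by an even amount. These parities later bound the number of generators.\<close>

lemma parity_push:
  "even (length (filter P (push i r))) \<longleftrightarrow> even (length (filter P (i # r)))"
  by (cases r) auto

lemma parity_reduce:
  "even (length (filter P (reduce u))) \<longleftrightarrow> even (length (filter P u))"
  by (induction u) (auto simp: parity_push)

text \<open>A letter \<open>(i, True)\<close> stands for \<open>s 0 \<circ> s i\<close> and \<open>(i, False)\<close> for its inverse \<open>s i \<circ> s 0\<close>.\<close>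

fun expand :: "(nat \<times> bool) list \<Rightarrow> nat list" where
  "expand [] = []"
| "expand ((i, e) # w) =
    (if e then push 0 (push i (expand w)) else push i (push 0 (expand w)))"

text \<open>Between neighbouring letters of a reduced word at most two copies of 0 cancel, as in s_i
  s_0 s_0 s_j, and then i and j differ. The induction has to remember two leading letters when the
  expansion starts with 0, because cancelling the 0 exposes the next one.\<close>

lemma expand_reduced:
  assumes "reduced_word w" "0 \<notin> fst ` set w"
  shows "w = [] \<and> expand w = [] \<or> (\<exists>i w' r. w = (i, True) # w' \<and> expand w = 0 # i # r) \<or>
    (\<exists>i w' r. w = (i, False) # w' \<and> expand w = i # r)"
  using assms
proof (induction w rule: expand.induct)
  case (2 i e w)
  have i: "i \<noteq> 0" and red: "reduced_word w" and 0: "0 \<notin> fst ` set w"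
    using 2(3-4) by (auto simp: reduced_word_def successively_Cons)
  from 2(1-2) red 0
  consider "w = []" "expand w = []" | j w' r where "w = (j, True) # w'" "expand w = 0 # j # r"
    | j w' r where "w = (j, False) # w'" "expand w = j # r"
    by (cases e) blast+
  then show ?case
  proof cases
    case 1
    then show ?thesis using i by auto
  next
    case 2
    have "i = j \<Longrightarrow> e" using "2.prems"(1) 2(1) by (auto simp: reduced_word_def)
    then show ?thesis using i 2 by auto
  next
    case 3
    have "i = j \<Longrightarrow> \<not> e" "j \<noteq> 0"
      using "2.prems" 3(1) by (auto simp: reduced_word_def)
    then show ?thesis using i 3 by auto
  qed
qed simp

lemma word_value_PGL2:
  "word_value PGL2 [] = id"
  "word_value PGL2 ((x, e) # w) = (if e then x else inv\<^bsub>PGL2\<^esub> x) \<circ> word_value PGL2 w"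
  by (simp_all add: word_value_def)

lemma hd_last_le:
  "u \<noteq> [] \<Longrightarrow> set u \<subseteq> {..g} \<Longrightarrow> hd u \<le> g \<and> last u \<le> (g :: nat)"
  by (metis atMost_iff hd_in_set last_in_set subsetD)

section \<open>Words in involutions and the groups they represent\<close>

locale involution_family =
  fixes g :: nat and s :: "nat \<Rightarrow> 'a :: field P1 \<Rightarrow> 'a P1"
  assumes s_in: "i \<le> g \<Longrightarrow> s i \<in> carrier PGL2"
    and s_s: "i \<le> g \<Longrightarrow> s i \<circ> s i = id"
begin

definition wv :: "nat list \<Rightarrow> 'a P1 \<Rightarrow> 'a P1" where
  "wv u = foldr (\<lambda>i h. s i \<circ> h) u id"

lemma wv_simps [simp]: "wv [] = id" "wv (i # u) = s i \<circ> wv u"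
  by (simp_all add: wv_def)

lemma wv_append [simp]: "wv (u @ w) = wv u \<circ> wv w"
  by (induction u) (auto simp: o_assoc)

lemma s_s_apply [simp]: "i \<le> g \<Longrightarrow> s i (s i x) = x"
  using fun_cong[OF s_s, of i x] by simp

lemma inv_s: "i \<le> g \<Longrightarrow> inv\<^bsub>PGL2\<^esub> (s i) = s i"
  using s_s s_in by (intro PGL2.inv_equality) auto

lemma wv_in: "set u \<subseteq> {..g} \<Longrightarrow> wv u \<in> carrier PGL2"
  by (induction u) (auto simp: comp_in_PGL2 s_in)

lemma wv_rev_wv: "set u \<subseteq> {..g} \<Longrightarrow> wv (rev u) \<circ> wv u = id"
  by (induction u) (auto simp: fun_eq_iff)

lemma inv_wv: "set u \<subseteq> {..g} \<Longrightarrow> inv\<^bsub>PGL2\<^esub> (wv u) = wv (rev u)"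
  using wv_in[of u] wv_in[of "rev u"] by (intro PGL2.inv_equality) (auto simp: wv_rev_wv)

lemma wv_push: "set r \<subseteq> {..g} \<Longrightarrow> wv (push i r) = s i \<circ> wv r"
  by (cases r) (auto simp: fun_eq_iff)

lemma wv_reduce: "set u \<subseteq> {..g} \<Longrightarrow> wv (reduce u) = wv u"
proof (induction u)
  case (Cons i u)
  then have "set (reduce u) \<subseteq> {..g}" using set_reduce[of u] by auto
  then show ?case using Cons by (simp add: wv_push)
qed simp

lemma wv_expand:
  "fst ` set w \<subseteq> {..g} \<Longrightarrow> set (expand w) \<subseteq> {..g} \<and>
    wv (expand w) = word_value PGL2 (map (\<lambda>(i, e). (s 0 \<circ> s i, e)) w)"
proof (induction w rule: expand.induct)
  case 1
  show ?case by (simp only: expand.simps list.map word_value_PGL2 wv_simps) simp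
next
  case (2 i e w)
  have i: "i \<le> g" and w: "fst ` set w \<subseteq> {..g}" using "2.prems" by auto
  have sub: "set (expand w) \<subseteq> {..g}"
    and IH: "wv (expand w) = word_value PGL2 (map (\<lambda>(i, e). (s 0 \<circ> s i, e)) w)"
    using "2.IH" w by (cases e; blast)+
  have push1: "set (push j (expand w)) \<subseteq> {..g}" if "j \<le> g" for j
    using set_push[of j "expand w"] sub that by auto
  then have push2: "set (push k (push j (expand w))) \<subseteq> {..g}" if "j \<le> g" "k \<le> g" for j k
    using set_push[of k "push j (expand w)"] that by force
  have "wv (expand ((i, e) # w)) =
      (if e then s 0 \<circ> s i else s i \<circ> s 0) \<circ> wv (expand w)"
    using wv_push[OF push1[OF i], of 0] wv_push[OF push1, of 0 i] wv_push[OF sub] i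
    by (cases e) (simp_all add: o_assoc)
  moreover have "inv\<^bsub>PGL2\<^esub> (s 0 \<circ> s i) = s i \<circ> s 0"
    using inv_wv[of "[0, i]"] i by simp
  ultimately have "wv (expand ((i, e) # w)) =
      word_value PGL2 (map (\<lambda>(i, e). (s 0 \<circ> s i, e)) ((i, e) # w))"
    unfolding list.map prod.case word_value_PGL2 IH by (cases e) (simp_all only: if_True if_False)
  moreover have "set (expand ((i, e) # w)) \<subseteq> {..g}"
    using push2[of i 0] push2[of 0 i] i by (cases e) simp_all
  ultimately show ?case by blast
qed

text \<open>Reversing a word of involutions inverts its value, so words closed under concatenation
  and reversal represent a subgroup. It is applied to all words and to the words of even
  length.\<close>

lemma generate_words:
  assumes W: "[] \<in> W" "\<And>u w. u \<in> W \<Longrightarrow> w \<in> W \<Longrightarrow> u @ w \<in> W"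
      "\<And>u. u \<in> W \<Longrightarrow> set u \<subseteq> {..g} \<and> rev u \<in> W"
    and X: "X \<subseteq> wv ` W"
  shows "generate PGL2 X \<subseteq> wv ` W"
proof
  fix h assume "h \<in> generate PGL2 X"
  then show "h \<in> wv ` W"
  proof (induction rule: generate.induct)
    case one
    show ?case unfolding PGL2_simps by (rule image_eqI[OF _ W(1)]) simp
  next
    case (incl h)
    then show ?case using X by blast
  next
    case (inv h)
    then obtain u where u: "h = wv u" "u \<in> W" using X by blast
    then show ?case using W(3)[OF u(2)] inv_wv by blast
  next
    case (eng h1 h2)
    then obtain u w where "h1 = wv u" "h2 = wv w" "u \<in> W" "w \<in> W" by blast
    then show ?case unfolding PGL2_simps using W(2) wv_append by (metis imageI)
  qed
qed

lemma Gamma0_eq: "Gamma0 g s = {wv u | u. set u \<subseteq> {..g}}"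
proof
  have "Gamma0 g s \<subseteq> wv ` {u. set u \<subseteq> {..g}}"
    unfolding Gamma0_def
  proof (rule generate_words)
    show "s ` {..g} \<subseteq> wv ` {u. set u \<subseteq> {..g}}"
    proof (rule image_subsetI)
      fix i assume "i \<in> {..g}"
      then show "s i \<in> wv ` {u. set u \<subseteq> {..g}}" by (intro image_eqI[of _ _ "[i]"]) simp_all
    qed
  qed auto
  then show "Gamma0 g s \<subseteq> {wv u | u. set u \<subseteq> {..g}}" by blast
  have "set u \<subseteq> {..g} \<Longrightarrow> wv u \<in> generate PGL2 (s ` {..g})" for u
  proof (induction u)
    case Nil
    then show ?case using generate.one[of PGL2 "s ` {..g}"] unfolding wv_simps PGL2_simps by blast
  next
    case (Cons i u)
    then have "s i \<in> generate PGL2 (s ` {..g})" "wv u \<in> generate PGL2 (s ` {..g})"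
      by (auto intro: generate.incl)
    from generate.eng[OF this] show ?case unfolding wv_simps PGL2_simps .
  qed
  then show "{wv u | u. set u \<subseteq> {..g}} \<subseteq> Gamma0 g s"
    by (auto simp: Gamma0_def)
qed

lemma Gamma_generators_in: "(\<lambda>i. s 0 \<circ> s i) ` {1..g} \<subseteq> carrier PGL2"
  by (auto intro!: comp_in_PGL2 s_in)

lemma Gamma0_subgroup: "subgroup (Gamma0 g s) PGL2"
  unfolding Gamma0_def by (rule PGL2.generate_is_subgroup) (auto intro: s_in)

lemma Gamma_subgroup: "subgroup (Gamma g s) PGL2"
  unfolding Gamma_def by (rule PGL2.generate_is_subgroup) (rule Gamma_generators_in)

text \<open>Since s_i s_j = (s_0 s_i)^(-1) (s_0 s_j), a word of even length splits into blocks of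
  two that lie in the group. Normality then only needs that conjugating a word keeps its length
  even.\<close>

lemma Gamma_eq: "Gamma g s = {wv u | u. set u \<subseteq> {..g} \<and> even (length u)}"
proof
  let ?W = "{u. set u \<subseteq> {..g} \<and> even (length u)}"
  have "Gamma g s \<subseteq> wv ` ?W"
    unfolding Gamma_def
  proof (rule generate_words)
    show "(\<lambda>i. s 0 \<circ> s i) ` {1..g} \<subseteq> wv ` ?W"
    proof (rule image_subsetI)
      fix i assume "i \<in> {1..g}"
      then show "s 0 \<circ> s i \<in> wv ` ?W" by (intro image_eqI[of _ _ "[0, i]"]) simp_all
    qed
  qed auto
  then show "Gamma g s \<subseteq> {wv u | u. set u \<subseteq> {..g} \<and> even (length u)}" by blast
  have gen: "s 0 \<circ> s i \<in> Gamma g s" if "i \<le> g" for i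
  proof (cases "i = 0")
    case True
    then show ?thesis using subgroup.one_closed[OF Gamma_subgroup] by (simp add: s_s)
  next
    case False
    then show ?thesis using that by (auto simp: Gamma_def intro!: generate.incl)
  qed
  have pair: "s i \<circ> s j \<in> Gamma g s" if "i \<le> g" "j \<le> g" for i j
  proof -
    have "inv\<^bsub>PGL2\<^esub> (s 0 \<circ> s i) \<circ> (s 0 \<circ> s j) \<in> Gamma g s"
      using subgroup.m_closed[OF Gamma_subgroup subgroup.m_inv_closed[OF Gamma_subgroup]] gen that
      by simp
    moreover have "inv\<^bsub>PGL2\<^esub> (s 0 \<circ> s i) = s i \<circ> s 0"
      using inv_wv[of "[0, i]"] that by simp
    ultimately show ?thesis by (auto simp: o_def)
  qed
  have "set u \<subseteq> {..g} \<and> even (length u) \<Longrightarrow> wv u \<in> Gamma g s" for u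
  proof (induction u rule: induct_list012)
    case 1
    then show ?case using subgroup.one_closed[OF Gamma_subgroup] unfolding wv_simps PGL2_simps by blast
  next
    case (3 i j u)
    then have "s i \<circ> s j \<in> Gamma g s" "wv u \<in> Gamma g s" by (auto intro: pair)
    from subgroup.m_closed[OF Gamma_subgroup this] show ?case
      unfolding wv_simps PGL2_simps o_assoc .
  qed simp
  then show "{wv u | u. set u \<subseteq> {..g} \<and> even (length u)} \<subseteq> Gamma g s" by blast
qed

lemma Gamma_subset_Gamma0: "Gamma g s \<subseteq> Gamma0 g s"
  by (auto simp: Gamma_eq Gamma0_eq)

lemma Gamma_normal: "Gamma g s \<lhd> PGL2\<lparr>carrier := Gamma0 g s\<rparr>"
proof -
  let ?G = "PGL2\<lparr>carrier := Gamma0 g s\<rparr>"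
  interpret G: group ?G by (rule PGL2.subgroup_imp_group[OF Gamma0_subgroup])
  have "x \<circ> h \<circ> inv\<^bsub>?G\<^esub> x \<in> Gamma g s" if x: "x \<in> Gamma0 g s" and h: "h \<in> Gamma g s" for x h
  proof -
    obtain u where u: "x = wv u" "set u \<subseteq> {..g}" using x by (auto simp: Gamma0_eq)
    obtain w where w: "h = wv w" "set w \<subseteq> {..g}" "even (length w)" using h by (auto simp: Gamma_eq)
    have "inv\<^bsub>?G\<^esub> x = wv (rev u)"
      using PGL2.m_inv_consistent[OF Gamma0_subgroup x] inv_wv[OF u(2)] u(1) by simp
    then have "x \<circ> h \<circ> inv\<^bsub>?G\<^esub> x = wv (u @ w @ rev u)" using u w by (simp add: o_assoc)
    moreover have "set (u @ w @ rev u) \<subseteq> {..g}" "even (length (u @ w @ rev u))" using u w by auto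
    ultimately show ?thesis unfolding Gamma_eq by blast
  qed
  moreover have "subgroup (Gamma g s) ?G"
    by (rule PGL2.subgroup_incl[OF Gamma_subgroup Gamma0_subgroup Gamma_subset_Gamma0])
  ultimately show ?thesis by (simp add: G.normal_inv_iff)
qed

end

section \<open>Ping-pong: normal forms, freeness and rank\<close>

locale pingpong = involution_family g s
  for g :: nat and s :: "nat \<Rightarrow> 'a :: field P1 \<Rightarrow> 'a P1" +
  fixes D :: "nat \<Rightarrow> 'a P1 set" and p0 :: "'a P1"
  assumes D_disjoint: "i \<le> g \<Longrightarrow> j \<le> g \<Longrightarrow> i \<noteq> j \<Longrightarrow> D i \<inter> D j = {}"
    and s_D: "i \<le> g \<Longrightarrow> x \<notin> D i \<Longrightarrow> s i x \<in> D i"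
    and p0: "i \<le> g \<Longrightarrow> p0 \<notin> D i"
begin

text \<open>Letters act from the right: a point in the set of one letter is outside the set of the
  next, different one. The conclusion is sharper than membership in \<open>D (hd u)\<close>: that
  the last step starts outside \<open>D (hd u)\<close> keeps the image away from neighbourhoods of
  the fixed points.\<close>

lemma wv_reduced_range:
  assumes "successively (\<noteq>) u" "u \<noteq> []" "set u \<subseteq> {..g}" "x \<notin> D (last u)"
  shows "wv u x \<in> s (hd u) ` (- D (hd u))"
  using assms
proof (induction u)
  case (Cons i u)
  show ?case
  proof (cases "u = []")
    case False
    then have "wv u x \<in> s (hd u) ` (- D (hd u))"
      using Cons by (auto simp: successively_Cons)
    then have "wv u x \<in> D (hd u)"
      using s_D[of "hd u"] False Cons.prems(3) hd_last_le[of u] by auto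
    moreover have "hd u \<noteq> i" "hd u \<le> g" "i \<le> g"
      using False Cons.prems hd_last_le[of u g] by (auto simp: successively_Cons)
    ultimately have "wv u x \<notin> D i" using D_disjoint[of i "hd u"] by auto
    then show ?thesis by simp
  qed (use Cons in simp)
qed simp

text \<open>A nonempty reduced word would carry \<open>p0\<close> into one of the sets
  \<open>D i\<close>, all of which miss it.\<close>

lemma wv_eq_id: 
  assumes "wv u = id" "set u \<subseteq> {..g}"
  shows "reduce u = []"
proof (rule ccontr)
  let ?r = "reduce u"
  assume r: "?r \<noteq> []"
  have sub: "set ?r \<subseteq> {..g}" using set_reduce assms(2) by blast
  then have hl: "hd ?r \<le> g" "last ?r \<le> g" using r hd_last_le by auto
  have "wv ?r p0 \<in> s (hd ?r) ` (- D (hd ?r))"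
    using wv_reduced_range[OF successively_reduce r sub] p0 hl by blast
  then have "wv ?r p0 \<in> D (hd ?r)" using s_D hl by auto
  then show False using wv_reduce[OF assms(2)] assms(1) p0[OF hl(1)] by simp
qed

lemma wv_eq_parity:
  assumes "wv u = wv w" "set u \<subseteq> {..g}" "set w \<subseteq> {..g}"
  shows "even (length (filter P u)) \<longleftrightarrow> even (length (filter P w))"
proof -
  have "wv (rev u @ w) = id" using assms(1) wv_rev_wv[OF assms(2)] by (metis wv_append)
  then have "reduce (rev u @ w) = []" using assms by (intro wv_eq_id) auto
  then have "even (length (filter P (rev u @ w)))" using parity_reduce[of P "rev u @ w"] by simp
  then show ?thesis by (simp add: rev_filter[symmetric])
qed

lemma Gamma_free_basis: "free_basis PGL2 ((\<lambda>i. s 0 \<circ> s i) ` {1..g}) (Gamma g s)"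
  unfolding free_basis_def
proof (intro conjI allI impI)
  let ?f = "\<lambda>i. s 0 \<circ> s i"
  let ?X = "?f ` {1..g}"
  show "?X \<subseteq> carrier PGL2" by (rule Gamma_generators_in)
  show "generate PGL2 ?X = Gamma g s" by (simp add: Gamma_def)
  fix w assume w: "w \<noteq> [] \<and> fst ` set w \<subseteq> ?X \<and> reduced_word w"
  \<comment> \<open>The letters of a word over the basis are group elements. Choosing one index for
    each generator is injective on the generators and keeps the word reduced, which makes
    \<open>expand\<close> applicable.\<close>
  define idx where "idx = inv_into {1..g} ?f"
  have f_idx: "?f (idx x) = x" and idx: "idx x \<in> {1..g}" if "x \<in> ?X" for x
    using f_inv_into_f[of x ?f "{1..g}"] inv_into_into[of x ?f "{1..g}"] that
    by (simp_all add: idx_def)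
  define w' where "w' = map (\<lambda>(x, e). (idx x, e)) w"
  have set_w': "fst ` set w' \<subseteq> {1..g}" using w idx by (force simp: w'_def)
  have red: "reduced_word w'"
    unfolding reduced_word_def w'_def successively_map
  proof (rule successively_mono)
    show "successively (\<lambda>l m. fst l = fst m \<longrightarrow> snd l = snd m) w"
      using w by (simp add: reduced_word_def)
  next
    fix l m assume lm: "l \<in> set w" "m \<in> set w" "fst l = fst m \<longrightarrow> snd l = snd m"
    then have "fst l \<in> ?X" "fst m \<in> ?X" using w by auto
    then have "idx (fst l) = idx (fst m) \<Longrightarrow> fst l = fst m"
      using inj_onD[OF inj_on_inv_into[of ?X ?f "{1..g}"], folded idx_def] by blast
    with lm(3) show "fst (case l of (x, e) \<Rightarrow> (idx x, e)) = fst (case m of (x, e) \<Rightarrow> (idx x, e)) \<longrightarrow>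
        snd (case l of (x, e) \<Rightarrow> (idx x, e)) = snd (case m of (x, e) \<Rightarrow> (idx x, e))"
      by (simp add: case_prod_beta)
  qed
  have "map (\<lambda>(i, e). (?f i, e)) w' = w"
    unfolding w'_def map_map
  proof (rule map_idI)
    fix l assume "l \<in> set w"
    then have "fst l \<in> ?X" using w by blast
    from f_idx[OF this] show "((\<lambda>(i, e). (?f i, e)) \<circ> (\<lambda>(x, e). (idx x, e))) l = l"
      by (simp add: case_prod_beta)
  qed
  then have val: "word_value PGL2 w = wv (expand w')"
    using wv_expand[of w'] set_w' by force
  have sub: "set (expand w') \<subseteq> {..g}" using wv_expand[of w'] set_w' by force
  have "w' \<noteq> []" using w by (simp add: w'_def)
  then have ne: "expand w' \<noteq> []" using expand_reduced[OF red] set_w' by force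
  have succ: "successively (\<noteq>) (expand w')"
    by (induction w' rule: expand.induct) (auto simp: successively_push)
  have hl: "hd (expand w') \<le> g" "last (expand w') \<le> g"
    using ne sub hd_last_le by auto
  have "wv (expand w') p0 \<in> D (hd (expand w'))"
    using wv_reduced_range[OF succ ne sub p0[OF hl(2)]] s_D[OF hl(1)] by auto
  then show "word_value PGL2 w \<noteq> \<one>\<^bsub>PGL2\<^esub>" using p0[OF hl(1)] val by auto
qed

text \<open>The parities of the numbers of letters from the sets \<open>A \<subseteq> {..g}\<close> are \<open>2 ^ (g + 1)\<close>
  characters of the group. On fewer than \<open>g + 1\<close> elements two of them coincide.\<close>

lemma Gamma0_rank:
  assumes "finite X" "X \<subseteq> Gamma0 g s" "generate PGL2 X = Gamma0 g s"
  shows "g + 1 \<le> card X"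
proof (rule ccontr)
  assume "\<not> g + 1 \<le> card X"
  then have lt: "card X < g + 1" by simp
  \<comment> \<open>Some word suffices here, since all words for \<open>h\<close> have the same
    parities.\<close>
  define chi where "chi A h \<longleftrightarrow> (\<exists>u. set u \<subseteq> {..g} \<and> wv u = h \<and> even (length (filter (\<lambda>i. i \<in> A) u)))"
    for A :: "nat set" and h
  have chi_wv: "chi A (wv u) \<longleftrightarrow> even (length (filter (\<lambda>i. i \<in> A) u))" if "set u \<subseteq> {..g}" for A u
    using wv_eq_parity that unfolding chi_def by blast
  have "card (Pow X) < card (Pow {..g})"
    using lt assms(1) power_strict_increasing[of "card X" "g + 1" "2 :: nat"]
    by (simp add: card_Pow)
  then have "\<not> inj_on (\<lambda>A. {x \<in> X. chi A x}) (Pow {..g})"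
    using card_inj_on_le[of "\<lambda>A. {x \<in> X. chi A x}" "Pow {..g}" "Pow X"] assms(1) by auto
  then obtain A B where AB: "A \<subseteq> {..g}" "B \<subseteq> {..g}" "A \<noteq> B"
    and eq: "{x \<in> X. chi A x} = {x \<in> X. chi B x}"
    by (auto simp: inj_on_def)
  have "chi A h \<longleftrightarrow> chi B h" if "h \<in> generate PGL2 X" for h
    using that
  proof (induction rule: generate.induct)
    case one
    have "chi A (wv [])" "chi B (wv [])" using chi_wv[of "[]"] by simp_all
    then show ?case unfolding wv_simps PGL2_simps by blast
  next
    case (incl h)
    then show ?case using eq by auto
  next
    case (inv h)
    then obtain u where u: "h = wv u" "set u \<subseteq> {..g}" using assms(2) by (auto simp: Gamma0_eq)
    have "chi C (inv\<^bsub>PGL2\<^esub> h) \<longleftrightarrow> chi C h" for C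
      using chi_wv[of u C] chi_wv[of "rev u" C] u inv_wv[OF u(2)]
      by (simp add: rev_filter[symmetric])
    then show ?case using eq inv by auto
  next
    case (eng h1 h2)
    then have "h1 \<in> Gamma0 g s" "h2 \<in> Gamma0 g s" using assms(3) by auto
    then obtain u w where uw: "h1 = wv u" "h2 = wv w" "set u \<subseteq> {..g}" "set w \<subseteq> {..g}"
      by (auto simp: Gamma0_eq)
    then have "chi C (h1 \<circ> h2) \<longleftrightarrow> (chi C h1 \<longleftrightarrow> chi C h2)" for C
      using chi_wv[of u C] chi_wv[of w C] chi_wv[of "u @ w" C] by simp
    then show ?case using eng.IH unfolding PGL2_simps by blast
  qed
  then have same: "chi A h \<longleftrightarrow> chi B h" if "h \<in> Gamma0 g s" for h using that assms(3) by simp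
  \<comment> \<open>One-letter words tell the characters apart, so equal characters come from equal
    sets.\<close>
  have "i \<in> A \<longleftrightarrow> i \<in> B" if "i \<le> g" for i
  proof -
    have "wv [i] \<in> Gamma0 g s"
      using that unfolding Gamma0_eq mem_Collect_eq by (intro exI[of _ "[i]"]) simp
    from same[OF this] show ?thesis using chi_wv[of "[i]" A] chi_wv[of "[i]" B] that
      by (simp split: if_splits)
  qed
  then show False using AB by blast
qed

text \<open>\<open>U\<close> is meant as a neighbourhood of a fixed point of \<open>s i\<close>:
  inside \<open>D i\<close>, preserved by \<open>s i\<close>, and not reached by \<open>s i\<close>
  from outside \<open>D i\<close>. Only two elements return to it, too few for a limit point in
  \<open>U\<close>.\<close>

lemma returning_elements:
  assumes i: "i \<le> g" and U: "U \<subseteq> D i" "\<And>x. x \<notin> D i \<Longrightarrow> s i x \<notin> U" "\<And>x. x \<in> U \<Longrightarrow> s i x \<in> U"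
  shows "{h \<in> Gamma0 g s. \<exists>x\<in>U. h x \<in> U} \<subseteq> {id, s i}"
proof
  \<comment> \<open>A point of \<open>U\<close> is outside the set of the last letter, so ping-pong
    applies; the resulting image of the complement of \<open>D (hd u)\<close> misses
    \<open>U\<close> whether or not \<open>hd u\<close> is \<open>i\<close>.\<close>
  have *: "u = []" if u: "successively (\<noteq>) u" "set u \<subseteq> {..g}" "u = [] \<or> last u \<noteq> i"
    "x \<in> U" "wv u x \<in> U" for u x
  proof (rule ccontr)
    assume ne: "u \<noteq> []"
    then have l: "last u \<noteq> i" "last u \<le> g" "hd u \<le> g" using u hd_last_le by auto
    have "x \<notin> D (last u)" using D_disjoint[OF i l(2)] l(1) U(1) u(4) by auto
    from wv_reduced_range[OF u(1) ne u(2) this]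
    obtain y where y: "y \<notin> D (hd u)" "wv u x = s (hd u) y" by auto
    show False
    proof (cases "hd u = i")
      case True
      then show False using y U(2) u(5) by auto
    next
      case False
      then show False using y s_D[OF l(3) y(1)] D_disjoint[OF i l(3)] U(1) u(5) by auto
    qed
  qed
  fix h assume "h \<in> {h \<in> Gamma0 g s. \<exists>x\<in>U. h x \<in> U}"
  then obtain w x where w: "h = wv w" "set w \<subseteq> {..g}" and x: "x \<in> U" "h x \<in> U"
    by (auto simp: Gamma0_eq)
  define u where "u = reduce w"
  have u: "h = wv u" "set u \<subseteq> {..g}" "successively (\<noteq>) u"
    using w(1) wv_reduce[OF w(2)] subset_trans[OF set_reduce w(2)] successively_reduce[of w]
    by (simp_all add: u_def)
  show "h \<in> {id, s i}"
  proof (cases "u = [] \<or> last u \<noteq> i")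
    case True
    have "u = []" using *[OF u(3) u(2) True x(1)] x(2) u(1) by simp
    then show ?thesis using u by simp
  next
    case False
    \<comment> \<open>A final letter \<open>i\<close> can be stripped off, as \<open>s i\<close>
      maps \<open>U\<close> into itself.\<close>
    then obtain u' where u': "u = u' @ [i]" by (metis append_butlast_last_id)
    have "u' = []"
    proof (rule *)
      show "successively (\<noteq>) u'" "u' = [] \<or> last u' \<noteq> i" "set u' \<subseteq> {..g}"
        using u by (auto simp: u' successively_append_iff)
      show "s i x \<in> U" "wv u' (s i x) \<in> U" using U(3) x u by (auto simp: u')
    qed
    then show ?thesis using u u' by simp
  qed
qed

end

section \<open>Discrete valuations with odd residue characteristic\<close>

locale valuation =
  fixes v :: "'a :: field \<Rightarrow> int"
  assumes v_mult: "x \<noteq> 0 \<Longrightarrow> y \<noteq> 0 \<Longrightarrow> v (x * y) = v x + v y"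
    and v_add: "x \<noteq> 0 \<Longrightarrow> y \<noteq> 0 \<Longrightarrow> x + y \<noteq> 0 \<Longrightarrow> min (v x) (v y) \<le> v (x + y)"
    and two_nonzero: "(2 :: 'a) \<noteq> 0"
    and v_2: "v 2 = 0"
begin

text \<open>Treats 0 as having infinite valuation, whatever number \<open>v 0\<close> is.\<close>

definition vge :: "'a \<Rightarrow> int \<Rightarrow> bool" where
  "vge x n \<longleftrightarrow> x = 0 \<or> n \<le> v x"

lemma v_1 [simp]: "v 1 = 0"
  using v_mult[of 1 1] by simp

lemma v_minus [simp]: "v (- x) = v x"
proof (cases "x = 0")
  case False
  have "v (- 1) = 0" using v_mult[of "- 1" "- 1"] by simp
  then show ?thesis using v_mult[of "- 1" x] False by simp
qed simp

lemma v_diff_commute: "v (x - y) = v (y - x)"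
  using v_minus[of "x - y"] by simp

lemma v_divide: "x \<noteq> 0 \<Longrightarrow> y \<noteq> 0 \<Longrightarrow> v (x / y) = v x - v y"
  using v_mult[of "x / y" y] by simp

lemma vge_0 [simp]: "vge 0 n"
  by (simp add: vge_def)

lemma vge_self [simp]: "vge x (v x)"
  by (simp add: vge_def)

lemma vge_mono: "vge x n \<Longrightarrow> m \<le> n \<Longrightarrow> vge x m"
  by (auto simp: vge_def)

lemma vge_add: "vge x n \<Longrightarrow> vge y n \<Longrightarrow> vge (x + y) n"
  using v_add[of x y] unfolding vge_def
  by (cases "x = 0"; cases "y = 0"; cases "x + y = 0") auto

lemma vge_minus [simp]: "vge (- x) n \<longleftrightarrow> vge x n"
  by (simp add: vge_def)

lemma vge_diff: "vge x n \<Longrightarrow> vge y n \<Longrightarrow> vge (x - y) n"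
  using vge_add[of x n "- y"] by simp

lemma vge_diff_commute: "vge (x - y) n \<longleftrightarrow> vge (y - x) n"
  using vge_minus[of "x - y" n] by simp

lemma vge_trans: "vge (x - y) n \<Longrightarrow> vge (y - z) n \<Longrightarrow> vge (x - z) n"
  using vge_add[of "x - y" n "y - z"] by simp

lemma vge_mult: "vge x m \<Longrightarrow> vge y n \<Longrightarrow> vge (x * y) (m + n)"
  using v_mult[of x y] by (cases "x = 0"; cases "y = 0") (simp_all add: vge_def)

lemma not_vge: "\<not> vge x n \<longleftrightarrow> x \<noteq> 0 \<and> v x < n"
  by (auto simp: vge_def)

text \<open>A perturbation of strictly larger valuation cannot cancel \<open>x\<close>; as the
  values are integers, strictly larger means at least \<open>v x + 1\<close>.\<close>

lemma v_close:
  assumes "x \<noteq> 0" "vge (y - x) (v x + 1)"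
  shows "y \<noteq> 0" "v y = v x"
proof -
  show y: "y \<noteq> 0" using assms by (auto simp: vge_def)
  have "vge y (v x)" using vge_add[of x "v x" "y - x"] vge_mono[OF assms(2), of "v x"] by simp
  then have "v x \<le> v y" using y by (simp add: vge_def)
  moreover have "\<not> v x < v y"
  proof
    assume "v x < v y"
    then have "vge y (v x + 1)" by (simp add: vge_def)
    then have "vge (y - (y - x)) (v x + 1)" using assms(2) by (rule vge_diff)
    then show False using assms(1) by (simp add: vge_def)
  qed
  ultimately show "v y = v x" by simp
qed

lemma v_half: "x \<noteq> 0 \<Longrightarrow> v (x / 2) = v x"
  using v_divide[of x 2] by (simp add: two_nonzero v_2)

lemma in_disc [simp]: "x \<in> disc v c n \<longleftrightarrow> vge (x - c) n"
  by (simp add: disc_def vge_def)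

lemma disc_mono: "m \<le> n \<Longrightarrow> disc v c n \<subseteq> disc v c m"
  using vge_mono[of _ n m] by auto

lemma integral_iff: "integral v x \<longleftrightarrow> vge x 0"
  by (simp add: integral_def vge_def)

subsection \<open>The topology of the projective line\<close>

lemma basic_nbhd_Fin: "basic_nbhd v (Fin x) n = Fin ` disc v x n"
  by (simp add: basic_nbhd_def disc_def)

lemma in_basic_nbhd: "p \<in> basic_nbhd v p n"
  by (cases p) (auto simp: basic_nbhd_def)

lemma openin_basic_nbhd: "openin (P1_topology v) (basic_nbhd v p n)"
  unfolding openin_P1_topology
proof
  fix q assume q: "q \<in> basic_nbhd v p n"
  show "\<exists>m. basic_nbhd v q m \<subseteq> basic_nbhd v p n"
  proof (cases p)
    case (Fin x)
    then obtain y where y: "q = Fin y" "vge (y - x) n" using q by (auto simp: basic_nbhd_Fin)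
    have "basic_nbhd v q n \<subseteq> basic_nbhd v p n"
      using y(2) vge_trans by (auto simp: basic_nbhd_Fin Fin y(1))
    then show ?thesis ..
  next
    case Infty
    show ?thesis
    proof (cases q)
      case (Fin y)
      then have y: "y \<noteq> 0" "v y \<le> - n" using q Infty by (auto simp: basic_nbhd_def)
      have "Fin w \<in> basic_nbhd v p n" if "vge (w - y) (v y + 1)" for w
        using v_close[OF y(1) that] y(2) by (simp add: Infty basic_nbhd_def)
      then have "basic_nbhd v q (v y + 1) \<subseteq> basic_nbhd v p n"
        by (auto simp: basic_nbhd_Fin Fin)
      then show ?thesis ..
    qed (use Infty in auto)
  qed
qed

lemma topspace_P1 [simp]: "topspace (P1_topology v) = UNIV"
  using openin_subset[of "P1_topology v" UNIV] by (auto simp: openin_P1_topology)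

lemma continuous_inversion:
  assumes "k \<noteq> 0"
  shows "continuous_map (P1_topology v) (P1_topology v) (mobius 0 k 1 0)"
  unfolding continuous_map
proof (intro conjI allI impI)
  fix U assume "openin (P1_topology v) U"
  then have U: "\<exists>n. basic_nbhd v p n \<subseteq> U" if "p \<in> U" for p
    using that by (simp add: openin_P1_topology)
  show "openin (P1_topology v) {x \<in> topspace (P1_topology v). mobius 0 k 1 0 x \<in> U}"
    unfolding openin_P1_topology
  proof
    fix p assume "p \<in> {x \<in> topspace (P1_topology v). mobius 0 k 1 0 x \<in> U}"
    then obtain n where n: "basic_nbhd v (mobius 0 k 1 0 p) n \<subseteq> U" using U by auto
    have "\<exists>m. \<forall>q\<in>basic_nbhd v p m. mobius 0 k 1 0 q \<in> basic_nbhd v (mobius 0 k 1 0 p) n"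
    proof (cases "p = Infty \<or> p = Fin 0")
      case True
      then show ?thesis
      proof
        assume p: "p = Infty"
        have "\<forall>q\<in>basic_nbhd v p (n - v k). mobius 0 k 1 0 q \<in> basic_nbhd v (mobius 0 k 1 0 p) n"
          using assms by (auto simp: p basic_nbhd_def v_divide)
        then show ?thesis ..
      next
        assume p: "p = Fin 0"
        have "\<forall>q\<in>basic_nbhd v p (n + v k). mobius 0 k 1 0 q \<in> basic_nbhd v (mobius 0 k 1 0 p) n"
          using assms by (auto simp: p basic_nbhd_def v_divide)
        then show ?thesis ..
      qed
    next
      case False
      then obtain x where p: "p = Fin x" "x \<noteq> 0" by (cases p) auto
      \<comment> \<open>The first bound forces v y = v x; the second then makes the valuation of k
        (x - y) / (x y) at least n.\<close>
      let ?m = "max (v x + 1) (n + 2 * v x - v k)"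
      have "mobius 0 k 1 0 q \<in> basic_nbhd v (mobius 0 k 1 0 p) n" if q: "q \<in> basic_nbhd v p ?m" for q
      proof -
        obtain y where y: "q = Fin y" "vge (y - x) ?m" using q p by (auto simp: basic_nbhd_Fin)
        have vy: "y \<noteq> 0" "v y = v x"
          using v_close[OF p(2) vge_mono[OF y(2)]] by auto
        have "k / y - k / x = k * (x - y) / (x * y)"
          using p vy by (simp add: field_simps)
        moreover have "vge (k * (x - y) / (x * y)) n"
        proof (cases "x = y")
          case False
          then have "?m \<le> v (x - y)" using y(2) v_diff_commute[of x y] by (simp add: vge_def)
          then show ?thesis using False p vy assms by (simp add: vge_def v_divide v_mult)
        qed simp
        ultimately show ?thesis using p y vy by (simp add: basic_nbhd_Fin)
      qed
      then show ?thesis by blast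
    qed
    then show "\<exists>m. basic_nbhd v p m \<subseteq> {x \<in> topspace (P1_topology v). mobius 0 k 1 0 x \<in> U}"
      (is ?thesis)
    proof
      fix m assume "\<forall>q\<in>basic_nbhd v p m. mobius 0 k 1 0 q \<in> basic_nbhd v (mobius 0 k 1 0 p) n"
      then have "basic_nbhd v p m \<subseteq> {x \<in> topspace (P1_topology v). mobius 0 k 1 0 x \<in> U}"
        using n by auto
      then show ?thesis ..
    qed
  qed
qed simp

subsection \<open>Limit points\<close>

lemma limit_points_mono: "H \<subseteq> H' \<Longrightarrow> limit_points v H \<subseteq> limit_points v H'"
  unfolding limit_points_def by blast

text \<open>Left translation by \<open>t\<close> turns a sequence converging to \<open>p\<close>
  into one converging to \<open>t p\<close> and keeps the group elements distinct.\<close>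

lemma limit_points_continuous_image:
  assumes t: "t \<in> carrier PGL2" "continuous_map (P1_topology v) (P1_topology v) t"
    and H: "\<And>h. h \<in> H \<Longrightarrow> t \<circ> h \<in> H" and p: "p \<in> limit_points v H"
  shows "t p \<in> limit_points v H"
proof -
  obtain q h where h: "inj h" "range h \<subseteq> H" "limitin (P1_topology v) (\<lambda>n :: nat. h n q) p sequentially"
    using p by (auto simp: limit_points_def)
  have "inj (\<lambda>n. t \<circ> h n)"
  proof (rule injI)
    fix m n assume "t \<circ> h m = t \<circ> h n"
    from fun_cong[OF this] have "h m x = h n x" for x
      using PGL2_inj[OF t(1)] by (simp add: inj_eq)
    then have "h m = h n" by blast
    then show "m = n" using h(1) by (simp add: inj_eq)
  qed
  moreover have "range (\<lambda>n. t \<circ> h n) \<subseteq> H" using H h(2) by auto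
  moreover have "limitin (P1_topology v) (\<lambda>n :: nat. (t \<circ> h n) q) (t p) sequentially"
    using continuous_map_limit[OF t(2) h(3)] by (simp add: o_def)
  ultimately show ?thesis unfolding limit_points_def by blast
qed

text \<open>If h_n q tends to \<open>p\<close>, the elements h_n h_N^(-1) with n \<ge> N are
  pairwise distinct, and each takes h_N q, a point of \<open>U\<close>, back into
  \<open>U\<close>.\<close>

lemma not_limit_point:
  assumes H: "subgroup H PGL2" and U: "openin (P1_topology v) U" "p \<in> U"
    and fin: "finite {h \<in> H. \<exists>x\<in>U. h x \<in> U}"
  shows "p \<notin> limit_points v H"
proof
  assume "p \<in> limit_points v H"
  then obtain q h where h: "inj h" "range h \<subseteq> H"
    "limitin (P1_topology v) (\<lambda>n :: nat. h n q) p sequentially"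
    by (auto simp: limit_points_def)
  then obtain N where N: "h n q \<in> U" if "n \<ge> N" for n
    using U unfolding limitin_def eventually_sequentially by meson
  have hH: "h n \<in> H" and hc: "h n \<in> carrier PGL2" for n
    using h(2) subgroup.subset[OF H] by auto
  define f where "f n = h n \<circ> inv\<^bsub>PGL2\<^esub> (h N)" for n
  have "f n \<in> H" for n
    using subgroup.m_closed[OF H hH[of n] subgroup.m_inv_closed[OF H hH[of N]]] by (simp add: f_def)
  moreover have fN: "f n (h N x) = h n x" for n x by (simp add: f_def PGL2_inv_apply[OF hc])
  ultimately have "f ` {N..} \<subseteq> {h \<in> H. \<exists>x\<in>U. h x \<in> U}"
    using N by (auto intro!: bexI[of _ "h N q"])
  moreover have "inj_on f {N..}"
  proof (rule inj_onI)
    fix m n assume "f m = f n"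
    then have "h m x = h n x" for x using fN[of m x] fN[of n x] by simp
    then have "h m = h n" by blast
    then show "m = n" using h(1) by (simp add: inj_eq)
  qed
  ultimately have "finite {N..}" using fin by (meson finite_imageD finite_subset)
  then show False using infinite_Ici by blast
qed

text \<open>On a compact projective line all orbit closures are compact, so discontinuity reduces to
  one point outside the limit set.\<close>

lemma pingpong_schottky:
  assumes "pingpong g s D p0" "compact_space (P1_topology v)" "p \<notin> limit_points v (Gamma g s)"
  shows "schottky v (Gamma g s)"
proof -
  interpret pingpong g s D p0 by fact
  have "compactin (P1_topology v) (P1_topology v closure_of X)" for X
    using assms(2) by (intro closedin_compact_space) auto
  then have "acts_discontinuously v (Gamma g s)"
    using assms(3) by (auto simp: acts_discontinuously_def)
  moreover have "finite ((\<lambda>i. s 0 \<circ> s i) ` {1..g})" by simp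
  ultimately show ?thesis
    using Gamma_free_basis Gamma_subgroup unfolding schottky_def by blast
qed

subsection \<open>Dynamics of an involution with finite fixed points\<close>

lemma pair_involution_commute: "pair_involution a b = pair_involution b a"
  by (simp add: pair_involution_def algebra_simps)

lemma pair_involution_centered:
  fixes w m f :: 'a
  assumes "w \<noteq> 0"
  shows "pair_involution (m - f) (m + f) (Fin (m + w)) = Fin (f * f / w + m)"
proof -
  have den: "2 * (m + w) + - (m - f + (m + f)) = 2 * w" by (simp add: algebra_simps)
  have num: "(m - f + (m + f)) * (m + w) + - (2 * (m - f) * (m + f)) = 2 * (f * f + m * w)"
    by (simp add: algebra_simps)
  show ?thesis
    unfolding pair_involution_def mobius.simps den num
    using assms two_nonzero by (simp add: add_divide_distrib)
qed

text \<open>The offset of \<open>z\<close> from the midpoint has the valuation of z - a, which is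
  below that of f; hence f^2 divided by the offset has valuation above that of f.\<close>

lemma pair_involution_far:
  fixes a b :: 'a
  assumes "a \<noteq> b" and x: "x \<notin> Fin ` disc v a (v (b - a))"
  shows "pair_involution a b x \<in> Fin ` disc v ((a + b) / 2) (v (b - a) + 1)"
proof (cases x)
  case Infty
  then show ?thesis by (auto simp: pair_involution_def two_nonzero)
next
  case (Fin z)
  define m f where "m = (a + b) / 2" and "f = (b - a) / 2"
  let ?r = "v (b - a)"
  have mf: "2 * m = a + b" "2 * f = b - a"
    using two_nonzero by (simp_all add: m_def f_def)
  have "2 * a = 2 * (m - f)" "2 * b = 2 * (m + f)"
    unfolding right_diff_distrib distrib_left mf by simp_all
  then have ab: "a = m - f" "b = m + f"
    by (simp_all only: mult_left_cancel[OF two_nonzero])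
  have f: "f \<noteq> 0" "v f = ?r" using assms(1) two_nonzero by (simp_all add: f_def v_half)
  have z: "z - a \<noteq> 0" "v (z - a) < ?r"
    using x Fin by (auto simp: image_iff not_vge)
  have "vge ((z - m) - (z - a)) (v (z - a) + 1)"
    using z(2) f(2) unfolding ab(1) by (simp add: vge_def)
  from v_close[OF z(1) this] have zm: "z - m \<noteq> 0" "v (z - m) = v (z - a)" .
  have "pair_involution a b x = Fin (f * f / (z - m) + m)"
    using pair_involution_centered[OF zm(1), of m f] by (simp add: Fin ab[symmetric])
  moreover have "v (f * f / (z - m)) = 2 * ?r - v (z - m)"
    using f zm(1) by (simp add: v_divide v_mult)
  then have "vge (f * f / (z - m)) (?r + 1)"
    using z(2) zm(2) by (simp add: vge_def)
  ultimately show ?thesis by (simp add: m_def[symmetric])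
qed

text \<open>As 2 is a unit, the midpoint is exactly as far from \<open>a\<close> as \<open>b\<close>
  is: within that radius, but not in the next smaller disc around \<open>a\<close>.\<close>

lemma midpoint_disc:
  assumes "a \<noteq> b"
  shows "disc v ((a + b) / 2) (v (b - a) + 1) \<subseteq> disc v a (v (b - a))"
    and "disc v ((a + b) / 2) (v (b - a) + 1) \<inter> disc v a (v (b - a) + 1) = {}"
proof -
  have e: "(a + b) / 2 - a = (b - a) / 2" using two_nonzero by (simp add: field_simps)
  have m: "(a + b) / 2 - a \<noteq> 0" "v ((a + b) / 2 - a) = v (b - a)"
    unfolding e using assms two_nonzero by (simp_all add: v_half)
  show "disc v ((a + b) / 2) (v (b - a) + 1) \<subseteq> disc v a (v (b - a))"
  proof
    fix y assume "y \<in> disc v ((a + b) / 2) (v (b - a) + 1)"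
    then have "vge (y - (a + b) / 2) (v (b - a))" using vge_mono by simp
    moreover have "vge ((a + b) / 2 - a) (v (b - a))" unfolding m(2)[symmetric] by simp
    ultimately have "vge (y - a) (v (b - a))" by (rule vge_trans)
    then show "y \<in> disc v a (v (b - a))" by simp
  qed
  show "disc v ((a + b) / 2) (v (b - a) + 1) \<inter> disc v a (v (b - a) + 1) = {}"
  proof (rule ccontr)
    assume "disc v ((a + b) / 2) (v (b - a) + 1) \<inter> disc v a (v (b - a) + 1) \<noteq> {}"
    then obtain y where "vge ((a + b) / 2 - y) (v (b - a) + 1)" "vge (y - a) (v (b - a) + 1)"
      using vge_diff_commute by auto
    then have "vge ((a + b) / 2 - a) (v (b - a) + 1)" by (rule vge_trans)
    then show False using m by (simp add: vge_def)
  qed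
qed

text \<open>The image of z minus a equals (z - a) (b - a) / (2 z - a - b). Near \<open>a\<close> the
  denominator has the valuation of b - a, so the distance to \<open>a\<close> is preserved.\<close>

lemma pair_involution_near:
  fixes a b :: 'a
  assumes "a \<noteq> b" and x: "x \<in> Fin ` disc v a (v (b - a) + 1)"
  shows "pair_involution a b x \<in> Fin ` disc v a (v (b - a) + 1)"
proof -
  let ?r = "v (b - a)"
  obtain z where z: "x = Fin z" "vge (z - a) (?r + 1)" using x by auto
  have ab: "a - b \<noteq> 0" using assms(1) by simp
  have v_ab: "v (a - b) = ?r" by (rule v_diff_commute)
  have "vge 2 0" by (simp add: vge_def v_2)
  from vge_mult[OF this z(2)] have "vge (2 * (z - a)) (v (a - b) + 1)" by (simp add: v_ab)
  moreover have "2 * (z - a) = (2 * z - (a + b)) - (a - b)" by (simp add: algebra_simps)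
  ultimately have "vge ((2 * z - (a + b)) - (a - b)) (v (a - b) + 1)" by simp
  from v_close[OF ab this] have den: "2 * z - (a + b) \<noteq> 0" "v (2 * z - (a + b)) = ?r"
    unfolding v_ab .
  have "(a + b) * z - 2 * a * b = (z - a) * (b - a) + a * (2 * z - (a + b))"
    by (simp add: algebra_simps)
  then have "((a + b) * z - 2 * a * b) / (2 * z - (a + b)) = (z - a) * (b - a) / (2 * z - (a + b)) + a"
    using den(1) by (simp add: add_divide_distrib)
  then have "pair_involution a b x = Fin ((z - a) * (b - a) / (2 * z - (a + b)) + a)"
    using den(1) unfolding pair_involution_def z(1) mobius.simps add_uminus_conv_diff by simp
  moreover have "vge ((z - a) * (b - a) / (2 * z - (a + b))) (?r + 1)"
  proof (cases "z = a")
    case False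
    then have "v ((z - a) * (b - a) / (2 * z - (a + b))) = v (z - a)"
      using den assms(1) by (simp add: v_divide v_mult)
    then show ?thesis using z(2) False by (simp add: vge_def)
  qed simp
  ultimately show ?thesis by simp
qed

end

subsection \<open>Configurations of pairs with disjoint discs\<close>

text \<open>Pair number 2 is \<open>{1, \<infinity>}\<close>; the value of \<open>\<beta> 2\<close> is irrelevant.\<close>

locale pair_configuration = valuation v for v :: "'a :: field \<Rightarrow> int" +
  fixes g :: nat and \<alpha> \<beta> :: "nat \<Rightarrow> 'a" and c :: 'a
  assumes g_ge_2: "2 \<le> g" and \<alpha>_2: "\<alpha> 2 = 1"
    and \<alpha>_neq_\<beta>: "i \<le> g \<Longrightarrow> i \<noteq> 2 \<Longrightarrow> \<alpha> i \<noteq> \<beta> i"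
    and v_\<alpha>: "i \<le> g \<Longrightarrow> i \<noteq> 2 \<Longrightarrow> vge (\<alpha> i) 1"
    and v_\<beta>_\<alpha>: "i \<le> g \<Longrightarrow> i \<noteq> 2 \<Longrightarrow> 1 \<le> v (\<beta> i - \<alpha> i)"
    and separated: "i \<le> g \<Longrightarrow> j \<le> g \<Longrightarrow> i \<noteq> 2 \<Longrightarrow> j \<noteq> 2 \<Longrightarrow> i \<noteq> j \<Longrightarrow>
      \<not> vge (\<alpha> i - \<alpha> j) (v (\<beta> i - \<alpha> i))"
    and v_c: "vge c 1"
    and c_outside: "i \<le> g \<Longrightarrow> i \<noteq> 2 \<Longrightarrow> \<not> vge (c - \<alpha> i) (v (\<beta> i - \<alpha> i))"
begin

definition a :: "nat \<Rightarrow> 'a P1" where "a i = Fin (\<alpha> i)"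

definition b :: "nat \<Rightarrow> 'a P1" where "b i = (if i = 2 then Infty else Fin (\<beta> i))"

definition s :: "nat \<Rightarrow> 'a P1 \<Rightarrow> 'a P1" where
  "s i = (if i = 2 then mobius (- 1) (2 * 1) 0 1 else pair_involution (\<alpha> i) (\<beta> i))"

text \<open>For pair 2 the set has to contain infinity. Its complement is the maximal ideal, which z
  to 2 - z sends outside itself because 2 is a unit. The other discs are the smallest ones
  containing both fixed points.\<close>

definition D :: "nat \<Rightarrow> 'a P1 set" where
  "D i = (if i = 2 then - Fin ` disc v 0 1 else Fin ` disc v (\<alpha> i) (v (\<beta> i - \<alpha> i)))"

lemma a_b_neq: "i \<le> g \<Longrightarrow> a i \<noteq> b i"
  by (simp add: a_def b_def \<alpha>_neq_\<beta>)

lemma s_fixing: "i \<le> g \<Longrightarrow> s i \<in> fixing_involutions (a i) (b i)"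
  using reflection_in_fixing_involutions[OF two_nonzero, of 1]
    pair_involution_in[OF \<alpha>_neq_\<beta> two_nonzero]
  by (auto simp: s_def a_def b_def \<alpha>_2)

lemma D_2_disjoint: "i \<le> g \<Longrightarrow> i \<noteq> 2 \<Longrightarrow> Fin ` disc v (\<alpha> i) (v (\<beta> i - \<alpha> i)) \<subseteq> Fin ` disc v 0 1"
proof
  fix x assume i: "i \<le> g" "i \<noteq> 2" and x: "x \<in> Fin ` disc v (\<alpha> i) (v (\<beta> i - \<alpha> i))"
  then obtain z where z: "x = Fin z" "vge (z - \<alpha> i) 1" using vge_mono v_\<beta>_\<alpha> by auto
  from vge_add[OF z(2) v_\<alpha>[OF i]] show "x \<in> Fin ` disc v 0 1" using z(1) by simp
qed

lemma pingpong: "pingpong g s D (Fin c)"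
proof
  fix i assume i: "i \<le> g"
  show "s i \<in> carrier PGL2" "s i \<circ> s i = id"
    using s_fixing[OF i] by (auto simp: fixing_involutions_iff)
  show "Fin c \<notin> D i" using v_c c_outside[OF i] by (auto simp: D_def)
  fix x assume x: "x \<notin> D i"
  show "s i x \<in> D i"
  proof (cases "i = 2")
    case True
    then obtain z where z: "x = Fin z" "vge z 1" using x by (auto simp: D_def)
    have "\<not> vge (2 - z) 1"
    proof
      assume "vge (2 - z) 1"
      from vge_add[OF this z(2)] show False using two_nonzero v_2 by (simp add: vge_def)
    qed
    then show ?thesis using True z by (auto simp: D_def s_def)
  next
    case False
    then show ?thesis
      using pair_involution_far[OF \<alpha>_neq_\<beta>[OF i False], of x] x midpoint_disc(1)[OF \<alpha>_neq_\<beta>[OF i False]]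
      by (auto simp: D_def s_def)
  qed
next
  fix i j assume ij: "i \<le> g" "j \<le> g" "i \<noteq> j"
  \<comment> \<open>Of two finite discs let \<open>D j\<close> be the larger; if they met, it would
    contain both centres, against \<open>separated\<close>.\<close>
  have *: "D i \<inter> D j = {}" if "i \<le> g" "j \<le> g" "i \<noteq> j" "j \<noteq> 2"
      "i = 2 \<or> v (\<beta> j - \<alpha> j) \<le> v (\<beta> i - \<alpha> i)" for i j
  proof (cases "i = 2")
    case True
    then show ?thesis using D_2_disjoint[OF that(2,4)] that(4) by (auto simp: D_def)
  next
    case False
    show ?thesis
    proof (rule ccontr)
      assume "D i \<inter> D j \<noteq> {}"
      then obtain x where "vge (x - \<alpha> i) (v (\<beta> i - \<alpha> i))" "vge (x - \<alpha> j) (v (\<beta> j - \<alpha> j))"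
        using False \<open>j \<noteq> 2\<close> unfolding D_def by auto
      then have "vge (\<alpha> j - x) (v (\<beta> j - \<alpha> j))" "vge (x - \<alpha> i) (v (\<beta> j - \<alpha> j))"
        using vge_mono that False vge_diff_commute by blast+
      then have "vge (\<alpha> j - \<alpha> i) (v (\<beta> j - \<alpha> j))" by (rule vge_trans)
      then show False using separated[of j i] that False by auto
    qed
  qed
  consider "j \<noteq> 2" "i = 2 \<or> v (\<beta> j - \<alpha> j) \<le> v (\<beta> i - \<alpha> i)"
    | "i \<noteq> 2" "j = 2 \<or> v (\<beta> i - \<alpha> i) \<le> v (\<beta> j - \<alpha> j)"
    using ij(3) by linarith
  then show "D i \<inter> D j = {}"
    using *[of i j] *[of j i] ij by cases (simp_all add: Int_commute)
qed

sublocale pingpong g s D "Fin c"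
  by (rule pingpong)

lemma limit_points_Gamma0:
  assumes "i \<le> g" "p \<in> {a i, b i}"
  shows "p \<notin> limit_points v (Gamma0 g s)"
proof -
  \<comment> \<open>A basic neighbourhood with these properties meets its image under at most two
    group elements, so only a suitable radius has to be found for each fixed point.\<close>
  have *: "p \<notin> limit_points v (Gamma0 g s)" if "U \<subseteq> D i" "\<And>x. x \<notin> D i \<Longrightarrow> s i x \<notin> U"
    "\<And>x. x \<in> U \<Longrightarrow> s i x \<in> U" "U = basic_nbhd v p n" for U n
  proof (rule not_limit_point[OF Gamma0_subgroup])
    show "openin (P1_topology v) U" "p \<in> U"
      using that(4) openin_basic_nbhd in_basic_nbhd by auto
    have "{h \<in> Gamma0 g s. \<exists>x\<in>U. h x \<in> U} \<subseteq> {id, s i}"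
      using returning_elements[of i U] assms(1) that(1-3) by blast
    then show "finite {h \<in> Gamma0 g s. \<exists>x\<in>U. h x \<in> U}" by (rule finite_subset) simp
  qed
  show ?thesis
  proof (cases "i = 2")
    case True
    have s2: "s i (Fin z) = Fin (2 - z)" "s i Infty = Infty" for z
      by (simp_all add: s_def True)
    have D2: "x \<in> D i \<longleftrightarrow> x \<notin> Fin ` {z. vge z 1}" for x
      by (auto simp: D_def True)
    consider "p = Fin 1" | "p = Infty"
      using assms(2) by (auto simp: a_def b_def True \<alpha>_2)
    then show ?thesis
    proof cases
      case 1
      have 11: "(1 :: 'a) \<noteq> 0" by simp
      show ?thesis
      proof (rule *)
        show "basic_nbhd v p 1 = basic_nbhd v p 1" ..
        show "basic_nbhd v p 1 \<subseteq> D i"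
          proof
          fix x assume "x \<in> basic_nbhd v p 1"
          then obtain z where z: "x = Fin z" "vge (z - 1) 1" by (auto simp: 1 basic_nbhd_Fin)
          have "\<not> vge z 1"
          proof
            assume "vge z 1"
            from vge_diff[OF this z(2)] show False by (simp add: vge_def)
          qed
          then show "x \<in> D i" by (simp add: z(1) D2 image_iff)
        qed
        show "s i x \<in> basic_nbhd v p 1" if x: "x \<in> basic_nbhd v p 1" for x
        proof -
          obtain z where z: "x = Fin z" "vge (z - 1) 1" using x by (auto simp: 1 basic_nbhd_Fin)
          then have "vge (2 - z - 1) 1" using vge_diff_commute[of z 1 1] by (simp add: algebra_simps)
          then show ?thesis by (simp add: 1 basic_nbhd_Fin z s2)
        qed
        show "s i x \<notin> basic_nbhd v p 1" if "x \<notin> D i" for x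
        proof
          assume h: "s i x \<in> basic_nbhd v p 1"
          obtain z where z: "x = Fin z" "vge z 1" using \<open>x \<notin> D i\<close> by (auto simp: D2)
          have "vge (2 - z - 1) 1" using h by (auto simp: 1 basic_nbhd_Fin z s2)
          from vge_add[OF this z(2)] show False by (simp add: vge_def)
        qed
      qed
    next
      case 2
      have neg: "Fin y \<in> basic_nbhd v p 1 \<longleftrightarrow> y \<noteq> 0 \<and> v y < 0" for y
        by (auto simp: 2 basic_nbhd_def)
      have neg2: "2 - y \<noteq> 0 \<and> v (2 - y) < 0" if "y \<noteq> 0" "v y < 0" for y
      proof -
        have "vge ((2 - y) - (- y)) (v (- y) + 1)" using that(2) v_2 by (simp add: vge_def)
        from v_close[OF _ this] show ?thesis using that by simp
      qed
      show ?thesis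
      proof (rule *)
        show "basic_nbhd v p 1 = basic_nbhd v p 1" ..
        show "basic_nbhd v p 1 \<subseteq> D i"
        proof
          fix x assume x: "x \<in> basic_nbhd v p 1"
          show "x \<in> D i"
          proof (cases x)
            case (Fin y)
            then have "\<not> vge y 1" using x neg[of y] by (simp add: vge_def)
            then show ?thesis using Fin by (simp add: D2 image_iff)
          qed (simp add: D2 image_iff)
        qed
        show "s i x \<in> basic_nbhd v p 1" if "x \<in> basic_nbhd v p 1" for x
          using that neg neg2 by (cases x) (auto simp: s2)
        show "s i x \<notin> basic_nbhd v p 1" if "x \<notin> D i" for x
        proof
          assume h: "s i x \<in> basic_nbhd v p 1"
          obtain z where z: "x = Fin z" "vge z 1" using \<open>x \<notin> D i\<close> by (auto simp: D2)
          then have "2 - z \<noteq> 0 \<and> v (2 - z) < 0" using h by (simp add: s2 neg)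
          from neg2[OF conjunct1[OF this] conjunct2[OF this]] show False
            using z by (auto simp: vge_def)
        qed
      qed
    qed
  next
    case False
    \<comment> \<open>Stated for \<open>x\<close> and \<open>y\<close> so that it serves both points
      of the pair, in which involution and disc are symmetric. The neighbourhood has valuation
      radius one more than \<open>D i\<close>, which separates it from the midpoint.\<close>
    have key: "Fin x \<notin> limit_points v (Gamma0 g s)"
      if p: "p = Fin x" and x: "x \<noteq> y" "s i = pair_involution x y" "D i = Fin ` disc v x (v (y - x))" for x y
    proof -
      have "p \<notin> limit_points v (Gamma0 g s)"
      proof (rule *)
        show "Fin ` disc v x (v (y - x) + 1) \<subseteq> D i" 
          unfolding x(3) by (intro image_mono disc_mono) simp
        show "s i u \<notin> Fin ` disc v x (v (y - x) + 1)" if "u \<notin> D i" for u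
        proof
          assume h: "s i u \<in> Fin ` disc v x (v (y - x) + 1)"
          have "s i u \<in> Fin ` disc v ((x + y) / 2) (v (y - x) + 1)"
            using pair_involution_far[OF x(1) that[unfolded x(3)]] by (simp add: x(2))
          with h obtain z where "z \<in> disc v x (v (y - x) + 1)"
            "z \<in> disc v ((x + y) / 2) (v (y - x) + 1)"
            by (auto simp del: in_disc)
          then show False using midpoint_disc(2)[OF x(1)] by blast
        qed
        show "s i u \<in> Fin ` disc v x (v (y - x) + 1)" if "u \<in> Fin ` disc v x (v (y - x) + 1)" for u
          using pair_involution_near[OF x(1) that] x(2) by simp
        show "Fin ` disc v x (v (y - x) + 1) = basic_nbhd v p (v (y - x) + 1)"
          by (simp add: p basic_nbhd_Fin)
      qed
      then show ?thesis using p by simp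
    qed
    let ?r = "v (\<beta> i - \<alpha> i)"
    have ab: "vge (\<beta> i - \<alpha> i) ?r" "vge (\<alpha> i - \<beta> i) ?r"
      using vge_diff_commute[of "\<beta> i" "\<alpha> i" ?r] vge_self by blast+
    have "vge (z - \<alpha> i) ?r \<longleftrightarrow> vge (z - \<beta> i) ?r" for z
      using vge_trans[OF _ ab(1), of z] vge_trans[OF _ ab(2), of z] by blast
    then have "disc v (\<alpha> i) ?r = disc v (\<beta> i) ?r" by auto
    then have "disc v (\<alpha> i) ?r = disc v (\<beta> i) (v (\<alpha> i - \<beta> i))"
      unfolding v_diff_commute[of "\<alpha> i" "\<beta> i"] .
    then have D: "D i = Fin ` disc v (\<alpha> i) (v (\<beta> i - \<alpha> i))"
        "D i = Fin ` disc v (\<beta> i) (v (\<alpha> i - \<beta> i))"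
      using False by (simp_all add: D_def)
    have s: "s i = pair_involution (\<alpha> i) (\<beta> i)" "s i = pair_involution (\<beta> i) (\<alpha> i)"
      using False by (simp_all add: s_def pair_involution_commute)
    note neq = \<alpha>_neq_\<beta>[OF assms(1) False]
    have "p = Fin (\<alpha> i) \<or> p = Fin (\<beta> i)"
      using assms(2) False by (simp add: a_def b_def)
    then show ?thesis
    proof
      assume p: "p = Fin (\<alpha> i)"
      show ?thesis using key[OF p neq s(1) D(1)] p by simp
    next
      assume p: "p = Fin (\<beta> i)"
      show ?thesis using key[OF p neq[symmetric] s(2) D(2)] p by simp
    qed
  qed
qed

lemma limit_points_Gamma: "i \<le> g \<Longrightarrow> p \<in> {a i, b i} \<Longrightarrow> p \<notin> limit_points v (Gamma g s)"
  using limit_points_Gamma0 limit_points_mono[OF Gamma_subset_Gamma0] by blast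

lemma a_b_in_D: "i \<le> g \<Longrightarrow> a i \<in> D i \<and> b i \<in> D i"
  by (auto simp: a_def b_def D_def \<alpha>_2 vge_def)

lemma card_pair_set: "card (pair_set g a b) = 2 * g + 2"
proof -
  have a: "i = j" if "i \<le> g" "j \<le> g" "a i = a j \<or> b i = b j \<or> a i = b j" for i j
    using a_b_in_D[OF that(1)] a_b_in_D[OF that(2)] D_disjoint[OF that(1,2)] that(3)
    by (metis disjoint_iff)
  have "inj_on a {..g}" "inj_on b {..g}" using a by (auto simp: inj_on_def)
  moreover have "a ` {..g} \<inter> b ` {..g} = {}"
  proof (rule ccontr)
    assume "a ` {..g} \<inter> b ` {..g} \<noteq> {}"
    then obtain i j where "i \<le> g" "j \<le> g" "a i = b j" by auto
    then show False using a[of i j] a_b_neq by auto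
  qed
  ultimately show ?thesis
    by (simp add: pair_set_def card_Un_disjoint card_image)
qed

lemma superelliptic:
  assumes "compact_space (P1_topology v)"
  shows "superelliptic_pairing v g a b s"
proof -
  have "schottky v (Gamma g s)"
    using pingpong_schottky[OF pingpong assms limit_points_Gamma[of 0]] by blast
  then show ?thesis
    using card_pair_set s_fixing Gamma0_rank by (simp add: superelliptic_pairing_def)
qed

end

section \<open>The tree of a finite subset of the projective line\<close>

lemma card_quotient_kernel:
  "card (X // {(x, y). x \<in> X \<and> y \<in> X \<and> f x = f y}) = card (f ` X)"
proof -
  let ?F = "\<lambda>y. {x \<in> X. f x = y}"
  have "X // {(x, y). x \<in> X \<and> y \<in> X \<and> f x = f y} = ?F ` f ` X"
    unfolding quotient_def image_image by (simp add: Image_def eq_commute UNION_singleton_eq_range cong: conj_cong)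
  moreover have "inj_on ?F (f ` X)" by (rule inj_onI) blast
  ultimately show ?thesis by (simp add: card_image)
qed

text \<open>A graph isomorphism is in particular a bijection of vertices, so the vertex count is an
  invariant of the position.\<close>

lemma not_same_position:
  "card (tree_verts v A) \<noteq> card (tree_verts v A') \<Longrightarrow> \<not> same_position v A A' \<psi>"
  using bij_betw_same_card unfolding same_position_def by blast

context valuation
begin

lemma invertible_reductionE:
  assumes "invertible_reduction v h"
  obtains a b c d where "h = mobius a b c d" "vge a 0" "vge b 0" "vge c 0" "vge d 0"
    "a * d - b * c \<noteq> 0" "v (a * d - b * c) = 0"
  using assms unfolding invertible_reduction_def integral_iff by blast

lemma invertible_reductionI:
  assumes "vge a 0" "vge b 0" "vge c 0" "vge d 0" "a * d - b * c \<noteq> 0" "v (a * d - b * c) = 0"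
  shows "invertible_reduction v (mobius a b c d)"
  using assms unfolding invertible_reduction_def integral_iff by blast

lemma invertible_reduction_in_PGL2: "invertible_reduction v h \<Longrightarrow> h \<in> carrier PGL2"
  by (auto elim: invertible_reductionE)

lemma invertible_reduction_id: "invertible_reduction v id"
  using invertible_reductionI[of 1 0 0 1] mobius_diagonal[of "1 :: 'a"] by (simp add: vge_def)

lemma vge_mult_0: "vge x 0 \<Longrightarrow> vge y 0 \<Longrightarrow> vge (x * y) 0"
  using vge_mult[of x 0 y 0] by simp

lemma invertible_reduction_comp:
  assumes "invertible_reduction v f" "invertible_reduction v h"
  shows "invertible_reduction v (f \<circ> h)"
proof -
  obtain a b c d where f: "f = mobius a b c d" "vge a 0" "vge b 0" "vge c 0" "vge d 0"
    "a * d - b * c \<noteq> 0" "v (a * d - b * c) = 0"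
    using assms(1) by (rule invertible_reductionE)
  obtain a' b' c' d' where h: "h = mobius a' b' c' d'" "vge a' 0" "vge b' 0" "vge c' 0" "vge d' 0"
    "a' * d' - b' * c' \<noteq> 0" "v (a' * d' - b' * c') = 0"
    using assms(2) by (rule invertible_reductionE)
  have det: "(a * a' + b * c') * (c * b' + d * d') - (a * b' + b * d') * (c * a' + d * c') =
      (a * d - b * c) * (a' * d' - b' * c')"
    by (simp add: algebra_simps)
  show ?thesis
    unfolding f(1) h(1) mobius_comp[OF f(6) h(6)]
  proof (rule invertible_reductionI)
    show "v ((a * a' + b * c') * (c * b' + d * d') - (a * b' + b * d') * (c * a' + d * c')) = 0"
      unfolding det using v_mult[OF f(6) h(6)] f(7) h(7) by simp
  qed (use f h det in \<open>simp_all add: vge_add vge_mult_0\<close>)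
qed

lemma invertible_reduction_inv:
  assumes "invertible_reduction v h"
  shows "invertible_reduction v (inv\<^bsub>PGL2\<^esub> h)"
proof -
  obtain a b c d where h: "h = mobius a b c d" "vge a 0" "vge b 0" "vge c 0" "vge d 0"
    "a * d - b * c \<noteq> 0" "v (a * d - b * c) = 0"
    using assms by (rule invertible_reductionE)
  have "d * a - (- b) * (- c) = a * d - b * c" by (simp add: mult.commute)
  then show ?thesis
    unfolding h(1) PGL2_inv_mobius[OF h(6)] using h(2-7)
    by (intro invertible_reductionI) (simp_all only: vge_minus not_False_eq_True)
qed

subsection \<open>Coordinates adapted to a disc\<close>

text \<open>The affine coordinate taking \<open>x\<close> to 0 and \<open>y\<close> to 1. Up to
  invertible reduction it depends only on the smallest disc containing both, which makes it a
  standard representative of a vertex.\<close>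

definition frame :: "'a \<Rightarrow> 'a \<Rightarrow> 'a P1 \<Rightarrow> 'a P1" where
  "frame x y = mobius 1 (- x) 0 (y - x)"

lemma frame_apply:
  "x \<noteq> y \<Longrightarrow> frame x y (Fin z) = Fin ((z - x) / (y - x))" "frame x y Infty = Infty"
  by (simp_all add: frame_def)

lemma frame_in_PGL2: "x \<noteq> y \<Longrightarrow> frame x y \<in> carrier PGL2"
  unfolding frame_def by (rule mobius_in_PGL2) simp

lemma frame_change_eq:
  assumes "x \<noteq> y" "x' \<noteq> y'"
  shows "frame x' y' \<circ> inv\<^bsub>PGL2\<^esub> (frame x y) = mobius (y - x) (x - x') 0 (y' - x')"
proof -
  have "inv\<^bsub>PGL2\<^esub> (frame x y) = mobius (y - x) x 0 1"
    unfolding frame_def using PGL2_inv_mobius[of 1 "y - x" "- x" 0] assms by simp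
  moreover have "frame x' y' \<circ> mobius (y - x) x 0 1 = mobius (y - x) (x - x') 0 (y' - x')"
    unfolding frame_def using mobius_comp[of 1 "y' - x'" "- x'" 0 "y - x" 1 x 0] assms by simp
  ultimately show ?thesis by simp
qed

lemma disc_eq: "vge (x - x') n \<Longrightarrow> disc v x n = disc v x' n"
  using vge_trans[of _ x n x'] vge_trans[of _ x' n x] vge_diff_commute[of x x' n] by auto

lemma disc_pair_swap: "disc v x (v (y - x)) = disc v y (v (x - y))"
  using disc_eq[of x y "v (y - x)"] v_diff_commute[of x y] vge_diff_commute[of x y "v (y - x)"]
  by simp

text \<open>The radius can be read off from the set: \<open>x\<close> and \<open>y\<close> lie in
  the second disc, which bounds v (y - x) from below, and conversely.\<close>

lemma disc_pair_eqD:
  assumes "disc v x (v (y - x)) = disc v x' (v (y' - x'))" "x \<noteq> y" "x' \<noteq> y'"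
  shows "v (y - x) = v (y' - x')" "vge (x - x') (v (y - x))"
proof -
  have le: "v (y' - x') \<le> v (y - x)"
    if "disc v x (v (y - x)) = disc v x' (v (y' - x'))" "x \<noteq> y" "x' \<noteq> y'" for x y x' y'
  proof -
    have "x \<in> disc v x (v (y - x))" "y \<in> disc v x (v (y - x))" by simp_all
    then have "vge (y - x') (v (y' - x'))" "vge (x' - x) (v (y' - x'))"
      using that(1) vge_diff_commute[of x x'] by simp_all
    then have "vge (y - x) (v (y' - x'))" by (rule vge_trans)
    then show ?thesis using that by (simp add: vge_def)
  qed
  show 1: "v (y - x) = v (y' - x')"
    using le[OF assms] le[OF assms(1)[symmetric] assms(3,2)] by simp
  have "x \<in> disc v x (v (y - x))" by simp
  then have "x \<in> disc v x' (v (y' - x'))" unfolding assms(1) .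
  then show "vge (x - x') (v (y - x))" unfolding 1 by simp
qed

text \<open>The change of coordinate is affine with slope (y - x) / (y' - x') and translation (x -
  x') / (y' - x'). It reduces invertibly exactly when the slope is a unit and the translation is
  integral: equal radii, and centres within that radius.\<close>

lemma frame_change_iff:
  assumes "x \<noteq> y" "x' \<noteq> y'"
  shows "invertible_reduction v (frame x' y' \<circ> inv\<^bsub>PGL2\<^esub> (frame x y)) \<longleftrightarrow>
    disc v x (v (y - x)) = disc v x' (v (y' - x'))" (is "?inv \<longleftrightarrow> ?disc")
proof
  note e = frame_change_eq[OF assms]
  assume ?inv
  \<comment> \<open>The integral matrix is only proportional to the given one; the values at
    infinity, 0 and 1 recover the ratios of its entries.\<close>
  then obtain a b c d where h: "mobius (y - x) (x - x') 0 (y' - x') = mobius a b c d"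
    "vge a 0" "vge b 0" "vge c 0" "vge d 0" "a * d - b * c \<noteq> 0" "v (a * d - b * c) = 0"
    unfolding e by (rule invertible_reductionE)
  have c: "c = 0" using fun_cong[OF h(1), of Infty] by (simp split: if_splits)
  have nz: "a \<noteq> 0" "d \<noteq> 0" using h(6) c by auto
  have b: "(x - x') / (y' - x') = b / d"
    using fun_cong[OF h(1), of "Fin 0"] assms nz c by simp
  have "(y - x + (x - x')) / (y' - x') = (a + b) / d"
    using fun_cong[OF h(1), of "Fin 1"] assms nz c by simp
  then have a: "(y - x) / (y' - x') = a / d" using b unfolding add_divide_distrib by simp
  have "v a + v d = 0" using h(7) v_mult[OF nz] c by simp
  then have vad: "v a = 0" "v d = 0" using h(2,5) nz by (auto simp: vge_def)
  have "v ((y - x) / (y' - x')) = 0" unfolding a using v_divide[OF nz] vad by simp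
  then have v1: "v (y - x) = v (y' - x')" using v_divide[of "y - x" "y' - x'"] assms by simp
  have "vge (x - x') (v (y' - x'))"
  proof (cases "x = x'")
    case False
    then have "b \<noteq> 0" using b nz assms by auto
    then have "v (b / d) = v b" "0 \<le> v b" using v_divide[of b d] nz vad h(3) by (auto simp: vge_def)
    then have "0 \<le> v (x - x') - v (y' - x')"
      using b v_divide[of "x - x'" "y' - x'"] False assms by simp
    then show ?thesis by (simp add: vge_def)
  qed simp
  then show ?disc unfolding v1 by (rule disc_eq)
next
  note e = frame_change_eq[OF assms]
  assume ?disc
  note d = disc_pair_eqD[OF this assms]
  let ?k = "y' - x'"
  have k: "?k \<noteq> 0" using assms by simp
  have "mobius (y - x) (x - x') 0 ?k = mobius ((y - x) / ?k) ((x - x') / ?k) 0 1"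
    using mobius_scale[OF k, of "(y - x) / ?k" "(x - x') / ?k" 0 1] k by simp
  moreover have "invertible_reduction v \<dots>"
  proof (rule invertible_reductionI)
    have "v ((y - x) / ?k) = 0" using v_divide[of "y - x" ?k] assms d(1) by simp
    then show "vge ((y - x) / ?k) 0" "v ((y - x) / ?k * 1 - (x - x') / ?k * 0) = 0"
      by (simp_all add: vge_def)
    show "vge ((x - x') / ?k) 0"
      using v_divide[of "x - x'" ?k] assms d by (cases "x = x'") (simp_all add: vge_def)
  qed (use assms in \<open>simp_all add: vge_def\<close>)
  ultimately show ?inv unfolding e by simp
qed

text \<open>\<open>L\<close> provides integral coordinates with unit brackets, that is, points with
  pairwise distinct reductions. The cross-ratio matrix then has integral entries, and its
  determinant is a product of units.\<close>

lemma normalizer_reduced: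
  assumes L: "\<And>p. p \<in> Z \<Longrightarrow> hom_pt (L p) = p \<and> L p \<noteq> (0, 0) \<and> vge (fst (L p)) 0 \<and> vge (snd (L p)) 0"
    and det: "\<And>p q. p \<in> Z \<Longrightarrow> q \<in> Z \<Longrightarrow> p \<noteq> q \<Longrightarrow>
      det2 (L p) (L q) \<noteq> 0 \<and> v (det2 (L p) (L q)) = 0"
    and z: "z0 \<in> Z" "z1 \<in> Z" "z2 \<in> Z" "z0 \<noteq> z1" "z1 \<noteq> z2" "z0 \<noteq> z2"
  shows "invertible_reduction v (normalizer (z0, z1, z2))"
proof -
  define u where "u = (\<lambda>i :: nat. L (if i = 0 then z0 else if i = 1 then z1 else z2))"
  have u: "u 0 = L z0" "u 1 = L z1" "u 2 = L z2" by (simp_all add: u_def)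
  have nz: "u i \<noteq> (0, 0)" for i using L z by (simp add: u_def)
  have d: "det2 (u 0) (u 1) \<noteq> 0" "det2 (u 1) (u 2) \<noteq> 0" "det2 (u 0) (u 2) \<noteq> 0"
    unfolding u using det z by blast+
  define A B where "A = det2 (u 1) (u 2)" and "B = det2 (u 1) (u 0)"
  have AB: "A \<noteq> 0" "v A = 0" "B \<noteq> 0" "v B = 0"
    unfolding A_def B_def u using det z by metis+
  let ?h = "mobius (A * snd (u 0)) (- (A * fst (u 0))) (B * snd (u 2)) (- (B * fst (u 2)))"
  note h = normalizer_mobius[of u, OF nz d, folded A_def B_def]
  have D: "A * B * det2 (u 0) (u 2) \<noteq> 0" "v (A * B * det2 (u 0) (u 2)) = 0"
    using AB d(3) det[OF z(1,3,6)] by (simp_all add: v_mult u)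
  have inv: "invertible_reduction v ?h"
  proof (rule invertible_reductionI)
    have "vge A 0" "vge B 0" using AB by (simp_all add: vge_def)
    then show "vge (A * snd (u 0)) 0" "vge (- (A * fst (u 0))) 0" "vge (B * snd (u 2)) 0"
      "vge (- (B * fst (u 2))) 0"
      unfolding vge_minus u using L z by (simp_all add: vge_mult_0)
  qed (use h(1) D in simp_all)
  have "normalizer (z0, z1, z2) = ?h"
    using h(2-4) L z invertible_reduction_in_PGL2[OF inv] unfolding u
    by (intro normalizer_unique) simp_all
  then show ?thesis using inv by simp
qed

lemma v_ultra:
  assumes "x \<noteq> y" "vge (y - z) (v (x - y) + 1)"
  shows "x \<noteq> z" "v (x - z) = v (x - y)"
proof -
  have "vge ((x - z) - (x - y)) (v (x - y) + 1)" using assms(2) by simp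
  from v_close[OF _ this] assms(1) show "x \<noteq> z" "v (x - z) = v (x - y)" by auto
qed

text \<open>If \<open>x\<close> and \<open>y\<close> form a closest pair, the three points become 0,
  1 and a point of absolute value at least 1 that does not reduce to 1. These have distinct
  reductions, whatever the order of the triple.\<close>

lemma normalizer_frame:
  assumes xy: "x \<noteq> y" "q \<noteq> Fin x" "q \<noteq> Fin y"
    and q: "\<And>w. q = Fin w \<Longrightarrow> v (w - x) \<le> v (y - x) \<and> v (w - y) \<le> v (y - x)"
    and z: "z0 \<in> {Fin x, Fin y, q}" "z1 \<in> {Fin x, Fin y, q}" "z2 \<in> {Fin x, Fin y, q}"
      "z0 \<noteq> z1" "z1 \<noteq> z2" "z0 \<noteq> z2"
  shows "\<exists>h. invertible_reduction v h \<and> normalizer (z0, z1, z2) = h \<circ> frame x y"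
proof -
  let ?F = "frame x y"
  have F: "?F \<in> carrier PGL2" by (rule frame_in_PGL2[OF xy(1)])
  have inj: "?F p = ?F p' \<longleftrightarrow> p = p'" for p p' using PGL2_inj[OF F] by (simp add: inj_eq)
  have F01: "?F (Fin x) = Fin 0" "?F (Fin y) = Fin 1" using xy(1) by (simp_all add: frame_apply)
  have Fq: "?F q \<noteq> Fin 0" "?F q \<noteq> Fin 1"
    using xy inj[of q "Fin x"] inj[of q "Fin y"] by (simp_all add: F01)
  \<comment> \<open>\<open>r\<close> is the reciprocal of the coordinate of \<open>q\<close>; this
    covers infinity by r = 0.\<close>
  obtain r where r: "hom_pt (1, r) = ?F q" "vge r 0" "r - 1 \<noteq> 0" "v (r - 1) = 0"
  proof (cases q)
    case Infty
    show ?thesis by (rule that[of 0]) (simp_all add: Infty hom_pt_def frame_apply)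
  next
    case (Fin w)
    have w: "w \<noteq> x" "w \<noteq> y" using xy Fin by auto
    \<comment> \<open>In an ultrametric triangle in which no side is shorter than the one from x to
      y, the two other sides are equal.\<close>
    have veq: "v (y - w) = v (w - x)"
    proof (cases "v (w - x) < v (y - x)")
      case True
      then have "vge (x - y) (v (w - x) + 1)" using v_diff_commute[of x y] by (simp add: vge_def)
      from v_ultra(2)[OF w(1) this] show ?thesis using v_diff_commute[of w y] by simp
    next
      case False
      then have eq: "v (w - x) = v (y - x)" using q[OF Fin] by simp
      have "vge ((y - x) - (w - x)) (v (y - x))" by (rule vge_diff) (simp_all add: eq vge_def)
      then have "v (y - x) \<le> v (y - w)" using w by (simp add: vge_def)
      then show ?thesis using q[OF Fin] eq v_diff_commute[of w y] by simp
    qed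
    show ?thesis
    proof (rule that[of "(y - x) / (w - x)"])
      show "hom_pt (1, (y - x) / (w - x)) = ?F q" using w xy(1) by (simp add: Fin hom_pt_def frame_apply)
      show "vge ((y - x) / (w - x)) 0" using w xy(1) q[OF Fin] by (simp add: vge_def v_divide)
      have e: "(y - x) / (w - x) - 1 = (y - w) / (w - x)" using w by (simp add: field_simps)
      show "(y - x) / (w - x) - 1 \<noteq> 0" unfolding e using w by simp
      show "v ((y - x) / (w - x) - 1) = 0" unfolding e using w veq by (simp add: v_divide)
    qed
  qed
  define L where "L p = (if p = Fin 0 then (0, 1) else if p = Fin 1 then (1, 1) else (1 :: 'a, r))"
    for p :: "'a P1"
  have L: "L (Fin 0) = (0, 1)" "L (Fin 1) = (1, 1)" "L (?F q) = (1, r)"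
    using Fq by (simp_all add: L_def)
  have r': "1 - r \<noteq> 0" "v (1 - r) = 0" using r v_diff_commute[of r 1] by simp_all
  let ?Z = "{Fin 0, Fin 1, ?F q}"
  have "invertible_reduction v (normalizer (?F z0, ?F z1, ?F z2))"
  proof (rule normalizer_reduced)
    show "hom_pt (L p) = p \<and> L p \<noteq> (0, 0) \<and> vge (fst (L p)) 0 \<and> vge (snd (L p)) 0" if "p \<in> ?Z" for p
      using that L r(1,2) by (auto simp: hom_pt_def vge_def)
    show "det2 (L p) (L p') \<noteq> 0 \<and> v (det2 (L p) (L p')) = 0" if "p \<in> ?Z" "p' \<in> ?Z" "p \<noteq> p'" for p p'
      using that r r' by (auto simp: L det2_def)
    show "?F z0 \<in> ?Z" "?F z1 \<in> ?Z" "?F z2 \<in> ?Z" using z F01 by auto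
    show "?F z0 \<noteq> ?F z1" "?F z1 \<noteq> ?F z2" "?F z0 \<noteq> ?F z2" using z by (simp_all add: inj)
  qed
  moreover have "normalizer (z0, z1, z2) = normalizer (?F z0, ?F z1, ?F z2) \<circ> ?F"
    using normalizer_props[of "?F z0" "?F z1" "?F z2"] z(4-6) F
    by (intro normalizer_unique) (simp_all add: inj comp_in_PGL2)
  ultimately show ?thesis by blast
qed

text \<open>Infinity never belongs to the chosen pair; among three finite points it is the pair
  whose difference has the largest valuation.\<close>

lemma closest_pair:
  assumes "z0 \<noteq> z1" "z1 \<noteq> z2" "z0 \<noteq> (z2 :: 'a P1)"
  shows "\<exists>x y q. {z0, z1, z2} = {Fin x, Fin y, q} \<and> x \<noteq> y \<and> q \<noteq> Fin x \<and> q \<noteq> Fin y \<and>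
    (\<forall>w. q = Fin w \<longrightarrow> v (w - x) \<le> v (y - x) \<and> v (w - y) \<le> v (y - x))"
proof -
  let ?P = "\<lambda>Z. \<exists>x y q. Z = {Fin x, Fin y, q} \<and> x \<noteq> y \<and> q \<noteq> Fin x \<and> q \<noteq> Fin y \<and>
    (\<forall>w. q = Fin w \<longrightarrow> v (w - x) \<le> v (y - x) \<and> v (w - y) \<le> v (y - x))"
  have inf: "?P {Fin x, Fin y, Infty}" if "x \<noteq> y" for x y
    using that by (intro exI[of _ x] exI[of _ y] exI[of _ Infty]) simp
  have max: "?P {Fin x, Fin y, Fin w}"
    if "x \<noteq> y" "w \<noteq> x" "w \<noteq> y" "v (w - x) \<le> v (y - x)" "v (w - y) \<le> v (y - x)" for x y w
    using that by (intro exI[of _ x] exI[of _ y] exI[of _ "Fin w"]) simp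
  show ?thesis
  proof (cases "Infty \<in> {z0, z1, z2}")
    case True
    then obtain x y where "{z0, z1, z2} = {Fin x, Fin y, Infty}" "x \<noteq> y"
      using assms by (cases z0; cases z1; cases z2) (auto simp: insert_commute)
    then show ?thesis using inf by simp
  next
    case False
    then obtain x y w where z: "z0 = Fin x" "z1 = Fin y" "z2 = Fin w"
      by (cases z0; cases z1; cases z2) auto
    have n: "x \<noteq> y" "w \<noteq> x" "w \<noteq> y" using assms z by auto
    note c = v_diff_commute[of x y] v_diff_commute[of x w] v_diff_commute[of y w]
    consider "v (w - x) \<le> v (y - x)" "v (w - y) \<le> v (y - x)"
      | "v (y - x) \<le> v (w - x)" "v (y - w) \<le> v (w - x)"
      | "v (x - y) \<le> v (w - y)" "v (x - w) \<le> v (w - y)"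
      using c by linarith
    then show ?thesis
    proof cases
      case 1
      then show ?thesis using max n z by simp
    next
      case 2
      then have "?P {Fin x, Fin w, Fin y}" using n by (intro max) auto
      then show ?thesis unfolding z by (simp only: insert_commute)
    next
      case 3
      then have "?P {Fin y, Fin w, Fin x}" using n by (intro max) auto
      moreover have "{Fin y, Fin w, Fin x} = {z0, z1, z2}" using z by auto
      ultimately show ?thesis by simp
    qed
  qed
qed

subsection \<open>Vertices correspond to discs\<close>

text \<open>The coordinate of the triple and that of the disc spanned by \<open>x\<close> and
  \<open>y\<close> differ by an invertible reduction, so both belong to the same vertex.\<close>

definition centered :: "'a P1 \<times> 'a P1 \<times> 'a P1 \<Rightarrow> 'a \<Rightarrow> 'a \<Rightarrow> bool" where
  "centered z x y \<longleftrightarrow> x \<noteq> y \<and> (\<exists>h. invertible_reduction v h \<and> normalizer z = h \<circ> frame x y)"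

definition center_disc :: "'a P1 \<times> 'a P1 \<times> 'a P1 \<Rightarrow> 'a set" where
  "center_disc z = (THE d. \<exists>x y. centered z x y \<and> d = disc v x (v (y - x)))"

definition pair_discs :: "'a set \<Rightarrow> 'a set set" where
  "pair_discs X = {disc v x (v (y - x)) | x y. x \<in> X \<and> y \<in> X \<and> x \<noteq> y}"

text \<open>Factors with invertible reduction can be cancelled on both sides, which leaves a change
  between two frames.\<close>

lemma centered_equiv_iff:
  assumes "centered z x y" "centered w x' y'"
  shows "invertible_reduction v (normalizer w \<circ> inv\<^bsub>PGL2\<^esub> (normalizer z)) \<longleftrightarrow>
    disc v x (v (y - x)) = disc v x' (v (y' - x'))"
proof -
  obtain h where h: "x \<noteq> y" "invertible_reduction v h" "normalizer z = h \<circ> frame x y"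
    using assms(1) by (auto simp: centered_def)
  obtain h' where h': "x' \<noteq> y'" "invertible_reduction v h'" "normalizer w = h' \<circ> frame x' y'"
    using assms(2) by (auto simp: centered_def)
  let ?F = "frame x y" and ?F' = "frame x' y'"
  have c: "?F \<in> carrier PGL2" "?F' \<in> carrier PGL2" "h \<in> carrier PGL2" "h' \<in> carrier PGL2"
    using frame_in_PGL2 h h' invertible_reduction_in_PGL2 by auto
  let ?M = "normalizer w \<circ> inv\<^bsub>PGL2\<^esub> (normalizer z)" and ?E = "?F' \<circ> inv\<^bsub>PGL2\<^esub> ?F"
  have "inv\<^bsub>PGL2\<^esub> (normalizer z) = inv\<^bsub>PGL2\<^esub> ?F \<circ> inv\<^bsub>PGL2\<^esub> h"
    unfolding h(3) using PGL2.inv_mult_group[OF c(3,1)] by simp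
  then have M: "?M = h' \<circ> ?E \<circ> inv\<^bsub>PGL2\<^esub> h" unfolding h'(3) by (simp add: o_assoc)
  then have "?E = inv\<^bsub>PGL2\<^esub> h' \<circ> ?M \<circ> h"
    by (simp add: fun_eq_iff PGL2_inv_apply[OF c(3)] PGL2_inv_apply[OF c(4)])
  then have "invertible_reduction v ?M \<longleftrightarrow> invertible_reduction v ?E"
    using M h(2) h'(2) invertible_reduction_comp invertible_reduction_inv by metis
  then show ?thesis using frame_change_iff[OF h(1) h'(1)] by simp
qed

lemma triples_iff:
  "(z0, z1, z2) \<in> triples A \<longleftrightarrow> z0 \<in> A \<and> z1 \<in> A \<and> z2 \<in> A \<and> z0 \<noteq> z1 \<and> z1 \<noteq> z2 \<and> z0 \<noteq> z2"
  by (simp add: triples_def)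

lemma centered_exists:
  assumes "z \<in> triples A"
  shows "\<exists>x y. Fin x \<in> A \<and> Fin y \<in> A \<and> centered z x y"
proof -
  obtain z0 z1 z2 where z: "z = (z0, z1, z2)" by (cases z)
  note t = assms[unfolded z triples_iff]
  obtain x y q where q: "{z0, z1, z2} = {Fin x, Fin y, q}" "x \<noteq> y" "q \<noteq> Fin x" "q \<noteq> Fin y"
    "\<And>w. q = Fin w \<Longrightarrow> v (w - x) \<le> v (y - x) \<and> v (w - y) \<le> v (y - x)"
    using closest_pair[of z0 z1 z2] t by metis
  have "z0 \<in> {Fin x, Fin y, q}" "z1 \<in> {Fin x, Fin y, q}" "z2 \<in> {Fin x, Fin y, q}"
    unfolding q(1)[symmetric] by simp_all
  from normalizer_frame[OF q(2-5) this] t have "centered z x y"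
    by (simp add: centered_def z q(2))
  moreover have "{Fin x, Fin y} \<subseteq> A" using t q(1) by auto
  ultimately show ?thesis by blast
qed

lemma center_disc_eq:
  assumes "z \<in> triples A" "centered z x y"
  shows "center_disc z = disc v x (v (y - x))"
  unfolding center_disc_def
proof (rule the_equality)
  show "\<exists>x' y'. centered z x' y' \<and> disc v x (v (y - x)) = disc v x' (v (y' - x'))"
    using assms(2) by blast
  fix d assume "\<exists>x y. centered z x y \<and> d = disc v x (v (y - x))"
  then obtain x' y' where d: "centered z x' y'" "d = disc v x' (v (y' - x'))" by blast
  have "normalizer z \<in> carrier PGL2"
    using assms(1) normalizer_props(1)[of "fst z" "fst (snd z)" "snd (snd z)"]
    by (cases z) (simp add: triples_iff)
  then have "normalizer z \<circ> inv\<^bsub>PGL2\<^esub> (normalizer z) = id" by simp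
  then show "d = disc v x (v (y - x))"
    using centered_equiv_iff[OF assms(2) d(1)] d(2) invertible_reduction_id by metis
qed

lemma triple_equiv_eq:
  "triple_equiv v A = {(z, w). z \<in> triples A \<and> w \<in> triples A \<and> center_disc z = center_disc w}"
proof -
  have "invertible_reduction v (normalizer w \<circ> inv\<^bsub>PGL2\<^esub> (normalizer z)) \<longleftrightarrow>
      center_disc z = center_disc w" if zw: "z \<in> triples A" "w \<in> triples A" for z w
  proof -
    obtain x y x' y' where c: "centered z x y" "centered w x' y'"
      using centered_exists zw by meson
    show ?thesis
      using centered_equiv_iff[OF c] center_disc_eq[OF zw(1) c(1)] center_disc_eq[OF zw(2) c(2)] by simp
  qed
  then show ?thesis by (auto simp: triple_equiv_def)
qed

text \<open>Infinity completes every pair of finite points to a triple whose normalizer is the frame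
  of that pair, so no disc spanned by two points is missed.\<close>

lemma center_disc_image:
  assumes "Infty \<in> A"
  shows "center_disc ` triples A = pair_discs {x. Fin x \<in> A}"
proof
  show "center_disc ` triples A \<subseteq> pair_discs {x. Fin x \<in> A}"
  proof
    fix d assume "d \<in> center_disc ` triples A"
    then obtain z where z: "z \<in> triples A" "d = center_disc z" by blast
    obtain x y where xy: "Fin x \<in> A" "Fin y \<in> A" "centered z x y"
      using centered_exists[OF z(1)] by blast
    then have "d = disc v x (v (y - x))" "x \<noteq> y"
      using center_disc_eq[OF z(1)] z(2) by (auto simp: centered_def)
    then show "d \<in> pair_discs {x. Fin x \<in> A}" using xy unfolding pair_discs_def by blast
  qed
  show "pair_discs {x. Fin x \<in> A} \<subseteq> center_disc ` triples A"
  proof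
    fix d assume "d \<in> pair_discs {x. Fin x \<in> A}"
    then obtain x y where xy: "Fin x \<in> A" "Fin y \<in> A" "x \<noteq> y" "d = disc v x (v (y - x))"
      by (auto simp: pair_discs_def)
    let ?z = "(Fin x, Fin y, Infty)"
    have z: "?z \<in> triples A" using xy assms by (simp add: triples_iff)
    have "normalizer ?z = frame x y"
      using xy(3) frame_in_PGL2 by (intro normalizer_unique) (simp_all add: frame_apply)
    then have "centered ?z x y"
      using xy(3) invertible_reduction_id unfolding centered_def by (metis id_o)
    from center_disc_eq[OF z this] show "d \<in> center_disc ` triples A"
      using z xy(4) by (metis imageI)
  qed
qed

lemma card_tree_verts:
  "Infty \<in> A \<Longrightarrow> card (tree_verts v A) = card (pair_discs {x. Fin x \<in> A})"
  unfolding tree_verts_def triple_equiv_eq card_quotient_kernel by (simp add: center_disc_image)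

subsection \<open>Moving a pair of points\<close>

lemma finite_pair_discs:
  assumes "finite X"
  shows "finite (pair_discs X)"
proof -
  have "pair_discs X \<subseteq> (\<lambda>(x, y). disc v x (v (y - x))) ` (X \<times> X)"
    by (auto simp: pair_discs_def)
  then show ?thesis using assms by (meson finite_SigmaI finite_imageI finite_subset)
qed

text \<open>The pair \<open>p, q\<close> sits in a disc of its own next to \<open>x0, y0\<close>; replacing it by a pair
  \<open>p', q'\<close> inside the smallest disc containing \<open>x0, y0\<close> destroys the disc joining \<open>p\<close> to \<open>x0\<close>.\<close>

lemma card_pair_discs_less:
  assumes C: "finite C" "x0 \<in> C" "y0 \<in> C" "x0 \<noteq> y0"
    and p: "p \<noteq> q" "p \<noteq> x0" "v (p - x0) < v (y0 - x0)" "v (p - x0) < v (q - p)"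
    and far: "\<And>y. y \<in> C \<Longrightarrow> y \<noteq> x0 \<Longrightarrow> y \<noteq> y0 \<Longrightarrow> v (y - x0) < v (p - x0)"
    and near: "\<And>z. z \<in> {p', q'} \<Longrightarrow> z \<noteq> x0 \<and> z \<noteq> y0 \<and> v (z - x0) = v (y0 - x0) \<and> v (z - y0) = v (y0 - x0)"
  shows "card (pair_discs (C \<union> {p', q'})) < card (pair_discs (C \<union> {p, q}))"
proof -
  define t r where "t = v (p - x0)" and "r = v (y0 - x0)"
  have tr: "t < r" using p(3) by (simp add: t_def r_def)
  have vpx: "v (x0 - p) = t" "v (p - x0) = t" "v (y0 - x0) = r" "v (x0 - y0) = r"
    using v_diff_commute by (simp_all add: t_def r_def)
  let ?X = "C \<union> {p', q'}" and ?Y = "C \<union> {p, q}"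
  let ?d1 = "disc v p (v (q - p))" and ?d2 = "disc v x0 t" and ?d' = "disc v p' (v (q' - p'))"
  \<comment> \<open>Seen from \<open>x0\<close> there is a gap: no other point of the new set has a
    difference of valuation at least \<open>t\<close> and less than \<open>r\<close>.\<close>
  have close: "x = x0 \<or> v (x - x0) < t \<or> v (x - x0) = r" if "x \<in> ?X" for x
    using far[of x] near[of x] that vpx by auto
  have apart: "x \<noteq> p \<and> v (x - p) \<le> t" if "x \<in> ?X" for x
  proof -
    consider "x = x0" | "x \<noteq> x0" "v (x - x0) < t" | "x \<noteq> x0" "v (x - x0) = r"
      using close \<open>x \<in> ?X\<close> by blast
    then show ?thesis
    proof cases
      case 1
      then show ?thesis using p(2) vpx by auto
    next
      case 2
      have "vge (x0 - p) (v (x - x0) + 1)" using 2 vpx by (simp add: vge_def)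
      from v_ultra[OF 2(1) this] show ?thesis using 2 by simp
    next
      case 3
      have "vge (x0 - x) (v (p - x0) + 1)"
        using 3 vpx tr v_diff_commute[of x x0] by (simp add: vge_def)
      from v_ultra[OF p(2) this] show ?thesis using vpx v_diff_commute[of x p] by simp
    qed
  qed
  have ne1: "disc v x n \<noteq> ?d1" if "x \<in> ?X" for x n
  proof
    assume "disc v x n = ?d1"
    then have "x \<in> ?d1" by (metis diff_self in_disc vge_0)
    then show False using apart[OF that] p(4) vpx by (simp add: vge_def)
  qed
  \<comment> \<open>By the gap, two points of the new set inside \<open>?d2\<close> are both within
    \<open>r\<close> of \<open>x0\<close>, so the disc they span is too small to reach
    \<open>p\<close>.\<close>
  have ne2: "disc v x (v (y - x)) \<noteq> ?d2" if xy: "x \<in> ?X" "y \<in> ?X" "x \<noteq> y" for x y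
  proof
    assume e: "disc v x (v (y - x)) = ?d2"
    have "x \<in> ?d2" "y \<in> ?d2" unfolding e[symmetric] by simp_all
    then have r: "vge (x - x0) r" "vge (y - x0) r"
      using close[OF xy(1)] close[OF xy(2)] tr by (auto simp: vge_def)
    then have "vge (y - x) r" using vge_diff[OF r(2) r(1)] by simp
    then have "r \<le> v (y - x)" using xy(3) by (simp add: vge_def)
    moreover have "p \<in> disc v x (v (y - x))" unfolding e using vpx by (simp add: vge_def)
    then have "vge (x - p) (v (y - x))" using vge_diff_commute[of x p] by simp
    ultimately show False using apart[OF xy(1)] tr by (simp add: vge_def)
  qed
  have inC: "disc v x (v (y - x)) \<in> pair_discs ?Y" if "x \<in> C" "y \<in> C" "x \<noteq> y" for x y
    using that unfolding pair_discs_def by blast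
  \<comment> \<open>A new point is as far from any \<open>x\<close> in \<open>C\<close> as
    \<open>x0\<close> or \<open>y0\<close> is, so the two span a disc already spanned inside
    \<open>C\<close>.\<close>
  have mixed: "disc v x (v (y - x)) \<in> pair_discs ?Y" if xy: "x \<in> C" "y \<in> {p', q'}" for x y
  proof -
    note ny = near[OF xy(2)]
    consider "x = x0" | "x = y0" | "x \<noteq> x0" "x \<noteq> y0" by blast
    then show ?thesis
    proof cases
      case 1
      then show ?thesis using inC[OF C(2,3,4)] ny by simp
    next
      case 2
      then have "v (y - x) = v (x0 - y0)" using ny v_diff_commute[of x0 y0] by simp
      then show ?thesis using inC[OF C(3,2) C(4)[symmetric]] 2 by simp
    next
      case 3
      have "vge (x0 - y) (v (x - x0) + 1)"
        using far[OF xy(1) 3] p(3) ny v_diff_commute[of x0 y] by (simp add: vge_def)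
      from v_ultra(2)[OF 3(1) this] have "v (y - x) = v (x0 - x)"
        using v_diff_commute[of x y] v_diff_commute[of x x0] by simp
      then show ?thesis using inC[OF xy(1) C(2) 3(1)] by simp
    qed
  qed
  \<comment> \<open>Two discs are lost and at most \<open>?d'\<close> is gained, which makes the
    inequality strict.\<close>
  have sub: "pair_discs ?X \<subseteq> insert ?d' (pair_discs ?Y - {?d1, ?d2})"
  proof
    fix d assume "d \<in> pair_discs ?X"
    then obtain x y where xy: "x \<in> ?X" "y \<in> ?X" "x \<noteq> y" "d = disc v x (v (y - x))"
      unfolding pair_discs_def by blast
    have "d \<noteq> ?d1" "d \<noteq> ?d2" using ne1[OF xy(1)] ne2[OF xy(1-3)] xy(4) by auto
    moreover have "d = ?d' \<or> d \<in> pair_discs ?Y"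
    proof -
      consider "x \<in> C" "y \<in> C" | "x \<in> C" "y \<in> {p', q'}" | "x \<in> {p', q'}" "y \<in> C"
        | "x = p'" "y = q'" | "x = q'" "y = p'"
        using xy by auto
      then show ?thesis
      proof cases
        case 3
        then show ?thesis using mixed[OF 3(2,1)] xy(4) disc_pair_swap[of x y] by simp
      next
        case 5
        then show ?thesis using xy(4) disc_pair_swap[of p' q'] by simp
      qed (use inC mixed xy in auto)
    qed
    ultimately show "d \<in> insert ?d' (pair_discs ?Y - {?d1, ?d2})" by blast
  qed
  have d1: "?d1 \<in> pair_discs ?Y" using p(1) unfolding pair_discs_def by blast
  have "?d2 = disc v x0 (v (p - x0))" by (simp add: vpx)
  then have d2: "?d2 \<in> pair_discs ?Y" using p(2) C(2) unfolding pair_discs_def by blast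
  have d12: "?d1 \<noteq> ?d2" using ne1[of x0 t] C(2) by auto
  have fin: "finite (pair_discs ?Y)" using C(1) by (intro finite_pair_discs) simp
  define R where "R = pair_discs ?Y - {?d1, ?d2}"
  have R: "finite R" using fin by (simp add: R_def)
  have "card (pair_discs ?X) \<le> card (insert ?d' R)"
    using card_mono[OF _ sub] R unfolding R_def[symmetric] by blast
  also have "\<dots> \<le> Suc (card R)" using R by (simp add: card_insert_if)
  also have "card R = card (pair_discs ?Y) - 2"
    unfolding R_def using d1 d2 d12 by (subst card_Diff_subset) auto
  also have "Suc (card (pair_discs ?Y) - 2) < card (pair_discs ?Y)"
  proof -
    have "card {?d1, ?d2} \<le> card (pair_discs ?Y)" using d1 d2 fin by (intro card_mono) auto
    then show ?thesis using d12 by simp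
  qed
  finally show ?thesis .
qed

end

section \<open>Conjugating one of the generating involutions\<close>

lemma orb_subgroup:
  assumes "subgroup H PGL2" "t \<in> H"
  shows "orb H (t x) = orb H x"
proof -
  have sub: "orb H (t x) \<subseteq> orb H x" if "t \<in> H" for t x
  proof
    fix y assume "y \<in> orb H (t x)"
    then obtain h where h: "h \<in> H" "y = h (t x)" by (auto simp: orb_def)
    have "h \<circ> t \<in> H" using subgroup.m_closed[OF assms(1) h(1) that] by simp
    moreover have "y = (h \<circ> t) x" using h by simp
    ultimately show "y \<in> orb H x" unfolding orb_def by (metis imageI)
  qed
  have "inv\<^bsub>PGL2\<^esub> t \<in> H" by (rule subgroup.m_inv_closed[OF assms])
  from sub[OF this, of "t x"] have "orb H x \<subseteq> orb H (t x)"
    using PGL2_inv_apply(1) subgroup.mem_carrier[OF assms] by metis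
  then show ?thesis using sub[OF assms(2)] by blast
qed

lemma (in valuation) v_from_midpoint_disc:
  assumes "a \<noteq> b" "z \<in> disc v ((a + b) / 2) (v (b - a) + 1)"
  shows "z \<noteq> a" "v (z - a) = v (b - a)"
proof -
  have "z \<in> disc v a (v (b - a))" "z \<notin> disc v a (v (b - a) + 1)"
    using midpoint_disc[OF assms(1)] assms(2) by blast+
  then show "z \<noteq> a" "v (z - a) = v (b - a)" by (auto simp: vge_def)
qed

text \<open>Pairs 3 and higher are farther from \<open>\<alpha> 0\<close> than pair 1 is. The
  smallest disc containing \<open>\<alpha> 0\<close> and \<open>\<alpha> 1\<close> thus holds only
  pairs 0 and 1, and it is no longer spanned once pair 1 has moved.\<close>

locale twisted_configuration = pair_configuration v g \<alpha> \<beta> c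
  for v :: "'a :: field \<Rightarrow> int" and g \<alpha> \<beta> c +
  assumes remote: "3 \<le> i \<Longrightarrow> i \<le> g \<Longrightarrow>
    v (\<alpha> i - \<alpha> 0) < v (\<alpha> 1 - \<alpha> 0) \<and> v (\<beta> i - \<alpha> 0) < v (\<alpha> 1 - \<alpha> 0)"
begin

definition a' :: "nat \<Rightarrow> 'a P1" where "a' = a(1 := s 0 (a 1))"

definition b' :: "nat \<Rightarrow> 'a P1" where "b' = b(1 := s 0 (b 1))"

definition s' :: "nat \<Rightarrow> 'a P1 \<Rightarrow> 'a P1" where "s' = s(1 := s 0 \<circ> s 1 \<circ> s 0)"

lemma g_ge: "0 \<le> g" "1 \<le> g" "2 \<le> g"
  using g_ge_2 by simp_all

lemma s'_apply: "s' 1 = s 0 \<circ> s 1 \<circ> s 0" "i \<noteq> 1 \<Longrightarrow> s' i = s i"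
  by (simp_all add: s'_def)

lemma s'_fixing:
  assumes "i \<le> g"
  shows "s' i \<in> fixing_involutions (a' i) (b' i)"
proof (cases "i = 1")
  case True
  have "s 0 \<circ> s 1 \<circ> s 0 \<in> fixing_involutions (s 0 (a 1)) (s 0 (b 1))"
    using fixing_involutions_conj[OF s_in[OF g_ge(1)] s_fixing[OF g_ge(2)]]
    unfolding inv_s[OF g_ge(1)] .
  then show ?thesis unfolding True s'_apply by (simp add: a'_def b'_def)
qed (use assms s_fixing in \<open>simp add: s'_def a'_def b'_def\<close>)

text \<open>Conjugation by s_0 is its own inverse and s_0 itself is kept, so the twist undoes itself
  and the two generating sets express each other.\<close>

lemma s'_1_conj: "s 1 = s' 0 \<circ> s' 1 \<circ> s' 0"
proof -
  have "s' 0 = s 0" by (simp add: s'_def)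
  then show ?thesis unfolding s'_apply(1) by (simp add: fun_eq_iff)
qed

lemma s'_in: "i \<le> g \<Longrightarrow> s' i \<in> carrier PGL2"
  using s'_fixing by (simp add: fixing_involutions_iff)

lemma Gamma0_s': "Gamma0 g s' = Gamma0 g s"
proof
  have sub': "subgroup (Gamma0 g s') PGL2"
    unfolding Gamma0_def by (rule PGL2.generate_is_subgroup) (auto intro: s'_in)
  have gen: "s i \<in> Gamma0 g s" if "i \<le> g" for i
    unfolding Gamma0_def using that by (auto intro: generate.incl)
  have gen': "s' i \<in> Gamma0 g s'" if "i \<le> g" for i
    unfolding Gamma0_def using that by (auto intro: generate.incl)
  note m = subgroup.m_closed[OF Gamma0_subgroup, unfolded PGL2_simps]
  note m' = subgroup.m_closed[OF sub', unfolded PGL2_simps]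
  have "s' i \<in> Gamma0 g s" if "i \<le> g" for i
  proof (cases "i = 1")
    case True
    then show ?thesis unfolding True s'_apply(1)
      using m[OF m[OF gen gen] gen, of 0 1 0] g_ge by blast
  qed (use gen that s'_apply(2) in simp)
  then show "Gamma0 g s' \<subseteq> Gamma0 g s"
    unfolding Gamma0_def[of g s'] by (intro PGL2.generate_subgroup_incl[OF _ Gamma0_subgroup]) auto
  have "s i \<in> Gamma0 g s'" if "i \<le> g" for i
  proof (cases "i = 1")
    case True
    have "s' 0 \<circ> s' 1 \<circ> s' 0 \<in> Gamma0 g s'"
      using m'[OF m'[OF gen' gen'] gen', of 0 1 0] g_ge by blast
    then show ?thesis unfolding True s'_1_conj[symmetric] .
  next
    case False
    then show ?thesis using gen'[OF that] s'_apply(2)[OF False] by simp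
  qed
  then show "Gamma0 g s \<subseteq> Gamma0 g s'"
    unfolding Gamma0_def[of g s] by (intro PGL2.generate_subgroup_incl[OF _ sub']) auto
qed

lemma twisted_generator: "s' 0 \<circ> s' 1 = inv\<^bsub>PGL2\<^esub> (s 0 \<circ> s 1)"
proof -
  have "s' 0 \<circ> s' 1 = s 1 \<circ> s 0"
    unfolding s'_apply(1) s'_apply(2)[of 0, simplified] by (simp add: fun_eq_iff)
  also have "\<dots> = inv\<^bsub>PGL2\<^esub> (s 0 \<circ> s 1)"
    using inv_wv[of "[0, 1]"] g_ge by simp
  finally show ?thesis .
qed

lemma Gamma_s': "Gamma g s' = Gamma g s"
proof
  let ?X' = "(\<lambda>i. s' 0 \<circ> s' i) ` {1..g}"
  have c: "s 0 \<circ> s i \<in> carrier PGL2" if "i \<le> g" for i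
    using that by (intro comp_in_PGL2 s_in) simp_all
  have sub': "subgroup (Gamma g s') PGL2"
    unfolding Gamma_def by (rule PGL2.generate_is_subgroup) (auto intro!: comp_in_PGL2 s'_in)
  have gen: "s 0 \<circ> s i \<in> Gamma g s" if "i \<in> {1..g}" for i
    unfolding Gamma_def by (rule generate.incl) (rule imageI[OF that])
  have gen': "s' 0 \<circ> s' i \<in> Gamma g s'" if "i \<in> {1..g}" for i
    unfolding Gamma_def by (rule generate.incl) (rule imageI[OF that])
  have one: "1 \<in> {1..g}" using g_ge by simp
  have eq: "s' 0 \<circ> s' i = s 0 \<circ> s i" if "i \<noteq> 1" for i
    using that by (simp add: s'_def)
  have "s' 0 \<circ> s' i \<in> Gamma g s" if "i \<in> {1..g}" for i
  proof (cases "i = 1")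
    case True
    show ?thesis unfolding True twisted_generator
      by (rule subgroup.m_inv_closed[OF Gamma_subgroup gen[OF one]])
  next
    case False
    show ?thesis using gen[OF that] unfolding eq[OF False] .
  qed
  then show "Gamma g s' \<subseteq> Gamma g s"
    unfolding Gamma_def[of g s'] by (intro PGL2.generate_subgroup_incl[OF _ Gamma_subgroup] image_subsetI)
  have "s 0 \<circ> s i \<in> Gamma g s'" if "i \<in> {1..g}" for i
  proof (cases "i = 1")
    case True
    have "inv\<^bsub>PGL2\<^esub> (s' 0 \<circ> s' 1) \<in> Gamma g s'"
      by (rule subgroup.m_inv_closed[OF sub' gen'[OF one]])
    then show ?thesis unfolding True twisted_generator PGL2.inv_inv[OF c[OF g_ge(2)]] .
  next
    case False
    show ?thesis using gen'[OF that] unfolding eq[OF False] .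
  qed
  then show "Gamma g s \<subseteq> Gamma g s'"
    unfolding Gamma_def[of g s] by (intro PGL2.generate_subgroup_incl[OF _ sub'] image_subsetI)
qed

text \<open>\<open>s 0 x\<close> lies in \<open>D 0\<close>, so in the original set it could only be
  \<open>a 0\<close> or \<open>b 0\<close>. These are fixed by \<open>s 0\<close>, which would give
  x = s_0 x, although \<open>x\<close> is outside \<open>D 0\<close> and its image inside.\<close>

lemma moved_points:
  assumes x: "x \<in> {a 1, b 1}"
  shows "s 0 x \<notin> pair_set g a b"
proof
  have x1: "x \<in> D 1" using a_b_in_D[OF g_ge(2)] x by auto
  then have x0: "x \<notin> D 0" using D_disjoint[OF g_ge(1,2)] by auto
  assume "s 0 x \<in> pair_set g a b"
  then obtain i where i: "i \<le> g" "s 0 x \<in> {a i, b i}" by (auto simp: pair_set_def)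
  then have "s 0 x \<in> D i" using a_b_in_D by auto
  then have "i = 0" using s_D[OF g_ge(1) x0] D_disjoint[OF g_ge(1) i(1)] by auto
  moreover have "s 0 (a 0) = a 0" "s 0 (b 0) = b 0"
    using s_fixing[OF g_ge(1)] by (simp_all add: fixing_involutions_iff)
  ultimately have "s 0 (s 0 x) = s 0 x" using i(2) by (elim insertE) simp_all
  then have "x = s 0 x" using g_ge by simp
  then show False using x0 s_D[OF g_ge(1) x0] by simp
qed

lemma pair_set_split:
  "pair_set g a b = (a ` ({..g} - {1}) \<union> b ` ({..g} - {1})) \<union> {a 1, b 1}"
  "pair_set g a' b' = (a ` ({..g} - {1}) \<union> b ` ({..g} - {1})) \<union> {s 0 (a 1), s 0 (b 1)}"
proof -
  have "{..g} = insert 1 ({..g} - {1})" using g_ge by auto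
  then have split: "pair_set g x y = (x ` ({..g} - {1}) \<union> y ` ({..g} - {1})) \<union> {x 1, y 1}"
    for x y :: "nat \<Rightarrow> 'a P1"
    unfolding pair_set_def by (metis (no_types, lifting) Un_insert_left Un_insert_right image_insert sup_bot.right_neutral)
  show "pair_set g a b = (a ` ({..g} - {1}) \<union> b ` ({..g} - {1})) \<union> {a 1, b 1}" by (rule split)
  have "a' ` ({..g} - {1}) = a ` ({..g} - {1})" "b' ` ({..g} - {1}) = b ` ({..g} - {1})"
    by (auto simp: a'_def b'_def intro!: image_cong)
  then show "pair_set g a' b' = (a ` ({..g} - {1}) \<union> b ` ({..g} - {1})) \<union> {s 0 (a 1), s 0 (b 1)}"
    unfolding split[of a' b'] by (simp add: a'_def b'_def)
qed

lemma card_pair_set': "card (pair_set g a' b') = 2 * g + 2"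
proof -
  let ?R = "a ` ({..g} - {1}) \<union> b ` ({..g} - {1})"
  have "a 1 \<noteq> b 1" by (rule a_b_neq[OF g_ge(2)])
  then have ne: "s 0 (a 1) \<noteq> s 0 (b 1)" using s_s_apply[OF g_ge(1)] by metis
  \<comment> \<open>The unchanged part has at least 2 g points because the original set has 2 g + 2,
    and at most 2 g as the union of two images of sets of size g.\<close>
  have "card (?R \<union> {a 1, b 1}) \<le> card ?R + card {a 1, b 1}" by (rule card_Un_le)
  then have "2 * g + 2 \<le> card ?R + 2" using card_pair_set \<open>a 1 \<noteq> b 1\<close> by (simp add: pair_set_split)
  moreover have "?R \<inter> {s 0 (a 1), s 0 (b 1)} = {}"
    using moved_points[of "a 1"] moved_points[of "b 1"] by (auto simp: pair_set_split(1))
  then have "card (pair_set g a' b') = card ?R + 2"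
    unfolding pair_set_split(2) using ne by (subst card_Un_disjoint) auto
  moreover have "card ?R \<le> card (a ` ({..g} - {1})) + card (b ` ({..g} - {1}))" by (rule card_Un_le)
  moreover have "card (a ` ({..g} - {1})) \<le> g" "card (b ` ({..g} - {1})) \<le> g"
    using g_ge by (auto intro!: order_trans[OF card_image_le])
  ultimately show ?thesis by simp
qed

lemma superelliptic':
  assumes "compact_space (P1_topology v)"
  shows "superelliptic_pairing v g a' b' s'"
  using superelliptic[OF assms] card_pair_set' s'_fixing
  by (simp add: superelliptic_pairing_def Gamma0_s' Gamma_s')

lemma moved_disc:
  assumes "x \<in> {a 1, b 1}"
  shows "s 0 x \<in> Fin ` disc v ((\<alpha> 0 + \<beta> 0) / 2) (v (\<beta> 0 - \<alpha> 0) + 1)"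
proof -
  have "x \<in> D 1" using a_b_in_D[OF g_ge(2)] assms by auto
  then have "x \<notin> D 0" using D_disjoint[OF g_ge(1,2)] by auto
  then show ?thesis using pair_involution_far[OF \<alpha>_neq_\<beta>[OF g_ge(1)], of x] by (simp add: D_def s_def)
qed

lemma card_tree_verts_less:
  "card (tree_verts v (pair_set g a' b')) < card (tree_verts v (pair_set g a b))"
proof -
  obtain p' where p': "s 0 (a 1) = Fin p'" "p' \<in> disc v ((\<alpha> 0 + \<beta> 0) / 2) (v (\<beta> 0 - \<alpha> 0) + 1)"
    using moved_disc[of "a 1"] by (auto simp del: in_disc)
  obtain q' where q': "s 0 (b 1) = Fin q'" "q' \<in> disc v ((\<alpha> 0 + \<beta> 0) / 2) (v (\<beta> 0 - \<alpha> 0) + 1)"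
    using moved_disc[of "b 1"] by (auto simp del: in_disc)
  \<comment> \<open>The finite points outside pair 1; \<open>\<beta> 2\<close> is left out because
    \<open>b 2\<close> is infinity.\<close>
  define C where "C = \<alpha> ` ({..g} - {1}) \<union> \<beta> ` ({..g} - {1, 2})"
  have T: "{x. Fin x \<in> pair_set g a b} = C \<union> {\<alpha> 1, \<beta> 1}"
    unfolding pair_set_split(1) C_def by (auto simp: a_def b_def image_iff)
  have T': "{x. Fin x \<in> pair_set g a' b'} = C \<union> {p', q'}"
    unfolding pair_set_split(2) C_def p'(1) q'(1) by (auto simp: a_def b_def image_iff)
  have b2: "b 2 = Infty" "2 \<in> {..g} - {1}" using g_ge by (simp_all add: b_def)
  have inf: "Infty \<in> pair_set g a b" "Infty \<in> pair_set g a' b'"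
    unfolding pair_set_split using b2 by (metis Un_iff image_eqI)+
  have "card (pair_discs (C \<union> {p', q'})) < card (pair_discs (C \<union> {\<alpha> 1, \<beta> 1}))"
  proof (rule card_pair_discs_less)
    show "finite C" by (simp add: C_def)
    show "\<alpha> 0 \<in> C" "\<beta> 0 \<in> C" unfolding C_def by (auto intro!: imageI)
    show "\<alpha> 0 \<noteq> \<beta> 0" "\<alpha> 1 \<noteq> \<beta> 1" using \<alpha>_neq_\<beta>[OF g_ge(1)] \<alpha>_neq_\<beta>[OF g_ge(2)] by simp_all
    have 01: "\<not> vge (\<alpha> 0 - \<alpha> 1) (v (\<beta> 0 - \<alpha> 0))" "\<not> vge (\<alpha> 1 - \<alpha> 0) (v (\<beta> 1 - \<alpha> 1))"
      using separated g_ge by simp_all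
    then show "\<alpha> 1 \<noteq> \<alpha> 0" by auto
    show t: "v (\<alpha> 1 - \<alpha> 0) < v (\<beta> 0 - \<alpha> 0)" "v (\<alpha> 1 - \<alpha> 0) < v (\<beta> 1 - \<alpha> 1)"
      using 01 v_diff_commute[of "\<alpha> 0" "\<alpha> 1"] by (simp_all add: not_vge)
    show "v (y - \<alpha> 0) < v (\<alpha> 1 - \<alpha> 0)" if y: "y \<in> C" "y \<noteq> \<alpha> 0" "y \<noteq> \<beta> 0" for y
    proof -
      consider "y = \<alpha> 2" | i where "3 \<le> i" "i \<le> g" "y = \<alpha> i \<or> y = \<beta> i"
      proof -
        from y(1) obtain i where "i \<le> g" "i \<noteq> 1" "y = \<alpha> i \<or> i \<noteq> 2 \<and> y = \<beta> i"
          by (auto simp: C_def)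
        then show ?thesis using that(1) that(2)[of i] y(2,3)
          by (cases "i = 0"; cases "i = 2") auto
      qed
      then show ?thesis
      proof cases
        case 1
        have "vge (\<alpha> 1 - \<alpha> 0) 1" using v_\<alpha> g_ge by (intro vge_diff) simp_all
        then have "1 \<le> v (\<alpha> 1 - \<alpha> 0)" using \<open>\<alpha> 1 \<noteq> \<alpha> 0\<close> by (simp add: vge_def)
        moreover have "vge ((1 - \<alpha> 0) - 1) (v 1 + 1)" using v_\<alpha>[OF g_ge(1)] by simp
        then have "v (1 - \<alpha> 0) = 0" using v_close(2)[of 1 "1 - \<alpha> 0"] by simp
        ultimately show ?thesis using 1 \<alpha>_2 by simp
      next
        case 2
        then show ?thesis using remote by blast
      qed
    qed
    show "z \<noteq> \<alpha> 0 \<and> z \<noteq> \<beta> 0 \<and> v (z - \<alpha> 0) = v (\<beta> 0 - \<alpha> 0) \<and> v (z - \<beta> 0) = v (\<beta> 0 - \<alpha> 0)"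
      if z: "z \<in> {p', q'}" for z
    proof -
      have z': "z \<in> disc v ((\<alpha> 0 + \<beta> 0) / 2) (v (\<beta> 0 - \<alpha> 0) + 1)" using z p'(2) q'(2) by blast
      \<comment> \<open>The midpoint disc is symmetric in the pair, so the distance to
        \<open>\<beta> 0\<close> follows with the roles exchanged.\<close>
      then have z'': "z \<in> disc v ((\<beta> 0 + \<alpha> 0) / 2) (v (\<alpha> 0 - \<beta> 0) + 1)"
        unfolding v_diff_commute[of "\<alpha> 0" "\<beta> 0"] by (simp only: add.commute)
      note n = \<alpha>_neq_\<beta>[OF g_ge(1), simplified]
      show ?thesis
        using v_from_midpoint_disc[OF n z'] v_from_midpoint_disc[OF n[symmetric] z'']
          v_diff_commute[of "\<alpha> 0" "\<beta> 0"] by simp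
    qed
  qed
  then show ?thesis unfolding card_tree_verts[OF inf(1)] card_tree_verts[OF inf(2)] T T' .
qed

end

section \<open>The valuation of \<open>\<rat>\<^sub>3(\<zeta>\<^sub>3)\<close>\<close>

subsection \<open>3-adic integers\<close>

lemma Rep_z3_compat: "Rep_z3 a n = Rep_z3 a (Suc n) mod 3 ^ n"
  using Rep_z3[of a] by blast

lemma Rep_z3_le: "Rep_z3 a n = Rep_z3 a (n + k) mod 3 ^ n"
  by (rule z3_mod_le) (intro allI Rep_z3_compat)

lemma Rep_z3_bounds: "0 \<le> Rep_z3 a n" "Rep_z3 a n < 3 ^ n"
  using Rep_z3_compat[of a n] by (metis pos_mod_sign zero_less_numeral zero_less_power,
    metis pos_mod_bound zero_less_numeral zero_less_power)

lemma z3_eqI: "(\<And>n. Rep_z3 a n = Rep_z3 b n) \<Longrightarrow> a = b"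
  by (metis Rep_z3_inject ext)

lemma Rep_z3_of_nat: "Rep_z3 (of_nat k) n = int k mod 3 ^ n"
  by (induction k) (simp_all add: zero_z3.rep_eq one_z3.rep_eq plus_z3.rep_eq mod_simps)

lemma Rep_z3_of_int: "Rep_z3 (of_int k) n = k mod 3 ^ n"
proof (cases k)
  case (neg m)
  show ?thesis
    unfolding neg of_int_minus of_int_of_nat_eq uminus_z3.rep_eq Rep_z3_of_nat by (rule mod_minus_eq)
qed (simp add: Rep_z3_of_nat)

lemma Rep_z3_3_power: "Rep_z3 (3 ^ k) n = 3 ^ k mod 3 ^ n"
  using Rep_z3_of_int[of "3 ^ k" n] by simp

lemma three_power_dvd_z3_iff: "3 ^ n dvd a \<longleftrightarrow> Rep_z3 a n = 0"
proof
  assume "3 ^ n dvd a"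
  then show "Rep_z3 a n = 0" by (auto simp: dvd_def times_z3.rep_eq Rep_z3_3_power)
next
  assume 0: "Rep_z3 a n = 0"
  \<comment> \<open>The candidate quotient: division by 3^n costs n digits, so its residue at m
    comes from index n + m.\<close>
  define b where "b m = Rep_z3 a (n + m) div 3 ^ n" for m
  have dvd: "3 ^ n * b m = Rep_z3 a (n + m)" for m
    using Rep_z3_le[of a n m] 0 by (auto simp: b_def)
  have "b m = b (Suc m) mod 3 ^ m" for m
  proof -
    have "3 ^ n * b m = (3 ^ n * b (Suc m)) mod (3 ^ n * 3 ^ m)"
      unfolding dvd using Rep_z3_compat[of a "n + m"] by (simp add: power_add)
    then show ?thesis by (simp add: mult_mod_right[symmetric])
  qed
  then have rep: "Rep_z3 (Abs_z3 b) = b" by (intro Abs_z3_inverse) blast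
  have "a = 3 ^ n * Abs_z3 b"
  proof (rule z3_eqI)
    fix m
    have "Rep_z3 (3 ^ n * Abs_z3 b) m = (3 ^ n * b m) mod 3 ^ m"
      by (simp add: times_z3.rep_eq Rep_z3_3_power rep mod_simps)
    also have "\<dots> = Rep_z3 a m"
      unfolding dvd using Rep_z3_le[of a m n] by (simp add: add.commute)
    finally show "Rep_z3 a m = Rep_z3 (3 ^ n * Abs_z3 b) m" by simp
  qed
  then show "3 ^ n dvd a" by simp
qed

lemma three_dvd_z3_iff: "3 dvd a \<longleftrightarrow> Rep_z3 a 1 = 0"
  using three_power_dvd_z3_iff[of 1 a] by simp

lemma prime_three_z3:
  assumes "3 dvd a * (b :: z3)"
  shows "3 dvd a \<or> 3 dvd b"
proof -
  have "3 dvd Rep_z3 a 1 * Rep_z3 b 1"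
    using assms by (auto simp: three_dvd_z3_iff times_z3.rep_eq)
  then have "3 dvd Rep_z3 a 1 \<or> 3 dvd Rep_z3 b 1"
    using prime_elem_dvd_mult_iff[OF prime_elem_3_int] by blast
  moreover have "Rep_z3 c 1 = 0" if "3 dvd Rep_z3 c 1" for c
    using that Rep_z3_bounds[of c 1] by (auto simp: zdvd_not_zless dest: zdvd_imp_le)
  ultimately show ?thesis unfolding three_dvd_z3_iff by blast
qed

lemma z3_unit:
  assumes "\<not> 3 dvd a"
  shows "\<exists>b. a * b = (1 :: z3)"
proof -
  have cop: "coprime (Rep_z3 a n) (3 ^ n)" for n
  proof (cases n)
    case (Suc m)
    have "\<not> 3 dvd Rep_z3 a n"
      using assms Rep_z3_le[of a 1 m] Suc by (auto simp: three_dvd_z3_iff)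
    then have "coprime (Rep_z3 a n) 3"
      by (metis coprime_commute prime_elem_3_int prime_elem_imp_coprime)
    then show ?thesis by simp
  qed simp
  \<comment> \<open>Inverses modulo each power of 3. The bounds make them unique, and uniqueness
    makes them compatible.\<close>
  define b where "b n = (SOME x. 0 \<le> x \<and> x < 3 ^ n \<and> [Rep_z3 a n * x = 1] (mod 3 ^ n))" for n
  have b: "0 \<le> b n \<and> b n < 3 ^ n \<and> [Rep_z3 a n * b n = 1] (mod 3 ^ n)" for n
    unfolding b_def
  proof (rule someI_ex)
    obtain x where x: "[Rep_z3 a n * x = 1] (mod 3 ^ n)" using cong_solve_coprime_int[OF cop] by blast
    have "[Rep_z3 a n * (x mod 3 ^ n) = 1] (mod 3 ^ n)" using x by (simp add: cong_def mod_simps)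
    then show "\<exists>x. 0 \<le> x \<and> x < 3 ^ n \<and> [Rep_z3 a n * x = 1] (mod 3 ^ n)"
      by (intro exI[of _ "x mod 3 ^ n"]) simp
  qed
  have "b n = b (Suc n) mod 3 ^ n" for n
  proof -
    have "[Rep_z3 a (Suc n) * b (Suc n) = 1] (mod 3 ^ n)"
      using b[of "Suc n"] by (auto intro: cong_dvd_modulus)
    then have "[Rep_z3 a n * (b (Suc n) mod 3 ^ n) = 1] (mod 3 ^ n)"
      unfolding Rep_z3_compat[of a n] by (simp add: cong_def mod_simps)
    then have "[Rep_z3 a n * b n = Rep_z3 a n * (b (Suc n) mod 3 ^ n)] (mod 3 ^ n)"
      using b[of n] cong_sym cong_trans by blast
    then have "[b n = b (Suc n) mod 3 ^ n] (mod 3 ^ n)"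
      using cop[of n] by (simp add: cong_mult_lcancel)
    then show ?thesis using b[of n] by (simp add: cong_def)
  qed
  then have rep: "Rep_z3 (Abs_z3 b) = b" by (intro Abs_z3_inverse) blast
  have "a * Abs_z3 b = 1"
    using b by (intro z3_eqI) (simp add: times_z3.rep_eq one_z3.rep_eq rep cong_def)
  then show ?thesis ..
qed

lemma z3_factor:
  assumes "a \<noteq> 0"
  shows "\<exists>n u. a = 3 ^ n * u \<and> \<not> 3 dvd (u :: z3)"
proof -
  obtain m where m: "Rep_z3 a m \<noteq> 0" using assms z3_eqI[of a 0] by (auto simp: zero_z3.rep_eq)
  \<comment> \<open>The residue at index 0 is always 0, so the least index is some n + 1, and 3^n is
    the exact power dividing \<open>a\<close>.\<close>
  define k where "k = (LEAST m. Rep_z3 a m \<noteq> 0)"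
  have k: "Rep_z3 a k \<noteq> 0" unfolding k_def by (rule LeastI[of "\<lambda>m. Rep_z3 a m \<noteq> 0", OF m])
  have "Rep_z3 a 0 = 0" using Rep_z3_bounds[of a 0] by simp
  then obtain n where n: "k = Suc n" using k by (cases k) auto
  have "Rep_z3 a n = 0" using not_less_Least[of n "\<lambda>m. Rep_z3 a m \<noteq> 0"] n by (simp add: k_def)
  then obtain u where u: "a = 3 ^ n * u" unfolding three_power_dvd_z3_iff[symmetric] by (rule dvdE)
  have "\<not> 3 dvd u"
  proof
    assume "3 dvd u"
    then have "3 ^ Suc n dvd a" unfolding u by (auto simp: dvd_def)
    then show False using k n by (simp only: three_power_dvd_z3_iff)
  qed
  then show ?thesis using u by blast
qed

text \<open>Divisibility by 9 only involves residues modulo 9, where the statement for integers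
  applies.\<close>

lemma nine_dvd_norm_z3:
  fixes a b :: z3
  assumes "9 dvd a * a - a * b + b * b"
  shows "3 dvd a \<and> 3 dvd b"
proof -
  let ?x = "Rep_z3 a 2" and ?y = "Rep_z3 b 2"
  have "3 ^ 2 dvd a * a - a * b + b * b" using assms by simp
  then have "Rep_z3 (a * a - a * b + b * b) 2 = 0" by (simp only: three_power_dvd_z3_iff)
  moreover have "Rep_z3 (a * a - a * b + b * b) 2 = (?x * ?x - ?x * ?y + ?y * ?y) mod 3 ^ 2"
    by (simp only: diff_conv_add_uminus times_z3.rep_eq plus_z3.rep_eq uminus_z3.rep_eq
        mod_add_left_eq mod_add_right_eq mod_add_eq mod_minus_eq)
  ultimately have "(?x * ?x - ?x * ?y + ?y * ?y) mod 9 = 0" by simp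
  then have "9 dvd ?x ^ 2 - ?x * ?y + ?y ^ 2" by (simp add: power2_eq_square mod_eq_0_iff_dvd)
  from nine_dvd_norm[OF this] show ?thesis
    using Rep_z3_compat[of a 1] Rep_z3_compat[of b 1]
    by (auto simp: three_dvd_z3_iff numeral_2_eq_2)
qed

subsection \<open>The valuation of \<open>\<rat>\<^sub>3\<close>\<close>

definition emb :: "z3 \<Rightarrow> q3" where "emb a = Fract a 1"

lemma emb_simps [simp]:
  "emb 0 = 0" "emb 1 = 1" "emb (a + b) = emb a + emb b" "emb (a * b) = emb a * emb b"
  "emb (- a) = - emb a" "emb (a - b) = emb a - emb b" "emb a = emb b \<longleftrightarrow> a = b"
  by (simp_all add: emb_def Zero_fract_def One_fract_def eq_fract)

lemma emb_eq_0_iff [simp]: "emb a = 0 \<longleftrightarrow> a = 0"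
  using emb_simps(7)[of a 0] by (simp del: emb_simps(7))

lemma emb_power [simp]: "emb (a ^ n) = emb a ^ n"
  by (induction n) simp_all

lemma emb_of_nat [simp]: "emb (of_nat n) = of_nat n"
  by (induction n) simp_all

lemma emb_numeral [simp]: "emb (numeral n) = numeral n"
  using emb_of_nat[of "numeral n"] by simp

lemma three_q3_nonzero [simp]: "(3 :: q3) \<noteq> 0"
proof -
  have "\<not> (3 :: z3) dvd 1" unfolding three_dvd_z3_iff by (simp add: one_z3.rep_eq)
  then have "(3 :: z3) \<noteq> 0" using Rep_z3_of_int[of 3 2] zero_z3.rep_eq by auto
  then show ?thesis using emb_eq_0_iff[of 3] by simp
qed

text \<open>An element of \<open>z3\<close> not divisible by 3 is invertible, so the unit part of
  the denominator moves into the numerator.\<close>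

lemma q3_factor:
  assumes "q \<noteq> 0"
  shows "\<exists>u k. \<not> 3 dvd u \<and> q = emb u * 3 powi k"
proof -
  obtain a b where ab: "q = Fract a b" "b \<noteq> 0" by (cases q)
  then have "a \<noteq> 0" using assms by (auto simp: fract_collapse)
  then obtain n u where u: "a = 3 ^ n * u" "\<not> 3 dvd u" using z3_factor by blast
  obtain m w where w: "b = 3 ^ m * w" "\<not> 3 dvd w" using z3_factor ab(2) by blast
  obtain w' where w': "w * w' = 1" using z3_unit w(2) by blast
  have "\<not> 3 dvd w'"
  proof
    assume "3 dvd w'"
    then have "3 dvd w * w'" by simp
    then show False unfolding w' three_dvd_z3_iff by (simp add: one_z3.rep_eq)
  qed
  then have "\<not> 3 dvd u * w'" using prime_three_z3 u(2) by blast
  moreover have "q = emb (u * w') * 3 powi (int n - int m)"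
  proof -
    have "q = emb a / emb b" using ab by (simp add: emb_def divide_fract)
    moreover have "emb w * emb w' = 1" using w' by (metis emb_simps(2,4))
    then have "emb w \<noteq> 0" "inverse (emb w) = emb w'" by (auto intro: inverse_unique)
    then have "emb a / emb b = emb u * emb w' * (3 ^ n / 3 ^ m)"
      by (simp add: u(1) w(1) divide_inverse)
    ultimately show ?thesis by (simp add: power_int_diff)
  qed
  ultimately show ?thesis by blast
qed

lemma v3_eq:
  assumes "\<not> 3 dvd u"
  shows "v3 (emb u * 3 powi k) = k"
  unfolding v3_def
proof (rule the_equality)
  have "\<not> 3 dvd (1 :: z3)" unfolding three_dvd_z3_iff by (simp add: one_z3.rep_eq)
  then show "\<exists>a b. \<not> 3 dvd a \<and> \<not> 3 dvd b \<and> emb u * 3 powi k = Fract a b * 3 powi k"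
    using assms by (auto simp: emb_def)
  fix n assume "\<exists>a b. \<not> 3 dvd a \<and> \<not> 3 dvd b \<and> emb u * 3 powi k = Fract a b * 3 powi n"
  then obtain a b where ab: "\<not> 3 dvd a" "\<not> 3 dvd b" "emb u * 3 powi k = Fract a b * 3 powi n"
    by blast
  have b: "b \<noteq> 0" using ab(2) by auto
  have "Fract a b = emb a / emb b" using b by (simp add: emb_def divide_fract)
  then have e: "emb (u * b) * 3 powi k = emb a * 3 powi n"
    using ab(3) b by (simp add: field_simps)
  have ub: "\<not> 3 dvd u * b" using prime_three_z3 assms ab(2) by blast
  \<comment> \<open>Otherwise the surplus power of 3 would divide \<open>x\<close>. Used in both
    directions, this makes the exponent unique.\<close>
  have le: "l \<le> j" if "emb x * 3 powi j = emb y * 3 powi l" "\<not> 3 dvd x" for x y j l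
  proof (rule ccontr)
    assume "\<not> l \<le> j"
    then obtain d where d: "l = j + int (Suc d)"
      by (metis add.commute add_Suc_right int_ops(4) not_le zless_iff_Suc_zadd)
    have "emb x * 3 powi j = emb (y * 3 ^ Suc d) * 3 powi j"
      using that(1) unfolding d by (simp add: power_int_add)
    then have "x = y * 3 ^ Suc d" by (simp del: emb_simps(4))
    then show False using that(2) by simp
  qed
  show "n = k" using le[OF e ub] le[OF e[symmetric] ab(1)] by simp
qed

lemma v3_emb_nonneg:
  assumes "a \<noteq> 0"
  shows "0 \<le> v3 (emb a)"
proof -
  obtain n u where u: "a = 3 ^ n * u" "\<not> 3 dvd u" using z3_factor[OF assms] by blast
  have "emb a = emb u * 3 powi (int n)" unfolding u(1) by simp
  then show ?thesis using v3_eq[OF u(2), of "int n"] by simp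
qed

lemma v3_mult:
  assumes "x \<noteq> 0" "y \<noteq> 0"
  shows "v3 (x * y) = v3 x + v3 y"
proof -
  obtain u k where u: "\<not> 3 dvd u" "x = emb u * 3 powi k" using q3_factor[OF assms(1)] by blast
  obtain w l where w: "\<not> 3 dvd w" "y = emb w * 3 powi l" using q3_factor[OF assms(2)] by blast
  have "x * y = emb (u * w) * 3 powi (k + l)" unfolding u w by (simp add: power_int_add)
  moreover have "\<not> 3 dvd u * w" using prime_three_z3 u w by blast
  ultimately show ?thesis using v3_eq u w by metis
qed

subsection \<open>Passing to \<open>\<rat>\<^sub>3(\<zeta>\<^sub>3)\<close>\<close>

definition q3z_integer :: "q3z \<Rightarrow> bool" where
  "q3z_integer z \<longleftrightarrow> (\<exists>p q. z = Q3z (emb p) (emb q))"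

lemma q3z_norm_mult: "q3z_norm (x * y) = q3z_norm x * q3z_norm y"
  by (simp add: q3z_norm_def times_q3z_def power2_eq_square algebra_simps)

lemma q3z_norm_nonzero: "x \<noteq> 0 \<Longrightarrow> q3z_norm x \<noteq> 0"
  using q3z_norm_eq_0[of x] by (metis q3z.collapse zero_q3z_def)

lemma val_mult: "x \<noteq> 0 \<Longrightarrow> y \<noteq> 0 \<Longrightarrow> val (x * y) = val x + val y"
  by (simp add: val_def q3z_norm_mult v3_mult q3z_norm_nonzero)

lemma q3z_factor:
  assumes "z \<noteq> 0"
  shows "\<exists>m p q. z = Q3z (emb p * 3 powi m) (emb q * 3 powi m) \<and> \<not> (3 dvd p \<and> 3 dvd q)"
proof -
  obtain x y where z: "z = Q3z x y" by (cases z)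
  consider "x = 0" "y \<noteq> 0" | "x \<noteq> 0" "y = 0" | "x \<noteq> 0" "y \<noteq> 0"
    using assms z zero_q3z_def by auto
  then show ?thesis
  proof cases
    case 1
    then obtain u k where "\<not> 3 dvd u" "y = emb u * 3 powi k" using q3_factor by blast
    then show ?thesis using 1 z by (intro exI[of _ k] exI[of _ 0] exI[of _ u]) simp
  next
    case 2
    then obtain u k where "\<not> 3 dvd u" "x = emb u * 3 powi k" using q3_factor by blast
    then show ?thesis using 2 z by (intro exI[of _ k] exI[of _ u] exI[of _ 0]) simp
  next
    case 3
    obtain u k where u: "\<not> 3 dvd u" "x = emb u * 3 powi k" using 3 q3_factor by blast
    obtain w l where w: "\<not> 3 dvd w" "y = emb w * 3 powi l" using 3 q3_factor by blast
    show ?thesis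
    proof (cases "k \<le> l")
      case True
      then obtain d where d: "l = k + int d" using zle_iff_zadd by blast
      have "y = emb (w * 3 ^ d) * 3 powi k" unfolding w(2) d by (simp add: power_int_add)
      then show ?thesis using u z by blast
    next
      case False
      then have "l \<le> k" by simp
      then obtain d where d: "k = l + int d" using zle_iff_zadd by blast
      have "x = emb (u * 3 ^ d) * 3 powi l" unfolding u(2) d by (simp add: power_int_add)
      then show ?thesis using w z by blast
    qed
  qed
qed

text \<open>For p, q not both divisible by 3 the norm form is not divisible by 9, so it contributes
  0 or 1. The value 1 occurs for the uniformizer 1 - \<zeta>, whose norm is 3.\<close>

lemma val_factored:
  assumes "z = Q3z (emb p * 3 powi m) (emb q * 3 powi m)" "\<not> (3 dvd p \<and> 3 dvd q)"
  shows "val z = 2 * m \<or> val z = 2 * m + 1"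
proof -
  let ?n = "p * p - p * q + q * q"
  have 9: "\<not> 9 dvd ?n" using nine_dvd_norm_z3 assms(2) by blast
  then have "?n \<noteq> 0" by auto
  then obtain e u where e: "?n = 3 ^ e * u" "\<not> 3 dvd u" using z3_factor by blast
  have "e < 2"
  proof (rule ccontr)
    assume "\<not> e < 2"
    then have "(3 :: z3) ^ 2 dvd 3 ^ e" by (intro le_imp_power_dvd) simp
    then have "3 ^ 2 dvd ?n" unfolding e(1) by (rule dvd_mult2)
    then show False using 9 by simp
  qed
  have "q3z_norm z = emb ?n * (3 powi m * 3 powi m)"
  proof -
    have "(x * t)\<^sup>2 - x * t * (y * t) + (y * t)\<^sup>2 = (x * x - x * y + y * y) * (t * t)" for x y t :: q3
      by (simp add: power2_eq_square algebra_simps)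
    then show ?thesis unfolding assms(1) q3z_norm_def q3z.sel emb_simps by blast
  qed
  also have "\<dots> = emb u * 3 powi (2 * m + int e)"
  proof -
    have "(3 :: q3) powi (2 * m + int e) = 3 powi m * 3 powi m * 3 ^ e"
      unfolding mult_2 power_int_add[OF disjI1[OF three_q3_nonzero]] power_int_of_nat by (rule refl)
    then show ?thesis unfolding e(1) by simp
  qed
  finally have "val z = 2 * m + int e" unfolding val_def using v3_eq[OF e(2)] by simp
  then show ?thesis using \<open>e < 2\<close> by linarith
qed

text \<open>Identifies the valuation ring with the elements having both coordinates integral. These
  are visibly closed under addition, which yields the ultrametric inequality that the norm does not
  show.\<close>

lemma val_nonneg_iff:
  assumes "z \<noteq> 0"
  shows "0 \<le> val z \<longleftrightarrow> q3z_integer z"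
proof
  assume v: "0 \<le> val z"
  obtain m p q where z: "z = Q3z (emb p * 3 powi m) (emb q * 3 powi m)" "\<not> (3 dvd p \<and> 3 dvd q)"
    using q3z_factor[OF assms] by blast
  have "0 \<le> m" using v val_factored[OF z] by linarith
  then have "3 powi m = emb (3 ^ nat m)" by (simp add: power_int_def)
  then have "z = Q3z (emb (p * 3 ^ nat m)) (emb (q * 3 ^ nat m))" unfolding z(1) by simp
  then show "q3z_integer z" unfolding q3z_integer_def by blast
next
  assume "q3z_integer z"
  then obtain p q where z: "z = Q3z (emb p) (emb q)" by (auto simp: q3z_integer_def)
  let ?n = "p * p - p * q + q * q"
  have n: "q3z_norm z = emb ?n" unfolding z q3z_norm_def by (simp add: power2_eq_square)
  then have "?n \<noteq> 0" using q3z_norm_nonzero[OF assms] by (auto simp del: emb_simps(3-6))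
  then show "0 \<le> val z" unfolding val_def n by (rule v3_emb_nonneg)
qed

lemma q3z_integer_add: "q3z_integer x \<Longrightarrow> q3z_integer y \<Longrightarrow> q3z_integer (x + y)"
  unfolding q3z_integer_def plus_q3z_def by (metis emb_simps(3) q3z.sel)

lemma q3z_integer_1: "q3z_integer 1"
  unfolding q3z_integer_def one_q3z_def by (metis emb_simps(1,2))

lemma of_int_q3z: "of_int k = Q3z (emb (of_int k)) 0"
proof -
  have n: "of_nat m = Q3z (emb (of_nat m)) 0" for m
    by (induction m) (simp_all add: zero_q3z_def one_q3z_def plus_q3z_def)
  show ?thesis
  proof (cases k)
    case (nonneg m)
    then show ?thesis using n[of m] by simp
  next
    case (neg m)
    show ?thesis unfolding neg of_int_minus of_int_of_nat_eq n uminus_q3z_def by simp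
  qed
qed

lemma val_of_int:
  assumes "\<not> 3 dvd k"
  shows "val (of_int k) = 0"
proof -
  have "\<not> 3 dvd k * k" using assms prime_elem_dvd_mult_iff[OF prime_elem_3_int] by blast
  then have "Rep_z3 (of_int (k * k)) 1 \<noteq> 0" unfolding Rep_z3_of_int by (simp add: dvd_eq_mod_eq_0)
  then have "\<not> 3 dvd (of_int (k * k) :: z3)" unfolding three_dvd_z3_iff .
  from v3_eq[OF this, of 0] have "v3 (emb (of_int (k * k))) = 0" by simp
  moreover have "q3z_norm (of_int k) = emb (of_int (k * k))"
    unfolding of_int_q3z q3z_norm_def by (simp add: power2_eq_square)
  ultimately show ?thesis by (simp add: val_def)
qed

lemma val_3: "val 3 = 2"
proof -
  have 3: "(3 :: q3z) = Q3z 3 0" using of_int_q3z[of 3] by simp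
  have "q3z_norm 3 = emb 1 * 3 powi 2"
    unfolding 3 q3z_norm_def by simp
  moreover have "\<not> 3 dvd (1 :: z3)" unfolding three_dvd_z3_iff by (simp add: one_z3.rep_eq)
  ultimately show ?thesis unfolding val_def using v3_eq[of 1 2] by simp
qed

interpretation q3z: valuation val
proof
  show "val (x * y) = val x + val y" if "x \<noteq> 0" "y \<noteq> 0" for x y
    using val_mult that .
  \<comment> \<open>Divided by the term of smaller valuation, the claim is that 1 + y/x is
    integral.\<close>
  have le: "val x \<le> val (x + y)" if xy: "x \<noteq> 0" "y \<noteq> 0" "x + y \<noteq> 0" "val x \<le> val y" for x y
  proof -
    let ?r = "y / x"
    have r: "?r \<noteq> 0" "x * ?r = y" "x * (1 + ?r) = x + y" using xy by (simp_all add: field_simps)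
    then have "0 \<le> val ?r" using val_mult[of x ?r] xy by simp
    then have "q3z_integer (1 + ?r)"
      using val_nonneg_iff[OF r(1)] q3z_integer_add q3z_integer_1 by blast
    moreover have "1 + ?r \<noteq> 0" using r(3) xy(3) by auto
    ultimately have "0 \<le> val (1 + ?r)" using val_nonneg_iff by blast
    then show ?thesis using val_mult[OF xy(1) \<open>1 + ?r \<noteq> 0\<close>] r(3) by simp
  qed
  show "min (val x) (val y) \<le> val (x + y)" if "x \<noteq> 0" "y \<noteq> 0" "x + y \<noteq> 0" for x y
    using le[of x y] le[of y x] that by (cases "val x \<le> val y") (simp_all add: add.commute)
  show "val 2 = 0" using val_of_int[of 2] by simp
  show "(2 :: q3z) \<noteq> 0"
  proof
    assume "(2 :: q3z) = 0"
    then have "Q3z (emb (of_int 2)) 0 = Q3z 0 0" using of_int_q3z[of 2] zero_q3z_def by simp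
    then have "(2 :: z3) = 0" by (simp del: emb_numeral)
    then show False using Rep_z3_of_int[of 2 1] zero_z3.rep_eq by simp
  qed
qed

lemma three_q3z_nonzero: "(3 :: q3z) \<noteq> 0"
proof -
  have "(3 :: q3z) = Q3z 3 0" using of_int_q3z[of 3] by simp
  then show ?thesis by (metis q3z.inject three_q3_nonzero zero_q3z_def)
qed

lemma val_eq:
  assumes "x = of_int k * 3 ^ n" "\<not> 3 dvd k"
  shows "x \<noteq> 0" "val x = 2 * int n"
proof -
  have k: "(of_int k :: q3z) \<noteq> 0"
  proof
    assume "(of_int k :: q3z) = 0"
    then have "emb (of_int k) = 0" by (simp add: of_int_q3z zero_q3z_def)
    then have "Rep_z3 (of_int k) 1 = 0" by (simp add: zero_z3.rep_eq)
    then show False using assms(2) by (simp add: Rep_z3_of_int dvd_eq_mod_eq_0)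
  qed
  then show "x \<noteq> 0" using three_q3z_nonzero by (simp add: assms(1))
  have "val (3 ^ n) = 2 * int n"
    using three_q3z_nonzero by (induction n) (simp_all add: val_mult val_3)
  then show "val x = 2 * int n"
    unfolding assms(1) using k three_q3z_nonzero by (simp add: val_mult val_of_int[OF assms(2)])
qed

subsection \<open>Compactness\<close>

text \<open>\<open>residue_box 0 0 0\<close> is the whole ring of integers, since residues modulo 1
  vanish.\<close>

definition residue_box :: "nat \<Rightarrow> int \<Rightarrow> int \<Rightarrow> q3z P1 set" where
  "residue_box n x y = {Fin (Q3z (emb p) (emb q)) | p q. Rep_z3 p n = x \<and> Rep_z3 q n = y}"

lemma residue_box_subset_nbhd:
  assumes "Rep_z3 p n = x" "Rep_z3 q n = y"
  shows "residue_box n x y \<subseteq> basic_nbhd val (Fin (Q3z (emb p) (emb q))) (2 * int n)"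
proof
  fix t assume "t \<in> residue_box n x y"
  then obtain p' q' where t: "t = Fin (Q3z (emb p') (emb q'))" "Rep_z3 p' n = x" "Rep_z3 q' n = y"
    by (auto simp: residue_box_def)
  have "3 ^ n dvd a - b" if "Rep_z3 a n = Rep_z3 b n" for a b
    unfolding three_power_dvd_z3_iff minus_z3_def plus_z3.rep_eq uminus_z3.rep_eq that
      mod_add_right_eq by simp
  then obtain c d where cd: "p' - p = 3 ^ n * c" "q' - q = 3 ^ n * d"
    using assms t by (metis dvdE)
  have "Q3z (emb p') (emb q') - Q3z (emb p) (emb q) = 3 ^ n * Q3z (emb c) (emb d)"
  proof -
    have "Q3z (emb p') (emb q') - Q3z (emb p) (emb q) = Q3z (emb (3 ^ n * c)) (emb (3 ^ n * d))"
      unfolding cd[symmetric] by (simp add: minus_q3z_def)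
    also have "\<dots> = of_int (3 ^ n) * Q3z (emb c) (emb d)"
      unfolding of_int_q3z by (simp add: times_q3z_def)
    finally show ?thesis by simp
  qed
  moreover have "q3z.vge (3 ^ n) (2 * int n)"
    using val_eq(2)[of "3 ^ n" 1 n] by (simp add: q3z.vge_def)
  moreover have "q3z.vge (Q3z (emb c) (emb d)) 0"
    using val_nonneg_iff[of "Q3z (emb c) (emb d)"] by (auto simp: q3z.vge_def q3z_integer_def)
  ultimately have "q3z.vge (Q3z (emb p') (emb q') - Q3z (emb p) (emb q)) (2 * int n)"
    using q3z.vge_mult by fastforce
  then show "t \<in> basic_nbhd val (Fin (Q3z (emb p) (emb q))) (2 * int n)"
    by (simp add: t(1) q3z.basic_nbhd_Fin)
qed

lemma residue_box_refine:
  "residue_box n x y \<subseteq> (\<Union>xy' \<in> {(x', y') \<in> {0..<3 ^ Suc n} \<times> {0..<3 ^ Suc n}.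
    x = x' mod 3 ^ n \<and> y = y' mod 3 ^ n}. residue_box (Suc n) (fst xy') (snd xy'))"
    (is "_ \<subseteq> \<Union> (?B ` ?I)")
proof
  fix t assume "t \<in> residue_box n x y"
  then obtain p q where t: "t = Fin (Q3z (emb p) (emb q))" "Rep_z3 p n = x" "Rep_z3 q n = y"
    by (auto simp: residue_box_def)
  let ?x = "Rep_z3 p (Suc n)" and ?y = "Rep_z3 q (Suc n)"
  have "t \<in> ?B (?x, ?y)" using t(1) unfolding residue_box_def fst_conv snd_conv by blast
  moreover have "(?x, ?y) \<in> ?I"
    using Rep_z3_bounds[of p "Suc n"] Rep_z3_bounds[of q "Suc n"] Rep_z3_compat[of p n]
      Rep_z3_compat[of q n] t by simp
  ultimately show "t \<in> \<Union> (?B ` ?I)" by (rule UN_I[rotated])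
qed

text \<open>A box without finite subcover contains such a box among the finitely many of the next
  level. The nested boxes determine a point, and a neighbourhood of it inside one member of the
  cover already contains one of them.\<close>

lemma compactin_integers: "compactin (P1_topology val) (residue_box 0 0 0)"
  unfolding compactin_def
proof (intro conjI allI impI)
  fix \<U> assume \<U>: "(\<forall>U\<in>\<U>. openin (P1_topology val) U) \<and> residue_box 0 0 0 \<subseteq> \<Union> \<U>"
  define bad where "bad n xy \<longleftrightarrow> \<not> (\<exists>\<F>. finite \<F> \<and> \<F> \<subseteq> \<U> \<and> residue_box n (fst xy) (snd xy) \<subseteq> \<Union> \<F>)"
    for n xy
  show "\<exists>\<F>. finite \<F> \<and> \<F> \<subseteq> \<U> \<and> residue_box 0 0 0 \<subseteq> \<Union> \<F>"
  proof (rule ccontr)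
    assume "\<not> (\<exists>\<F>. finite \<F> \<and> \<F> \<subseteq> \<U> \<and> residue_box 0 0 0 \<subseteq> \<Union> \<F>)"
    then have bad0: "bad 0 (0, 0)" by (simp add: bad_def)
    have step: "\<exists>xy'. bad (Suc n) xy' \<and> fst xy = fst xy' mod 3 ^ n \<and> snd xy = snd xy' mod 3 ^ n"
      if "bad n xy" for n xy
    proof (rule ccontr)
      assume none: "\<not> ?thesis"
      let ?I = "{(x', y') \<in> {0..<3 ^ Suc n} \<times> {0..<3 ^ Suc n}.
        fst xy = x' mod 3 ^ n \<and> snd xy = y' mod (3 :: int) ^ n}"
      have fin: "finite ?I" by (rule finite_subset[of _ "{0..<3 ^ Suc n} \<times> {0..<3 ^ Suc n}"]) auto
      have "\<forall>xy'\<in>?I. \<exists>\<F>. finite \<F> \<and> \<F> \<subseteq> \<U> \<and> residue_box (Suc n) (fst xy') (snd xy') \<subseteq> \<Union> \<F>"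
      proof
        fix xy' assume "xy' \<in> ?I"
        then have "fst xy = fst xy' mod 3 ^ n" "snd xy = snd xy' mod 3 ^ n" by auto
        with none have "\<not> bad (Suc n) xy'" by blast
        then show "\<exists>\<F>. finite \<F> \<and> \<F> \<subseteq> \<U> \<and> residue_box (Suc n) (fst xy') (snd xy') \<subseteq> \<Union> \<F>"
          unfolding bad_def not_not .
      qed
      from bchoice[OF this] obtain F where F: "\<forall>xy'\<in>?I. finite (F xy') \<and> F xy' \<subseteq> \<U> \<and>
          residue_box (Suc n) (fst xy') (snd xy') \<subseteq> \<Union> (F xy')" by blast
      have "residue_box n (fst xy) (snd xy) \<subseteq> (\<Union>xy'\<in>?I. residue_box (Suc n) (fst xy') (snd xy'))"
        by (rule residue_box_refine)
      also have "\<dots> \<subseteq> \<Union> (\<Union> (F ` ?I))"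
      proof (rule UN_least)
        fix xy' assume i: "xy' \<in> ?I"
        have "residue_box (Suc n) (fst xy') (snd xy') \<subseteq> \<Union> (F xy')" using bspec[OF F i] by simp
        also have "\<dots> \<subseteq> \<Union> (\<Union> (F ` ?I))" by (rule Union_mono, rule UN_upper, rule i)
        finally show "residue_box (Suc n) (fst xy') (snd xy') \<subseteq> \<Union> (\<Union> (F ` ?I))" .
      qed
      finally have "residue_box n (fst xy) (snd xy) \<subseteq> \<Union> (\<Union> (F ` ?I))" .
      moreover have "finite (\<Union> (F ` ?I))" "\<Union> (F ` ?I) \<subseteq> \<U>" using F fin by auto
      ultimately show False using that unfolding bad_def by blast
    qed
    have "\<exists>f. \<forall>n. bad n (f n) \<and> (fst (f n) = fst (f (Suc n)) mod 3 ^ n \<and> snd (f n) = snd (f (Suc n)) mod 3 ^ n)"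
      by (rule dependent_nat_choice) (use bad0 step in blast)+
    then obtain f where f: "\<And>n. bad n (f n)" "\<And>n. fst (f n) = fst (f (Suc n)) mod 3 ^ n"
      "\<And>n. snd (f n) = snd (f (Suc n)) mod 3 ^ n" by blast
    define p q where "p = Abs_z3 (\<lambda>n. fst (f n))" and "q = Abs_z3 (\<lambda>n. snd (f n))"
    have "(\<lambda>n. fst (f n)) \<in> {x. \<forall>n. x n = x (Suc n) mod 3 ^ n}"
      "(\<lambda>n. snd (f n)) \<in> {x. \<forall>n. x n = x (Suc n) mod 3 ^ n}"
      using f(2,3) by blast+
    from this[THEN Abs_z3_inverse] have rep: "Rep_z3 p n = fst (f n)" "Rep_z3 q n = snd (f n)" for n
      unfolding p_def q_def by simp_all
    let ?t = "Fin (Q3z (emb p) (emb q))"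
    have "Rep_z3 a 0 = 0" for a using Rep_z3_bounds[of a 0] by simp
    then have "?t \<in> residue_box 0 0 0" unfolding residue_box_def by blast
    then obtain U where U: "U \<in> \<U>" "?t \<in> U" using \<U> by blast
    then obtain k where k: "basic_nbhd val ?t k \<subseteq> U" using \<U> openin_P1_topology by blast
    \<comment> \<open>Level \<open>nat k\<close> suffices, also for negative k: 2 * int (nat k) is
      at least k.\<close>
    have "residue_box (nat k) (fst (f (nat k))) (snd (f (nat k))) \<subseteq> basic_nbhd val ?t (2 * int (nat k))"
      using residue_box_subset_nbhd rep by blast
    also have "\<dots> \<subseteq> basic_nbhd val ?t k" by (rule basic_nbhd_antimono) simp
    also note k
    finally have "residue_box (nat k) (fst (f (nat k))) (snd (f (nat k))) \<subseteq> \<Union> {U}" by simp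
    then show False using f(1)[of "nat k"] U(1) unfolding bad_def by blast
  qed
qed simp

text \<open>The integers and their inverses cover the line, and the latter are a continuous image of
  the former.\<close>

lemma compact_P1: "compact_space (P1_topology val)"
proof -
  let ?A = "residue_box 0 0 0" and ?i = "mobius 0 1 1 (0 :: q3z)"
  have 0: "Rep_z3 a 0 = 0" for a using Rep_z3_bounds[of a 0] by simp
  have A: "Fin z \<in> ?A" if "q3z_integer z" for z
    using that 0 by (auto simp: residue_box_def q3z_integer_def)
  have "x \<in> ?A \<union> ?i ` ?A" for x
  proof (cases x)
    case Infty
    have "Fin 0 \<in> ?A" using A[of 0] by (auto simp: q3z_integer_def zero_q3z_def intro!: exI[of _ 0])
    moreover have "?i (Fin 0) = x" by (simp add: Infty)
    ultimately show ?thesis by blast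
  next
    case (Fin z)
    show ?thesis
    proof (cases "z = 0 \<or> 0 \<le> val z")
      case True
      have "q3z_integer 0" by (auto simp: q3z_integer_def zero_q3z_def intro!: exI[of _ 0])
      then have "q3z_integer z" using True by (cases "z = 0") (simp_all add: val_nonneg_iff)
      then show ?thesis using A Fin by blast
    next
      case False
      then have "val (1 / z) = - val z" using q3z.v_divide[of 1 z] by simp
      then have "q3z_integer (1 / z)" using False val_nonneg_iff[of "1 / z"] by simp
      then have "Fin (1 / z) \<in> ?A" by (rule A)
      moreover have "?i (Fin (1 / z)) = x" using False Fin by simp
      ultimately show ?thesis by blast
    qed
  qed
  then have "?A \<union> ?i ` ?A = UNIV" by blast
  moreover have "compactin (P1_topology val) (?i ` ?A)"
    by (rule image_compactin[OF compactin_integers q3z.continuous_inversion]) simp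
  ultimately show ?thesis
    using compactin_Un[OF compactin_integers] by (metis compact_space_def q3z.topspace_P1)
qed

section \<open>Clusters and quartets\<close>

text \<open>The families of the theorem are list lookups, unspecified beyond the last entry. They
  can be compared with those of a configuration only up to index g, and that is enough.\<close>

lemma superelliptic_pairing_cong:
  assumes "\<And>i. i \<le> g \<Longrightarrow> a i = a' i" "\<And>i. i \<le> g \<Longrightarrow> b i = b' i" "\<And>i. i \<le> g \<Longrightarrow> s i = s' i"
  shows "pair_set g a b = pair_set g a' b'" "Gamma0 g s = Gamma0 g s'" "Gamma g s = Gamma g s'"
    "superelliptic_pairing v g a b s = superelliptic_pairing v g a' b' s'"
proof -
  show 1: "pair_set g a b = pair_set g a' b'"
    unfolding pair_set_def using assms(1,2) by (metis (no_types, lifting) atMost_iff image_cong)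
  have "s ` {..g} = s' ` {..g}" using assms(3) by (intro image_cong) auto
  then show 2: "Gamma0 g s = Gamma0 g s'" by (simp add: Gamma0_def)
  have "(\<lambda>i. s 0 \<circ> s i) ` {1..g} = (\<lambda>i. s' 0 \<circ> s' i) ` {1..g}"
    using assms(3) by (intro image_cong) auto
  then show 3: "Gamma g s = Gamma g s'" by (simp add: Gamma_def)
  show "superelliptic_pairing v g a b s = superelliptic_pairing v g a' b' s'"
    unfolding superelliptic_pairing_def 1 2 3 using assms by auto
qed

text \<open>A matrix multiplies every bracket by its determinant; \<open>k p\<close> is the scalar
  relating the image vector of \<open>p\<close> to the normalized vector
  \<open>coords (h p)\<close>.\<close>

lemma PGL2_coords:
  assumes "h \<in> carrier PGL2"
  shows "\<exists>k d. d \<noteq> 0 \<and> (\<forall>p. k p \<noteq> 0) \<and> (\<forall>p q. det2 (coords (h p)) (coords (h q)) * (k p * k q) =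
    d * det2 (coords p) (coords q))"
proof -
  obtain a b c d where h: "h = mobius a b c d" "a * d - b * c \<noteq> 0" using assms by (rule PGL2_E)
  define x y where "x p = a * fst (coords p) + b * snd (coords p)"
    and "y p = c * fst (coords p) + d * snd (coords p)" for p :: "'a P1"
  have xy: "(x p, y p) \<noteq> (0, 0)" for p
    using linear_image_nonzero[OF h(2), of "fst (coords p)" "snd (coords p)"]
    by (simp add: x_def y_def del: coords.simps)
  have hp: "h p = hom_pt (x p, y p)" for p
    unfolding h(1) x_def y_def by (rule mobius_coords[OF h(2)])
  define k where "k p = (if y p = 0 then x p else y p)" for p
  have k: "k p \<noteq> 0" "x p = k p * fst (coords (h p))" "y p = k p * snd (coords (h p))" for p
    using xy[of p] by (auto simp: hp hom_pt_def k_def)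
  have "det2 (coords (h p)) (coords (h q)) * (k p * k q) =
      (a * d - b * c) * det2 (coords p) (coords q)" for p q
  proof -
    have "det2 (coords (h p)) (coords (h q)) * (k p * k q) = x p * y q - y p * x q"
      unfolding det2_def k(2,3)[of p] k(2,3)[of q] by (simp add: algebra_simps)
    also have "\<dots> = (a * d - b * c) * det2 (coords p) (coords q)"
      unfolding det2_def x_def y_def by (simp add: algebra_simps)
    finally show ?thesis .
  qed
  then show ?thesis using h(2) k(1) by blast
qed

context valuation
begin

text \<open>The points \<open>p, q\<close> are separated from \<open>r, s\<close> by an edge of the Bruhat-Tits tree.\<close>

definition quartet :: "'a P1 \<Rightarrow> 'a P1 \<Rightarrow> 'a P1 \<Rightarrow> 'a P1 \<Rightarrow> bool" where
  "quartet p q r s \<longleftrightarrow>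
    v (det2 (coords p) (coords r)) + v (det2 (coords q) (coords s)) <
    v (det2 (coords p) (coords q)) + v (det2 (coords r) (coords s))"

text \<open>Each of the four points occurs once on either side of the inequality, so the scalars
  \<open>k\<close> cancel, and so does the determinant, which occurs twice on each side.\<close>

lemma quartet_PGL2:
  assumes h: "h \<in> carrier PGL2" and d: "p \<noteq> q" "r \<noteq> s" "p \<noteq> r" "q \<noteq> s"
  shows "quartet (h p) (h q) (h r) (h s) \<longleftrightarrow> quartet p q r s"
proof -
  obtain k d where k: "d \<noteq> 0" "\<And>p. k p \<noteq> 0"
    "\<And>p q. det2 (coords (h p)) (coords (h q)) * (k p * k q) = d * det2 (coords p) (coords q)"
    using PGL2_coords[OF h] by blast
  have "v (det2 (coords (h p)) (coords (h q))) = v d + v (det2 (coords p) (coords q)) - v (k p) - v (k q)"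
    if "p \<noteq> q" for p q
  proof -
    have "h p \<noteq> h q" using PGL2_inj[OF h] that by (simp add: inj_eq)
    then have nz: "det2 (coords (h p)) (coords (h q)) \<noteq> 0" "det2 (coords p) (coords q) \<noteq> 0"
      using that by (simp_all add: det2_coords_eq_0_iff)
    have kk: "k p * k q \<noteq> 0" "v (k p * k q) = v (k p) + v (k q)" using k(2) by (simp_all add: v_mult)
    have "v (det2 (coords (h p)) (coords (h q)) * (k p * k q)) = v (d * det2 (coords p) (coords q))"
      by (simp only: k(3))
    then show ?thesis unfolding v_mult[OF nz(1) kk(1)] v_mult[OF k(1) nz(2)] kk(2) by simp
  qed
  note this[OF d(1)] this[OF d(2)] this[OF d(3)] this[OF d(4)]
  then show ?thesis unfolding quartet_def by linarith
qed

lemma clusterE: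
  assumes "C \<in> clusters v A"
  obtains c n where "C = A \<inter> Fin ` disc v c n" "C \<noteq> {}"
  using assms unfolding clusters_def by blast

lemma clusterI:
  assumes "A = insert Infty (Fin ` X)" "{y \<in> X. vge (y - c) n} \<noteq> {}"
  shows "Fin ` {y \<in> X. vge (y - c) n} \<in> clusters v A"
proof -
  have "Fin ` {y \<in> X. vge (y - c) n} = A \<inter> Fin ` disc v c n" using assms(1) by auto
  then show ?thesis using assms(2) unfolding clusters_def by blast
qed

text \<open>Every point of an ultrametric disc is a centre, so clusters can be enumerated with
  centres taken from the set itself.\<close>

lemma cluster_around_point:
  assumes C: "C \<in> clusters v A" and A: "A = insert Infty (Fin ` X)"
  shows "\<exists>x\<in>X. \<exists>n. C = Fin ` {y \<in> X. y = x \<or> n \<le> v (y - x)}"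
proof -
  obtain c n where Ceq: "C = A \<inter> Fin ` disc v c n" and ne: "C \<noteq> {}" using C by (rule clusterE)
  then obtain x where x: "x \<in> X" "vge (x - c) n" using A by auto
  have "vge (y - c) n \<longleftrightarrow> y = x \<or> n \<le> v (y - x)" for y
    using vge_trans[OF _ x(2), of y] vge_diff[OF _ x(2), of "y - c"] by (auto simp: vge_def)
  then have "C = Fin ` {y \<in> X. y = x \<or> n \<le> v (y - x)}" using Ceq A by auto
  then show ?thesis using x(1) by blast
qed

text \<open>A finite point outside the disc is equally far from \<open>p\<close> and
  \<open>q\<close>, and farther than these are from each other; the bracket of \<open>r\<close> and
  \<open>s\<close> is bounded by the ultrametric inequality. Brackets of finite points with
  \<open>Infty\<close> are units.\<close>

lemma quartet_cluster:
  assumes C: "C \<in> clusters v A" and pq: "p \<in> C" "q \<in> C" "p \<noteq> q"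
    and rs: "r \<in> A - C" "s \<in> A - C" "r \<noteq> s"
  shows "quartet p q r s"
proof -
  obtain c n where Ceq: "C = A \<inter> Fin ` disc v c n" using C by (rule clusterE)
  obtain x y where x: "p = Fin x" "vge (x - c) n" and y: "q = Fin y" "vge (y - c) n"
    using pq(1,2) Ceq by auto
  have xy: "x \<noteq> y" "n \<le> v (x - y)"
    using pq(3) x y vge_diff[OF x(2) y(2)] by (auto simp: vge_def)
  have out: "z \<noteq> x \<and> v (x - z) < n \<and> v (y - z) = v (x - z)" if "Fin z \<in> A - C" for z
  proof -
    have z: "\<not> vge (z - c) n" using that Ceq by auto
    have "\<not> vge (z - x) n" using z vge_trans[OF _ x(2), of z] by blast
    then have zx: "z \<noteq> x" "v (x - z) < n" using v_diff_commute[of x z] by (auto simp: not_vge)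
    have "vge (x - y) (v (z - x) + 1)" using xy zx v_diff_commute[of x z] by (simp add: vge_def)
    from v_ultra(2)[OF zx(1) this] show ?thesis
      using zx v_diff_commute[of x z] v_diff_commute[of y z] by simp
  qed
  show ?thesis
  proof (cases r)
    case Infty
    then obtain w where w: "s = Fin w" using rs(3) by (cases s) auto
    show ?thesis using out[of w] rs(2) xy(2) by (simp add: quartet_def x(1) y(1) Infty w det2_def)
  next
    case r: (Fin z)
    show ?thesis
    proof (cases s)
      case Infty
      show ?thesis using out[of z] rs(1) xy(2) by (simp add: quartet_def x(1) y(1) Infty r det2_def)
    next
      case s: (Fin w)
      have zw: "z \<noteq> w" using rs(3) r s by simp
      note o = out[OF rs(1)[unfolded r]] out[OF rs(2)[unfolded s]]
      have "vge ((x - w) - (x - z)) (min (v (x - z)) (v (x - w)))"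
        by (rule vge_diff) (simp_all add: vge_def)
      then have "min (v (x - z)) (v (x - w)) \<le> v (z - w)" using zw by (simp add: vge_def)
      then have "v (x - z) + v (x - w) < v (x - y) + v (z - w)" using o xy(2) by linarith
      then show ?thesis using o by (simp add: quartet_def x(1) y(1) r s det2_def)
    qed
  qed
qed

end

lemma Collect_mem_insert_if: "{y \<in> insert x X. P y} = (if P x then insert x {y \<in> X. P y} else {y \<in> X. P y})"
  by auto

section \<open>The two families of examples\<close>

text \<open>Lets numerals be compared by simplification. Naturals m, n with the same residue modulo
  3^(m + n) are equal, both being smaller than the modulus.\<close>

instance q3z :: field_char_0
proof
  show "inj (of_nat :: nat \<Rightarrow> q3z)"
  proof (rule injI)
    fix m n :: nat assume "(of_nat m :: q3z) = of_nat n"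
    then have "emb (of_nat m) = emb (of_nat n)"
      using of_int_q3z[of "int m"] of_int_q3z[of "int n"] by simp
    then have e: "Rep_z3 (of_nat m) (m + n) = Rep_z3 (of_nat n) (m + n)"
      unfolding emb_simps(7) by simp
    have "k < 3 ^ k" for k :: nat by (rule less_exp[THEN less_le_trans]) (simp add: power_mono)
    then have "k < 3 ^ (k + l)" for k l :: nat
      by (rule less_le_trans) (simp add: power_add)
    from this[of m n] this[of n m] have "int m < int (3 ^ (m + n))" "int n < int (3 ^ (n + m))"
      by (simp_all only: of_nat_less_iff)
    then show "m = n" using e by (simp add: Rep_z3_of_nat add.commute)
  qed
qed

lemma val_numerals [simp]:
  "val 2 = 0" "val 3 = 2" "val 4 = 0" "val 6 = 2" "val 8 = 0" "val 9 = 4" "val 10 = 0" "val 11 = 0" "val 12 = 2"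
  "val 18 = 4" "val 21 = 2" "val 24 = 2" "val 26 = 0" "val 27 = 6" "val 36 = 4" "val 54 = 6" "val 81 = 8"
  using val_eq(2)[of 2 2 0] val_eq(2)[of 3 1 1] val_eq(2)[of 4 4 0] val_eq(2)[of 6 2 1] val_eq(2)[of 8 8 0]
    val_eq(2)[of 9 1 2] val_eq(2)[of 10 10 0] val_eq(2)[of 11 11 0] val_eq(2)[of 12 4 1] val_eq(2)[of 18 2 2]
    val_eq(2)[of 21 7 1] val_eq(2)[of 24 8 1] val_eq(2)[of 26 26 0] val_eq(2)[of 27 1 3]
    val_eq(2)[of 36 4 2] val_eq(2)[of 54 2 3] val_eq(2)[of 81 1 4]
  by simp_all

definition \<alpha>2 :: "nat \<Rightarrow> q3z" where
  "\<alpha>2 i = (if i = 0 then - 9 else if i = 1 then 3 else 1)"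

definition \<beta>2 :: "nat \<Rightarrow> q3z" where
  "\<beta>2 i = (if i = 0 then 9 else 12)"

text \<open>The base point -3 differs from -9 and from 3 by valuation 2, whereas the discs of pairs
  0 and 1 have valuation radius 4; it also lies in the maximal ideal, outside the set of pair
  2.\<close>

interpretation E: twisted_configuration val 2 \<alpha>2 \<beta>2 "- 3"
proof unfold_locales
  show "\<alpha>2 2 = 1" by (simp add: \<alpha>2_def)
  show "\<alpha>2 i \<noteq> \<beta>2 i" if "i \<le> 2" "i \<noteq> 2" for i
    using that by (auto simp: \<alpha>2_def \<beta>2_def)
  show "q3z.vge (\<alpha>2 i) 1" if "i \<le> 2" "i \<noteq> 2" for i
    using that by (auto simp: \<alpha>2_def q3z.vge_def)
  show "1 \<le> val (\<beta>2 i - \<alpha>2 i)" if "i \<le> 2" "i \<noteq> 2" for i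
    using that by (auto simp: \<alpha>2_def \<beta>2_def)
  show "\<not> q3z.vge (\<alpha>2 i - \<alpha>2 j) (val (\<beta>2 i - \<alpha>2 i))"
    if "i \<le> 2" "j \<le> 2" "i \<noteq> 2" "j \<noteq> 2" "i \<noteq> j" for i j
    using that by (auto simp: \<alpha>2_def \<beta>2_def q3z.vge_def)
  show "q3z.vge (- 3) 1" by (simp add: q3z.vge_def)
  show "\<not> q3z.vge (- 3 - \<alpha>2 i) (val (\<beta>2 i - \<alpha>2 i))" if "i \<le> 2" "i \<noteq> 2" for i
    using that by (auto simp: \<alpha>2_def \<beta>2_def q3z.vge_def)
qed simp_all

text \<open>Pairs 0 and 1 are those of genus two multiplied by 3, which raises the valuation of
  \<open>\<alpha>g 1 - \<alpha>g 0\<close> from 2 to 4. The pairs from 3 on sit near 3, at valuation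
  2 from pairs 0 and 1 and thus remote. The powers 3^i keep them apart: centres i and j differ by
  valuation 2 min(i, j), while pair i has radius 2 (i + 1).\<close>

definition \<alpha>g :: "nat \<Rightarrow> q3z" where
  "\<alpha>g i = (if i = 0 then - 27 else if i = 1 then 9 else if i = 2 then 1 else 3 + 3 ^ i)"

definition \<beta>g :: "nat \<Rightarrow> q3z" where
  "\<beta>g i = (if i = 0 then 27 else if i = 1 then 36 else 3 + 4 * 3 ^ i)"

lemma val_three_power_diff:
  assumes "i < j"
  shows "(3 :: q3z) ^ i \<noteq> 3 ^ j" "val (3 ^ i - 3 ^ j) = 2 * int i" "val (3 ^ j - 3 ^ i) = 2 * int i"
proof -
  obtain d where d: "j = i + Suc d" using assms by (metis add_Suc_right less_iff_Suc_add)
  have "\<not> 3 dvd 1 - 3 * x" for x :: int by presburger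
  from this[of "3 ^ d"] have *: "\<not> (3 :: int) dvd 1 - 3 ^ Suc d" by simp
  have e: "(3 :: q3z) ^ i - 3 ^ j = of_int (1 - 3 ^ Suc d) * 3 ^ i"
    by (simp add: d power_add algebra_simps)
  show "(3 :: q3z) ^ i \<noteq> 3 ^ j" using val_eq(1)[OF e *] by auto
  show "val (3 ^ i - 3 ^ j) = 2 * int i" by (rule val_eq(2)[OF e *])
  then show "val (3 ^ j - 3 ^ i) = 2 * int i" by (simp only: q3z.v_diff_commute)
qed

text \<open>Meant for differences such as 30 + 3^i: the power is divisible by 9, so the single
  factor 3 of the first term decides.\<close>

lemma val_extra:
  assumes "3 \<le> i" "\<not> 3 dvd k"
  shows "of_int (3 * k) + of_int l * 3 ^ i \<noteq> (0 :: q3z)" "val (of_int (3 * k) + of_int l * 3 ^ i) = 2"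
proof -
  obtain d where d: "i = Suc (Suc d)" using assms(1) by (metis add_2_eq_Suc le_Suc_ex numeral_3_eq_3 add_Suc)
  have "\<not> 3 dvd k + 3 * x" for x :: int using assms(2) by presburger
  from this[of "l * 3 ^ d"] have *: "\<not> 3 dvd k + 3 * (l * 3 ^ d)" .
  have e: "of_int (3 * k) + of_int l * 3 ^ i = (of_int (k + 3 * (l * 3 ^ d)) :: q3z) * 3 ^ 1"
    by (simp add: d algebra_simps)
  show "of_int (3 * k) + of_int l * 3 ^ i \<noteq> (0 :: q3z)" "val (of_int (3 * k) + of_int l * 3 ^ i) = 2"
    using val_eq[OF e *] by simp_all
qed

lemma twisted_configuration_general:
  assumes "2 \<le> g"
  shows "twisted_configuration val g \<alpha>g \<beta>g (- 3)"
proof unfold_locales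
  have radius: "\<beta>g i - \<alpha>g i = 3 ^ Suc i" if "3 \<le> i" for i
    using that by (simp add: \<alpha>g_def \<beta>g_def)
  have val_pow: "val (3 ^ n) = 2 * int n" for n using val_eq(2)[of "3 ^ n" 1 n] by simp
  have cases: "i = 0 \<or> i = 1 \<or> 3 \<le> i" if "i \<noteq> 2" for i :: nat using that by auto
  have diff: "\<alpha>g i = 3 + 3 ^ i" "\<beta>g i = 3 + 4 * 3 ^ i" if "3 \<le> i" for i
    using that by (simp_all add: \<alpha>g_def \<beta>g_def)
  have vals: "\<alpha>g i \<noteq> 0" "val (\<alpha>g i) = 2" "val (\<alpha>g i - \<alpha>g 0) = 2" "val (\<beta>g i - \<alpha>g 0) = 2"
    "\<alpha>g i - \<alpha>g 0 \<noteq> 0" "\<alpha>g i - \<alpha>g 1 \<noteq> 0" "val (\<alpha>g i - \<alpha>g 1) = 2" "- 3 - \<alpha>g i \<noteq> 0" "val (- 3 - \<alpha>g i) = 2"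
    if "3 \<le> i" for i
    \<comment> \<open>In this order: \<open>\<alpha>g i\<close>,
      \<open>\<alpha>g i - \<alpha>g 0\<close>, \<open>\<beta>g i - \<alpha>g 0\<close>,
      \<open>\<alpha>g i - \<alpha>g 1\<close> and \<open>- 3 - \<alpha>g i\<close>.\<close>
    using val_extra[OF that, of 1 1] val_extra[OF that, of 10 1] val_extra[OF that, of 10 4]
      val_extra[OF that, of "- 2" 1] val_extra[OF that, of "- 2" "- 1"]
    unfolding diff[OF that] by (simp_all add: \<alpha>g_def algebra_simps)
  show "2 \<le> g" by fact
  show "\<alpha>g 2 = 1" by (simp add: \<alpha>g_def)
  show "\<alpha>g i \<noteq> \<beta>g i" if "i \<le> g" "i \<noteq> 2" for i
    using cases[OF that(2)] radius[of i] by (auto simp: \<alpha>g_def \<beta>g_def)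
  show "q3z.vge (\<alpha>g i) 1" if "i \<le> g" "i \<noteq> 2" for i
    using cases[OF that(2)]
  proof (elim disjE)
    assume "3 \<le> i"
    then show ?thesis using vals(2) by (simp add: q3z.vge_def)
  qed (simp_all add: \<alpha>g_def q3z.vge_def)
  have r: "val (\<beta>g i - \<alpha>g i) = (if 3 \<le> i then 2 * int (Suc i) else 6)" if "i \<noteq> 2" for i
    using cases[OF that]
  proof (elim disjE)
    assume "3 \<le> i"
    then show ?thesis using val_pow[of "Suc i"] unfolding radius[OF \<open>3 \<le> i\<close>] by simp
  qed (simp_all add: \<alpha>g_def \<beta>g_def)
  show "1 \<le> val (\<beta>g i - \<alpha>g i)" if "i \<le> g" "i \<noteq> 2" for i
    using r[OF that(2)] by simp
  show "\<not> q3z.vge (\<alpha>g i - \<alpha>g j) (val (\<beta>g i - \<alpha>g i))"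
    if ij: "i \<le> g" "j \<le> g" "i \<noteq> 2" "j \<noteq> 2" "i \<noteq> j" for i j
  proof -
    consider "i \<in> {0, 1}" "j \<in> {0, 1}" | "3 \<le> i" "j \<in> {0, 1}" | "i \<in> {0, 1}" "3 \<le> j"
      | "3 \<le> i" "3 \<le> j" "i < j" | "3 \<le> i" "3 \<le> j" "j < i"
      using cases[OF ij(3)] cases[OF ij(4)] ij(5) by fastforce
    then have "\<alpha>g i - \<alpha>g j \<noteq> 0 \<and> val (\<alpha>g i - \<alpha>g j) < val (\<beta>g i - \<alpha>g i)"
    proof cases
      case 1
      then show ?thesis using ij(5) by (auto simp: \<alpha>g_def \<beta>g_def)
    next
      case 2
      then show ?thesis using vals(3,5,6,7)[OF 2(1)] r[OF ij(3)] by auto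
    next
      case 3
      then show ?thesis
        using vals(3,5,6,7)[OF 3(2)] r[OF ij(3)] q3z.v_diff_commute[of "\<alpha>g i" "\<alpha>g j"] by auto
    next
      case 4
      then show ?thesis using val_three_power_diff[OF 4(3)] r[OF ij(3)] by (simp add: diff)
    next
      case 5
      then show ?thesis using val_three_power_diff[OF 5(3)] r[OF ij(3)] by (simp add: diff)
    qed
    then show ?thesis by (simp add: q3z.not_vge)
  qed
  show "q3z.vge (- 3) 1" by (simp add: q3z.vge_def)
  show "\<not> q3z.vge (- 3 - \<alpha>g i) (val (\<beta>g i - \<alpha>g i))" if "i \<le> g" "i \<noteq> 2" for i
    using cases[OF that(2)]
  proof (elim disjE)
    assume "3 \<le> i"
    then show ?thesis using vals(8,9) r[OF that(2)] by (simp add: q3z.not_vge)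
  qed (simp_all add: \<alpha>g_def \<beta>g_def q3z.vge_def)
  show "val (\<alpha>g i - \<alpha>g 0) < val (\<alpha>g 1 - \<alpha>g 0) \<and> val (\<beta>g i - \<alpha>g 0) < val (\<alpha>g 1 - \<alpha>g 0)"
    if "3 \<le> i" "i \<le> g" for i
  proof -
    have "\<alpha>g 1 - \<alpha>g 0 = 36" by (simp add: \<alpha>g_def)
    then show ?thesis using vals(3,4)[OF that(1)] by simp
  qed
qed

lemma positions_differ_in_every_genus:
  assumes "2 \<le> g"
  shows "\<exists>(T :: q3z P1 set) T' H H0.
    card T = 2 * g + 2 \<and> card T' = 2 * g + 2 \<and>
    superelliptic_inducing val g T H H0 \<and> superelliptic_inducing val g T' H H0 \<and>
    H \<lhd> PGL2\<lparr>carrier := H0\<rparr> \<and>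
    (\<forall>\<psi>. bij_betw \<psi> T T' \<longrightarrow> \<not> same_position val T T' \<psi>)"
proof -
  interpret F: twisted_configuration val g \<alpha>g \<beta>g "- 3"
    by (rule twisted_configuration_general[OF assms])
  have "superelliptic_inducing val g (pair_set g F.a F.b) (Gamma g F.s) (Gamma0 g F.s)"
    unfolding superelliptic_inducing_def using F.superelliptic[OF compact_P1] by blast
  moreover have "superelliptic_inducing val g (pair_set g F.a' F.b') (Gamma g F.s) (Gamma0 g F.s)"
    unfolding superelliptic_inducing_def
    using F.superelliptic'[OF compact_P1] F.Gamma_s' F.Gamma0_s' by blast
  moreover have "\<not> same_position val (pair_set g F.a F.b) (pair_set g F.a' F.b') \<psi>" for \<psi>
    using F.card_tree_verts_less by (intro not_same_position) simp
  ultimately show ?thesis using F.card_pair_set F.card_pair_set' F.Gamma_normal by blast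
qed

subsection \<open>The example of genus two\<close>

lemma atMost_2: "{..2 :: nat} = {0, 1, 2}"
  by auto

definition S2 :: "q3z P1 set" where "S2 = {Fin (- 9), Fin 9, Fin 3, Fin 12, Fin 1, Infty}"

definition S2' :: "q3z P1 set" where "S2' = {Fin (- 9), Fin 9, Fin 27, Fin (27 / 4), Fin 1, Infty}"

lemma val_fractions [simp]:
  "val (27 / 4) = 6" "val (63 / 4) = 4" "val (9 / 4) = 4" "val (81 / 4) = 8" "val (23 / 4) = 0"
proof -
  have "val 63 = 4" "val 23 = 0" using val_eq(2)[of 63 7 2] val_eq(2)[of 23 23 0] by simp_all
  then show "val (27 / 4) = 6" "val (63 / 4) = 4" "val (9 / 4) = 4" "val (81 / 4) = 8" "val (23 / 4) = 0"
    by (simp_all add: q3z.v_divide)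
qed

lemma E_points:
  "E.a 0 = Fin (- 9)" "E.a 1 = Fin 3" "E.a 2 = Fin 1" "E.b 0 = Fin 9" "E.b 1 = Fin 12" "E.b 2 = Infty"
  by (simp_all add: E.a_def E.b_def \<alpha>2_def \<beta>2_def)

lemma E_s_0: "E.s 0 = mobius 0 81 1 0"
proof -
  have "E.s 0 = mobius (2 * 0) (2 * 81) (2 * 1) (2 * 0)"
    by (simp add: E.s_def \<alpha>2_def \<beta>2_def pair_involution_def)
  then show ?thesis using mobius_scale[of "2 :: q3z" 0 81 1 0] by simp
qed

lemma E_twisted_points:
  "E.a' 0 = Fin (- 9)" "E.a' 1 = Fin 27" "E.a' 2 = Fin 1"
  "E.b' 0 = Fin 9" "E.b' 1 = Fin (27 / 4)" "E.b' 2 = Infty"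
  by (simp_all add: E.a'_def E.b'_def E_points E_points(2,5)[unfolded One_nat_def] E_s_0)

lemma E_pair_set: "pair_set 2 E.a E.b = S2" "pair_set 2 E.a' E.b' = S2'"
  unfolding pair_set_def atMost_2 S2_def S2'_def image_insert image_empty E_points E_twisted_points
  by auto

lemma card_S2: "card S2 = 6" "card S2' = 6"
  using E.card_pair_set E.card_pair_set' by (simp_all add: E_pair_set)

lemma limit_points_S2: "S2 \<inter> limit_points val (Gamma0 2 E.s) = {}"
  using E.limit_points_Gamma0 unfolding E_pair_set(1)[symmetric] pair_set_def by auto

text \<open>The two new points are images of non-limit points under \<open>E.s 0\<close>, a
  continuous involution in the group; were they limit points, the originals would be too.\<close>

lemma limit_points_S2': "S2' \<inter> limit_points val (Gamma0 2 E.s) = {}"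
proof -
  let ?L = "limit_points val (Gamma0 2 E.s)"
  have s0: "E.s 0 \<in> Gamma0 2 E.s"
    unfolding Gamma0_def by (rule generate.incl) simp
  have "E.s 0 x \<notin> ?L" if x: "x \<in> {E.a 1, E.b 1}" for x
  proof
    assume "E.s 0 x \<in> ?L"
    then have "E.s 0 (E.s 0 x) \<in> ?L"
    proof (rule q3z.limit_points_continuous_image[rotated 3])
      show "E.s 0 \<in> carrier PGL2" by (rule E.s_in) simp
      show "continuous_map (P1_topology val) (P1_topology val) (E.s 0)"
        unfolding E_s_0 by (rule q3z.continuous_inversion) simp
      show "E.s 0 \<circ> h \<in> Gamma0 2 E.s" if "h \<in> Gamma0 2 E.s" for h
        using subgroup.m_closed[OF E.Gamma0_subgroup s0 that] unfolding PGL2_simps .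
    qed
    then have "x \<in> ?L" by simp
    then show False using E.limit_points_Gamma0[of 1 x] x by simp
  qed
  from this[of "E.a 1"] this[of "E.b 1"] have "Fin 27 \<notin> ?L" "Fin (27 / 4) \<notin> ?L"
    by (simp_all add: E_points(2,5)[unfolded One_nat_def] E_s_0)
  moreover have "p \<notin> ?L" if "p \<in> S2" for p using limit_points_S2 that by blast
  ultimately show ?thesis unfolding S2'_def S2_def by auto
qed

lemma even_clusters_S2:
  "{\<s> \<in> clusters val S2. even (card \<s>)} =
    {Fin ` {- 9, 9, 3, 12}, Fin ` {- 9, 9}, Fin ` {3, 12}}" (is "?L = ?R")
proof
  let ?X = "{- 9, 9, 3, 12, 1} :: q3z set"
  have eq: "S2 = insert Infty (Fin ` ?X)" unfolding S2_def by auto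
  show "?L \<subseteq> ?R"
  proof
    fix C assume "C \<in> ?L"
    then have C: "C \<in> clusters val S2" "even (card C)" by auto
    from q3z.cluster_around_point[OF C(1) eq]
    obtain x n where x: "x \<in> ?X" "C = Fin ` {y \<in> ?X. y = x \<or> n \<le> val (y - x)}" by blast
    \<comment> \<open>Differences of points of \<open>?X\<close> have valuation 0, 2 or 4, so the
      cluster can change only where \<open>n\<close> passes one of these values.\<close>
    consider "n \<le> 0" | "0 < n" "n \<le> 2" | "2 < n" "n \<le> 4" | "4 < n" "n \<le> 8" | "8 < n" by linarith
    then show "C \<in> ?R"
      using C(2) x unfolding Collect_mem_insert_if
      by cases (elim insertE emptyE; simp add: insert_commute)+
  qed
  note cl = q3z.clusterI[OF eq]
  show "?R \<subseteq> ?L"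
    using cl[of 0 2] cl[of 9 4] cl[of 3 4]
    unfolding Collect_mem_insert_if by (simp add: q3z.vge_def)
qed

lemma even_clusters_S2':
  "{\<s> \<in> clusters val S2'. even (card \<s>)} =
    {Fin ` {- 9, 9, 27, 27 / 4}, Fin ` {27, 27 / 4}}" (is "?L = ?R")
proof
  let ?X = "{- 9, 9, 27, 27 / 4, 1} :: q3z set"
  have eq: "S2' = insert Infty (Fin ` ?X)" unfolding S2'_def by auto
  show "?L \<subseteq> ?R"
  proof
    fix C assume "C \<in> ?L"
    then have C: "C \<in> clusters val S2'" "even (card C)" by auto
    from q3z.cluster_around_point[OF C(1) eq]
    obtain x n where x: "x \<in> ?X" "C = Fin ` {y \<in> ?X. y = x \<or> n \<le> val (y - x)}" by blast
    \<comment> \<open>Here the differences have valuation 0, 4 or 8.\<close>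
    consider "n \<le> 0" | "0 < n" "n \<le> 2" | "2 < n" "n \<le> 4" | "4 < n" "n \<le> 8" | "8 < n" by linarith
    then show "C \<in> ?R"
      using C(2) x unfolding Collect_mem_insert_if
      by cases (elim insertE emptyE; simp add: insert_commute)+
  qed
  note cl = q3z.clusterI[OF eq]
  show "?R \<subseteq> ?L"
    using cl[of 0 2] cl[of 27 5]
    unfolding Collect_mem_insert_if by (simp add: q3z.vge_def)
qed

text \<open>The points \<open>9, - 9, 27, 1\<close> leave one vertex of the tree in four different directions, so
  that no quartet separates them. Two of the four are paired up by any partition into pairs.\<close>

lemma no_quartet:
  assumes "p \<in> {Fin 9, Fin (- 9), Fin 27, Fin 1}" "q \<in> {Fin 9, Fin (- 9), Fin 27, Fin 1}"
    "r \<in> {Fin 9, Fin (- 9), Fin 27, Fin 1}" "s \<in> {Fin 9, Fin (- 9), Fin 27, Fin 1}"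
    "distinct [p, q, r, s]"
  shows "\<not> q3z.quartet p q r s"
  using assms by (auto simp: q3z.quartet_def det2_def)

text \<open>Pulled back along the alleged bijection, two of the four points of \<open>?Q\<close>
  land in the same pair of \<open>S2\<close>, which a cluster separates from the other two. The
  separation survives the return through \<sigma> and contradicts \<open>no_quartet\<close>. The
  bijection is arbitrary, so \<phi> is covered as a special case.\<close>

lemma different_cluster_data:
  assumes \<sigma>: "\<sigma> \<in> carrier PGL2"
  shows "\<not> same_cluster_data val S2 (\<sigma> ` S2')"
proof
  let ?A = "\<sigma> ` S2'" and ?Q = "{Fin 9, Fin (- 9), Fin 27, Fin (1 :: q3z)}"
  assume "same_cluster_data val S2 ?A"
  then obtain \<psi> where \<psi>: "bij_betw \<psi> S2 ?A" "bij_betw ((`) \<psi>) (clusters val S2) (clusters val ?A)"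
    unfolding same_cluster_data_def by blast
  define \<theta> where "\<theta> = inv_into S2 \<psi>"
  have \<theta>: "\<theta> y \<in> S2" "\<psi> (\<theta> y) = y" if "y \<in> ?A" for y
    using that \<psi>(1) unfolding \<theta>_def
    by (auto simp: bij_betw_def inv_into_into f_inv_into_f)
  have inj: "inj_on \<psi> S2" using \<psi>(1) by (simp add: bij_betw_def)
  have cl: "\<psi> ` C \<in> clusters val ?A" if "C \<in> {Fin ` {- 9, 9, 3, 12}, Fin ` {- 9, 9}, Fin ` {3, 12}}" for C
  proof -
    have "C \<in> clusters val S2" using that even_clusters_S2 by blast
    then show ?thesis using \<psi>(2) unfolding bij_betw_def by blast
  qed
  \<comment> \<open>Numbers the pairs {-9, 9}, {3, 12} and {1, infinity} of \<open>S2\<close>; each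
    is a cluster or the complement of one.\<close>
  define k where "k p = (if p \<in> {Fin (- 9), Fin 9} then 0 else if p \<in> {Fin 3, Fin 12} then 1 else (2 :: nat))"
    for p :: "q3z P1"
  have k: "k p = 0 \<Longrightarrow> p \<in> {Fin (- 9), Fin 9}" "k p = 1 \<Longrightarrow> p \<in> {Fin 3, Fin 12}"
    "k p = 2 \<Longrightarrow> p \<notin> Fin ` {- 9, 9, 3, 12}" "k p = 0 \<or> k p = 1 \<or> k p = 2" for p
    unfolding k_def image_insert image_empty
    by (cases "p \<in> {Fin (- 9), Fin 9}"; cases "p \<in> {Fin 3, Fin 12}"; simp)+
  have QA: "\<sigma> u \<in> ?A" if "u \<in> ?Q" for u using that unfolding S2'_def by auto
  have "card ((\<lambda>u. k (\<theta> (\<sigma> u))) ` ?Q) \<le> card {0, 1, 2 :: nat}"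
    by (rule card_mono) (auto simp: k_def)
  also have "\<dots> < card ?Q" by simp
  finally have "\<not> inj_on (\<lambda>u. k (\<theta> (\<sigma> u))) ?Q" by (rule pigeonhole)
  then obtain u u' where u: "u \<in> ?Q" "u' \<in> ?Q" "u \<noteq> u'" "k (\<theta> (\<sigma> u)) = k (\<theta> (\<sigma> u'))"
    unfolding inj_on_def by blast
  have "card (?Q - {u, u'}) = 2" using u by (subst card_Diff_subset) auto
  then obtain z w where zw: "?Q - {u, u'} = {z, w}" "z \<noteq> w" by (auto simp: card_2_iff)
  have zw': "z \<in> ?Q" "w \<in> ?Q" "z \<notin> {u, u'}" "w \<notin> {u, u'}" using zw(1) by blast+
  define t where "t x = \<theta> (\<sigma> x)" for x
  have t: "t x \<in> S2" "\<psi> (t x) = \<sigma> x" if "x \<in> ?Q" for x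
    using \<theta>[OF QA[OF that]] by (simp_all add: t_def)
  have t_inj: "t x \<noteq> t y" if "x \<in> ?Q" "y \<in> ?Q" "x \<noteq> y" for x y
    using t(2)[OF that(1)] t(2)[OF that(2)] that(3) PGL2_inj[OF \<sigma>] by (metis inj_eq)
  note tu = t(1)[OF u(1)] t(1)[OF u(2)] t(1)[OF zw'(1)] t(1)[OF zw'(2)]
  have ne: "t u \<noteq> t u'" "t z \<noteq> t u" "t z \<noteq> t u'" "t w \<noteq> t u" "t w \<noteq> t u'" "t z \<noteq> t w"
    using t_inj u zw' zw(2) by blast+
  have mem: "\<sigma> x \<in> \<psi> ` C \<longleftrightarrow> t x \<in> C" if "x \<in> ?Q" "C \<subseteq> S2" for x C
    using inj_on_image_mem_iff[OF inj t(1)[OF that(1)] that(2)] t(2)[OF that(1)] by simp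
  have sub: "Fin ` {- 9, 9, 3, 12} \<subseteq> S2" "Fin ` {- 9, 9} \<subseteq> S2" "Fin ` {3, 12} \<subseteq> S2"
    by (auto simp: S2_def)
  have \<sigma>_inj: "\<sigma> x \<noteq> \<sigma> y" if "x \<noteq> y" for x y
    using that PGL2_inj[OF \<sigma>] by (simp add: inj_eq)
  have quartet: "q3z.quartet x y x' y'"
    if C: "C \<in> {Fin ` {- 9, 9, 3, 12}, Fin ` {- 9, 9}, Fin ` {3, 12}}"
      and Q: "x \<in> ?Q" "y \<in> ?Q" "x' \<in> ?Q" "y' \<in> ?Q" "x \<noteq> y" "x' \<noteq> y'" "x \<noteq> x'" "y \<noteq> y'"
      and mem': "t x \<in> C" "t y \<in> C" "t x' \<notin> C" "t y' \<notin> C" for x y x' y' C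
  proof -
    have CS: "C \<subseteq> S2" using C sub by blast
    have "q3z.quartet (\<sigma> x) (\<sigma> y) (\<sigma> x') (\<sigma> y')"
    proof (rule q3z.quartet_cluster[OF cl[OF C]])
      show "\<sigma> x \<in> \<psi> ` C" "\<sigma> y \<in> \<psi> ` C"
        using mem[OF Q(1) CS] mem[OF Q(2) CS] mem'(1,2) by simp_all
      show "\<sigma> x' \<in> ?A - \<psi> ` C" "\<sigma> y' \<in> ?A - \<psi> ` C"
        using mem[OF Q(3) CS] mem[OF Q(4) CS] mem'(3,4) QA[OF Q(3)] QA[OF Q(4)] by blast+
      show "\<sigma> x \<noteq> \<sigma> y" "\<sigma> x' \<noteq> \<sigma> y'" using \<sigma>_inj Q(5,6) by blast+
    qed
    then show ?thesis using q3z.quartet_PGL2[OF \<sigma> Q(5-8)] by blast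
  qed
  consider "k (t u) = 0" "k (t u') = 0" | "k (t u) = 1" "k (t u') = 1" | "k (t u) = 2" "k (t u') = 2"
    using u(4) k(4)[of "t u"] by (auto simp: t_def)
  then have "q3z.quartet u u' z w \<or> q3z.quartet z w u u'"
  proof cases
    case 1
    then have "{t u, t u'} \<subseteq> {Fin (- 9), Fin 9}" using k(1) by blast
    then have *: "{t u, t u'} = Fin ` {- 9, 9}" using ne(1) by auto
    show ?thesis
      using quartet[of "Fin ` {- 9, 9}" u u' z w] u zw' zw(2) ne unfolding *[symmetric] by blast
  next
    case 2
    then have "{t u, t u'} \<subseteq> {Fin 3, Fin 12}" using k(2) by blast
    then have *: "{t u, t u'} = Fin ` {3, 12}" using ne(1) by auto
    show ?thesis
      using quartet[of "Fin ` {3, 12}" u u' z w] u zw' zw(2) ne unfolding *[symmetric] by blast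
  next
    case 3
    \<comment> \<open>The pair {1, infinity} is the complement of the cluster of four. So the two
      other points lie in the cluster, and the two pairs exchange their roles.\<close>
    then have not: "t u \<notin> Fin ` {- 9, 9, 3, 12}" "t u' \<notin> Fin ` {- 9, 9, 3, 12}" using k(3) by blast+
    then have "{t u, t u'} \<subseteq> {Fin 1, Infty}"
      using tu(1,2) unfolding S2_def image_insert image_empty by blast
    then have *: "{t u, t u'} = {Fin 1, Infty}" using ne(1) by auto
    have "t z \<in> Fin ` {- 9, 9, 3, 12}" "t w \<in> Fin ` {- 9, 9, 3, 12}"
    proof -
      have "t z \<notin> {Fin 1, Infty}" "t w \<notin> {Fin 1, Infty}" unfolding *[symmetric] using ne by blast+
      then show "t z \<in> Fin ` {- 9, 9, 3, 12}" "t w \<in> Fin ` {- 9, 9, 3, 12}"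
        using tu(3,4) unfolding S2_def image_insert image_empty by blast+
    qed
    then show ?thesis
      using not quartet[of "Fin ` {- 9, 9, 3, 12}" z w u u'] u zw' zw(2) by blast
  qed
  moreover have "distinct [u, u', z, w]" "distinct [z, w, u, u']" using u(3) zw'(3,4) zw(2) by auto
  note no_quartet[OF u(1,2) zw'(1,2) this(1)] no_quartet[OF zw'(1,2) u(1,2) this(2)]
  ultimately show False by blast
qed

theorem mainTheorem3:
  fixes a b a' b' :: "nat \<Rightarrow> q3z P1"
    and s s' :: "nat \<Rightarrow> q3z P1 \<Rightarrow> q3z P1"
    and S S' :: "q3z P1 set"
    and \<phi> :: "q3z P1 \<Rightarrow> q3z P1"
  assumes a: "a = (!) [Fin (- 9), Fin 3, Fin 1]"
    and b: "b = (!) [Fin 9, Fin 12, Infty]"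
    and s: "s = (\<lambda>i. THE t. t \<in> fixing_involutions (a i) (b i))"
    and a': "a' = a(1 := s 0 (a 1))"
    and b': "b' = b(1 := s 0 (b 1))"
    and s': "s' = s(1 := s 0 \<circ> s 1 \<circ> s 0)"
    and S: "S = pair_set 2 a b"
    and S': "S' = pair_set 2 a' b'"
    and \<phi>: "\<forall>i\<le>2. \<phi> (a i) = a' i \<and> \<phi> (b i) = b' i"
  shows
    "(\<forall>g\<ge>2. \<exists>(T :: q3z P1 set) T' H H0.
        card T = 2 * g + 2 \<and> card T' = 2 * g + 2 \<and>
        superelliptic_inducing val g T H H0 \<and> superelliptic_inducing val g T' H H0 \<and>
        H \<lhd> PGL2\<lparr>carrier := H0\<rparr> \<and>
        (\<forall>\<psi>. bij_betw \<psi> T T' \<longrightarrow> \<not> same_position val T T' \<psi>)) \<and>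
     (S = {Fin (- 9), Fin 9, Fin 3, Fin 12, Fin 1, Infty}) \<and>
     (a' 1 = Fin 27) \<and>
     (b' 1 = Fin (27 / 4)) \<and>
     (S' = {Fin (- 9), Fin 9, Fin 27, Fin (27 / 4), Fin 1, Infty}) \<and>
     (card S = 6) \<and>
     (card S' = 6) \<and>
     (bij_betw \<phi> S S') \<and>
     (s 0 = mobius 0 81 1 0) \<and>
     (\<forall>i\<le>2. fixing_involutions (a i) (b i) = {s i}) \<and>
     (\<forall>i\<le>2. fixing_involutions (a' i) (b' i) = {s' i}) \<and>
     (Gamma 2 s = generate PGL2 {s 0 \<circ> s 1, s 0 \<circ> s 2}) \<and>
     (Gamma 2 s' = generate PGL2 {s' 0 \<circ> s' 1, s' 0 \<circ> s' 2}) \<and>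
     (generate PGL2 {s' 0 \<circ> s' 1, s' 0 \<circ> s' 2} =
      generate PGL2 {inv\<^bsub>PGL2\<^esub> (s 0 \<circ> s 1), s 0 \<circ> s 2}) \<and>
     (generate PGL2 {inv\<^bsub>PGL2\<^esub> (s 0 \<circ> s 1), s 0 \<circ> s 2} = Gamma 2 s) \<and>
     (Gamma0 2 s' = Gamma0 2 s) \<and>
     (Gamma 2 s \<lhd> PGL2\<lparr>carrier := Gamma0 2 s\<rparr>) \<and>
     (schottky val (Gamma 2 s)) \<and>
     (superelliptic_pairing val 2 a b s) \<and>
     (superelliptic_pairing val 2 a' b' s') \<and>
     (\<forall>z\<in>S. orb (Gamma0 2 s) (\<phi> z) = orb (Gamma0 2 s) z) \<and>
     (S \<inter> limit_points val (Gamma 2 s) = {}) \<and>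
     (S' \<inter> limit_points val (Gamma 2 s) = {}) \<and>
     (\<forall>\<pi>. separates_orbits val (Gamma 2 s) (Gamma0 2 s) \<pi> \<longrightarrow>
      \<not> (same_position val S (\<pi> ` S) \<pi> \<and> same_position val S' (\<pi> ` S') \<pi>)) \<and>
     (\<not> (\<exists>\<sigma>\<in>carrier PGL2. same_cluster_data val S (\<sigma> ` S'))) \<and>
     (\<not> (\<exists>\<sigma>\<in>carrier PGL2.
        bij_betw ((`) (\<sigma> \<circ> \<phi>)) (clusters val S) (clusters val (\<sigma> ` S')))) \<and>
     ({\<s> \<in> clusters val S. even (card \<s>)} =
      {Fin ` {- 9, 9, 3, 12}, Fin ` {- 9, 9}, Fin ` {3, 12}}) \<and>
     ({\<s> \<in> clusters val S'. even (card \<s>)} =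
      {Fin ` {- 9, 9, 27, 27 / 4}, Fin ` {27, 27 / 4}}) \<and>
     (\<not> same_position val S S' \<phi>) \<and>
     (\<forall>\<psi>. bij_betw \<psi> S S' \<longrightarrow> \<not> same_position val S S' \<psi>)"
proof -
  have index: "i = 0 \<or> i = 1 \<or> i = 2" if "i \<le> 2" for i :: nat using that by auto
  have ab: "a i = E.a i" "b i = E.b i" if "i \<le> 2" for i
    using index[OF that] by (auto simp: a b E_points E_points(2,5)[unfolded One_nat_def])
  have E_unique: "fixing_involutions (E.a i) (E.b i) = {E.s i}" if "i \<le> 2" for i
    using E.s_fixing[OF that] fixing_involutions_unique[OF E.a_b_neq[OF that]] by blast
  have s_eq: "s i = E.s i" if "i \<le> 2" for i
    unfolding s ab[OF that] E_unique[OF that] by simp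
  have a'b': "a' i = E.a' i" "b' i = E.b' i" and s'_eq: "s' i = E.s' i" if "i \<le> 2" for i
    using ab[OF that] s_eq[OF that] ab[of 1] s_eq[of 0] s_eq[of 1]
    by (simp_all add: a' b' s' E.a'_def E.b'_def E.s'_def)
  have E_neq': "E.a' i \<noteq> E.b' i" if "i \<le> 2" for i
    using index[OF that] by (auto simp: E_twisted_points E_twisted_points(2,5)[unfolded One_nat_def])
  have cong: "pair_set 2 a b = pair_set 2 E.a E.b" "Gamma0 2 s = Gamma0 2 E.s"
    "Gamma 2 s = Gamma 2 E.s"
    "superelliptic_pairing val 2 a b s = superelliptic_pairing val 2 E.a E.b E.s"
    by (rule superelliptic_pairing_cong; erule ab s_eq)+
  have cong': "pair_set 2 a' b' = pair_set 2 E.a' E.b'" "Gamma0 2 s' = Gamma0 2 E.s'"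
    "Gamma 2 s' = Gamma 2 E.s'"
    "superelliptic_pairing val 2 a' b' s' = superelliptic_pairing val 2 E.a' E.b' E.s'"
    by (rule superelliptic_pairing_cong; erule a'b' s'_eq)+
  have S_eq: "S = S2" and S'_eq: "S' = S2'"
    unfolding S S' cong(1) cong'(1) by (rule E_pair_set)+
  have sub: "Gamma 2 s \<subseteq> Gamma0 2 s" unfolding cong(2,3) by (rule E.Gamma_subset_Gamma0)
  have S_points: "S = {Fin (- 9), Fin 9, Fin 3, Fin 12, Fin 1, Infty}"
    unfolding S_eq S2_def ..
  have S'_points: "S' = {Fin (- 9), Fin 9, Fin 27, Fin (27 / 4), Fin 1, Infty}"
    unfolding S'_eq S2'_def ..
  have a'_1: "a' 1 = Fin 27" and b'_1: "b' 1 = Fin (27 / 4)"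
    using a'b'[of 1] E_twisted_points(2,5) by simp_all
  have card: "card S = 6" "card S' = 6" using card_S2 by (simp_all add: S_eq S'_eq)
  have \<phi>_image: "\<phi> ` S = S'"
  proof -
    have "\<phi> ` a ` {..2} = a' ` {..2}" "\<phi> ` b ` {..2} = b' ` {..2}"
      unfolding image_image using \<phi> by (auto intro!: image_cong)
    then show ?thesis unfolding S S' pair_set_def image_Un by simp
  qed
  have \<phi>_bij: "bij_betw \<phi> S S'"
    unfolding bij_betw_def
  proof
    have "finite S" using card(1) card_ge_0_finite by force
    then show "inj_on \<phi> S" by (rule eq_card_imp_inj_on) (simp add: \<phi>_image card)
  qed (rule \<phi>_image)
  have s_0: "s 0 = mobius 0 81 1 0" using s_eq[of 0] E_s_0 by simp
  have unique: "\<forall>i\<le>2. fixing_involutions (a i) (b i) = {s i}"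
    using ab s_eq E_unique by simp
  have unique': "\<forall>i\<le>2. fixing_involutions (a' i) (b' i) = {s' i}"
  proof (intro allI impI)
    fix i :: nat assume i: "i \<le> 2"
    show "fixing_involutions (a' i) (b' i) = {s' i}"
      unfolding a'b'[OF i] s'_eq[OF i]
      using E.s'_fixing[OF i] fixing_involutions_unique[OF E_neq'[OF i]] by blast
  qed
  have "{1..2 :: nat} = {1, 2}" by auto
  then have Gamma_gen: "Gamma 2 t = generate PGL2 {t 0 \<circ> t 1, t 0 \<circ> t 2}" for t :: "nat \<Rightarrow> q3z P1 \<Rightarrow> q3z P1"
    by (simp only: Gamma_def image_insert image_empty)
  have twisted: "generate PGL2 {s' 0 \<circ> s' 1, s' 0 \<circ> s' 2} =
      generate PGL2 {inv\<^bsub>PGL2\<^esub> (s 0 \<circ> s 1), s 0 \<circ> s 2}"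
  proof -
    have "s' 0 \<circ> s' 1 = inv\<^bsub>PGL2\<^esub> (s 0 \<circ> s 1)"
      using E.twisted_generator s_eq[of 0] s_eq[of 1] s'_eq[of 0] s'_eq[of 1] by simp
    moreover have "s' 0 \<circ> s' 2 = s 0 \<circ> s 2" by (simp add: s')
    ultimately show ?thesis by (simp only:)
  qed
  have Gamma_eq: "Gamma 2 s' = Gamma 2 s" unfolding cong(3) cong'(3) by (rule E.Gamma_s')
  have twisted_eq: "generate PGL2 {inv\<^bsub>PGL2\<^esub> (s 0 \<circ> s 1), s 0 \<circ> s 2} = Gamma 2 s"
    unfolding twisted[symmetric] Gamma_gen[symmetric] by (rule Gamma_eq)
  have Gamma0_eq: "Gamma0 2 s' = Gamma0 2 s" unfolding cong(2) cong'(2) by (rule E.Gamma0_s')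
  have normal: "Gamma 2 s \<lhd> PGL2\<lparr>carrier := Gamma0 2 s\<rparr>"
    unfolding cong(2,3) by (rule E.Gamma_normal)
  have pairing: "superelliptic_pairing val 2 a b s"
    unfolding cong(4) by (rule E.superelliptic[OF compact_P1])
  have pairing': "superelliptic_pairing val 2 a' b' s'"
    unfolding cong'(4) by (rule E.superelliptic'[OF compact_P1])
  have schottky: "schottky val (Gamma 2 s)" using pairing by (simp add: superelliptic_pairing_def)
  have orbits: "\<forall>z\<in>S. orb (Gamma0 2 s) (\<phi> z) = orb (Gamma0 2 s) z"
  proof
    fix z assume "z \<in> S"
    then obtain i where i: "i \<le> 2" "z = a i \<or> z = b i" by (auto simp: S pair_set_def)
    have "\<phi> z = z \<or> \<phi> z = s 0 z" using \<phi> i by (auto simp: a' b')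
    moreover have "subgroup (Gamma0 2 s) PGL2" unfolding cong(2) by (rule E.Gamma0_subgroup)
    moreover have "s 0 \<in> Gamma0 2 s" unfolding Gamma0_def by (rule generate.incl) simp
    ultimately show "orb (Gamma0 2 s) (\<phi> z) = orb (Gamma0 2 s) z" using orb_subgroup by metis
  qed
  have limits: "S \<inter> limit_points val (Gamma 2 s) = {}" "S' \<inter> limit_points val (Gamma 2 s) = {}"
    using limit_points_S2 limit_points_S2' q3z.limit_points_mono[OF sub]
    unfolding S_eq S'_eq cong(2) by blast+
  have less: "card (tree_verts val S') < card (tree_verts val S)"
    using E.card_tree_verts_less unfolding E_pair_set S_eq S'_eq .
  have differ: "\<not> same_position val S S' \<psi>" for \<psi>
    using less by (intro not_same_position) simp
  have conjecture_fails: "\<forall>\<pi>. separates_orbits val (Gamma 2 s) (Gamma0 2 s) \<pi> \<longrightarrow>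
      \<not> (same_position val S (\<pi> ` S) \<pi> \<and> same_position val S' (\<pi> ` S') \<pi>)"
  proof (intro allI impI notI)
    fix \<pi>
    assume sep: "separates_orbits val (Gamma 2 s) (Gamma0 2 s) \<pi>"
      and same: "same_position val S (\<pi> ` S) \<pi> \<and> same_position val S' (\<pi> ` S') \<pi>"
    have "\<pi> (\<phi> z) = \<pi> z" if z: "z \<in> S" for z
    proof -
      have "\<phi> z \<in> S'" using z \<phi>_image by blast
      then have "z \<in> - limit_points val (Gamma 2 s)" "\<phi> z \<in> - limit_points val (Gamma 2 s)"
        using z limits by blast+
      then show ?thesis using sep orbits z unfolding separates_orbits_def by blast
    qed
    \<comment> \<open>Both sets would have the position of one and the same image, hence equally
      many vertices.\<close>
    then have "\<pi> ` S' = \<pi> ` S" unfolding \<phi>_image[symmetric] image_image by (rule image_cong[OF refl])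
    then have "card (tree_verts val S') = card (tree_verts val (\<pi> ` S))"
      using same not_same_position[of val S' "\<pi> ` S'" \<pi>] by auto
    moreover have "card (tree_verts val S) = card (tree_verts val (\<pi> ` S))"
      using same not_same_position[of val S "\<pi> ` S" \<pi>] by auto
    ultimately show False using less by simp
  qed
  have clusters_differ: "\<not> (\<exists>\<sigma>\<in>carrier PGL2. same_cluster_data val S (\<sigma> ` S'))"
    unfolding S_eq S'_eq using different_cluster_data by blast
  have clusters_differ': "\<not> (\<exists>\<sigma>\<in>carrier PGL2.
      bij_betw ((`) (\<sigma> \<circ> \<phi>)) (clusters val S) (clusters val (\<sigma> ` S')))"
  proof
    assume "\<exists>\<sigma>\<in>carrier PGL2. bij_betw ((`) (\<sigma> \<circ> \<phi>)) (clusters val S) (clusters val (\<sigma> ` S'))"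
    then obtain \<sigma> where \<sigma>: "\<sigma> \<in> carrier PGL2"
      "bij_betw ((`) (\<sigma> \<circ> \<phi>)) (clusters val S) (clusters val (\<sigma> ` S'))" by blast
    have "bij_betw \<sigma> S' (\<sigma> ` S')"
      by (rule inj_on_imp_bij_betw) (rule inj_on_subset[OF PGL2_inj[OF \<sigma>(1)] subset_UNIV])
    then have "bij_betw (\<sigma> \<circ> \<phi>) S (\<sigma> ` S')" by (rule bij_betw_trans[OF \<phi>_bij])
    then have "same_cluster_data val S (\<sigma> ` S')"
      using \<sigma>(2) unfolding same_cluster_data_def by blast
    then show False using clusters_differ \<sigma>(1) by blast
  qed
  note even = even_clusters_S2[folded S_eq] even_clusters_S2'[folded S'_eq]
  show ?thesis
    using differ
    by (intro conjI positions_differ_in_every_genus S_points a'_1 b'_1 S'_points card \<phi>_bij s_0 unique unique' Gamma_gen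
        twisted twisted_eq Gamma0_eq normal schottky pairing pairing' orbits limits conjecture_fails
        clusters_differ clusters_differ' even allI impI) simp_all
qed

end
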